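(* Let $b,\sigma:\mathbb{R}\to\mathbb{R}$ and $K\in L^2_{\mathrm{loc}}(\mathbb{R}_+)$. Suppose there are constants $C,C^*>0$, exponents $\chi_b,\chi_\sigma\in(0,1]$ and $\gamma,\gamma_*>0$ such that $$|b(y)-b(x)|\le C|y-x|^{\chi_b},\quad |\sigma(y)-\sigma(x)|\le C|y-x|^{\chi_\sigma}\quad (x,y\in\mathbb{R}),\qquad C^*t^{2\gamma_*}\le\int_0^tK(s)^2\,\mathrm{d}s\le Ct^{2\gamma}\quad (t\in(0,1]).$$ Put $\lambda(n)=\big(\int_0^{1/n}K(r)^2\,\mathrm{d}r\big)^{-1}$ and suppose: (1) $\gamma_*<\min\{\gamma+\tfrac12,\ \gamma(1+\chi_\sigma)\}$; (2) there exists $\overline{K}\in L^2_{\mathrm{loc}}(\mathbb{R}_+)$ such that for all $0\le s\le t\le1$ $$\lim_{n\to\infty}\lambda(n)\int_0^{s/n}K((t-s)/n+r)K(r)\,\mathrm{d}r=\int_0^s\overline{K}(t-s+r)\overline{K}(r)\,\mathrm{d}r;$$ (3) there is $\overline{\gamma}>0$ such that for every $T>0$ there is $\overline{C}_T>0$ with $\int_0^T|K(s+h)-K(s)|^2\,\mathrm{d}s\le\overline{C}_Th^{2\overline{\gamma}}$ for all $h\in(0,1]$, and $\gamma':=\min\{\gamma,\overline{\gamma}\}=\gamma_*$. Let $v\ge0$ be a continuous weak solution of $$v_t=v_0+\int_0^tK(t-s)\,b(v_s)\,\mathrm{d}s+\int_0^tK(t-s)\,\sigma(v_s)\,\mathrm{d}B_s,\qquad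 t\in\mathbb{R}_+,$$ with deterministic $v_0$ satisfying $\sigma(v_0)>0$, and put $\mathcal{V}_T=\frac1T\int_0^Tv_t\,\mathrm{d}t$ for $T>0$. Let $a\in\mathbb{R}$ and $\beta>0$. Then the small-time limits of the prices $\mathbb{E}[\mathbf{1}_{\{\mathcal{V}_{1/n}\ge v_0+n^{-\beta}a\}}]$ of digital calls with underlying $\mathcal{V}$ and strike $v_0+n^{-\beta}a$ are as follows. (i) If $a=0$, then $\lim_{n\to\infty}\mathbb{E}\big[\mathbf{1}_{\{\mathcal{V}_{1/n}\ge v_0\}}\big]=\tfrac12$. (ii) If $a\ne0$ and $\beta>\gamma_*$, then $\lim_{n\to\infty}\mathbb{E}\big[\mathbf{1}_{\{\mathcal{V}_{1/n}\ge v_0+n^{-\beta}a\}}\big]=\tfrac12$. (iii) If $a\ne0$, $\beta=\gamma_*$ and $\sqrt{\lambda(n)}\sim C_\lambda n^{\gamma_*}$ as $n\to\infty$ for some $C_\lambda>0$, then $$\lim_{n\to\infty}\mathbb{E}\big[\mathbf{1}_{\{\mathcal{V}_{1/n}\ge v_0+n^{-\gamma_*}a\}}\big]=1-\Phi\left(\frac{\sigma(v_0)^{-1}C_\lambda a}{\sqrt{\int_0^1\big(\int_0^s\overline{K}(t)\,\mathrm{d}t\big)^2\,\mathrm{d}s}}\right),$$ where $\Phi$ is the cumulative distribution function of the standard normal distribution.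
   Context: $\mathbb{R}_+=[0,\infty)$. A continuous weak solution is a process with continuous sample paths, adapted on some filtered probability space carrying a real-valued Brownian motion $B$, satisfying the integral equation. $a_n\sim b_n$ means $a_n/b_n\to1$. *)

theory Defs
  imports
    "HOL-Probability.Probability"
    "HOL-Probability.Stopping_Time"
    "HOL-Library.Landau_Symbols"
begin

(* Elements of L^2_loc are classes modulo null sets. They are represented here by a Borel
   function on {0..}; its values at negative arguments are irrelevant. Every integral below that
   involves such a kernel is independent of the chosen representative. *)
definition L2_loc :: "(real \<Rightarrow> real) \<Rightarrow> bool" where
  "L2_loc K \<longleftrightarrow> set_borel_measurable borel {0..} K \<and>
     (\<forall>T>0. set_integrable lborel {0..T} (\<lambda>s. (K s)\<^sup>2))"

definition lam :: "(real \<Rightarrow> real) \<Rightarrow> nat \<Rightarrow> real" where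
  "lam K n = inverse (LBINT r:{0..1 / real n}. (K r)\<^sup>2)"

definition time_average :: "(real \<Rightarrow> 'a \<Rightarrow> real) \<Rightarrow> real \<Rightarrow> 'a \<Rightarrow> real" where
  "time_average v T \<omega> = 1 / T * (LBINT t:{0..T}. v t \<omega>)"

definition digital_call_price ::
    "'a measure \<Rightarrow> (real \<Rightarrow> 'a \<Rightarrow> real) \<Rightarrow> real \<Rightarrow> real \<Rightarrow> real" where
  "digital_call_price M v T k =
     (\<integral>\<omega>. indicat_real {\<omega> \<in> space M. time_average v T \<omega> \<ge> k} \<omega> \<partial>M)"

(* The time index is real, but only F t with t >= 0 plays a role: a filtration indexed by {0..}
   extends by F t = F 0 for t < 0. Completeness and right-continuity are not required. *)
locale filtered_prob_space = prob_space M + filtration "space M" F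
  for M :: "'a measure" and F :: "real \<Rightarrow> 'a measure" +
  assumes sets_F_subset: "0 \<le> t \<Longrightarrow> sets (F t) \<subseteq> sets M"

definition brownian_motion ::
    "'a measure \<Rightarrow> (real \<Rightarrow> 'a measure) \<Rightarrow> (real \<Rightarrow> 'a \<Rightarrow> real) \<Rightarrow> bool" where
  "brownian_motion M F B \<longleftrightarrow>
     (\<forall>t\<ge>0. B t \<in> borel_measurable (F t)) \<and>
     (AE \<omega> in M. B 0 \<omega> = 0) \<and>
     (AE \<omega> in M. continuous_on {0..} (\<lambda>t. B t \<omega>)) \<and>
     (\<forall>s t. 0 \<le> s \<and> s < t \<longrightarrow>
        distributed M lborel (\<lambda>\<omega>. B t \<omega> - B s \<omega>) (normal_density 0 (sqrt (t - s))) \<and>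
        prob_space.indep_set M (sets (F s))
          {(\<lambda>\<omega>. B t \<omega> - B s \<omega>) -` A \<inter> space M | A. A \<in> sets borel})"

definition progressive_on ::
    "(real \<Rightarrow> 'a measure) \<Rightarrow> real \<Rightarrow> (real \<Rightarrow> 'a \<Rightarrow> real) \<Rightarrow> bool" where
  "progressive_on F t H \<longleftrightarrow>
     (\<forall>u\<in>{0..t}. (\<lambda>(s, \<omega>). H s \<omega>) \<in>
        borel_measurable (restrict_space borel {0..u} \<Otimes>\<^sub>M F u))"

(* Data of the simple process sum_{i<m} \<xi>_i 1_{(\<tau>_i, \<tau>_{i+1}]} with bounded F_{\<tau>_i}-measurable \<xi>_i. *)
definition simple_process_data ::
    "'a measure \<Rightarrow> (real \<Rightarrow> 'a measure) \<Rightarrow> nat \<Rightarrow> (nat \<Rightarrow> real) \<Rightarrow> (nat \<Rightarrow> 'a \<Rightarrow> real) \<Rightarrow> bool" where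
  "simple_process_data M F m \<tau> \<xi> \<longleftrightarrow>
     0 \<le> \<tau> 0 \<and>
     (\<forall>i<m. \<tau> i \<le> \<tau> (Suc i) \<and> \<xi> i \<in> borel_measurable (F (\<tau> i)) \<and>
            (\<exists>c. \<forall>\<omega>\<in>space M. \<bar>\<xi> i \<omega>\<bar> \<le> c))"

definition simple_process ::
    "nat \<Rightarrow> (nat \<Rightarrow> real) \<Rightarrow> (nat \<Rightarrow> 'a \<Rightarrow> real) \<Rightarrow> real \<Rightarrow> 'a \<Rightarrow> real" where
  "simple_process m \<tau> \<xi> s \<omega> = (\<Sum>i<m. \<xi> i \<omega> * indicat_real {\<tau> i<..\<tau> (Suc i)} s)"

definition simple_integral ::
    "(real \<Rightarrow> 'a \<Rightarrow> real) \<Rightarrow> nat \<Rightarrow> (nat \<Rightarrow> real) \<Rightarrow> (nat \<Rightarrow> 'a \<Rightarrow> real) \<Rightarrow> real \<Rightarrow> 'a \<Rightarrow> real" where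
  "simple_integral B m \<tau> \<xi> t \<omega> =
     (\<Sum>i<m. \<xi> i \<omega> * (B (min t (\<tau> (Suc i))) \<omega> - B (min t (\<tau> i)) \<omega>))"

(* Ito integral I = int_0^t H_s dB_s of a progressively measurable H with int_0^t H_s^2 ds < oo
   almost surely: limit in probability of the integrals of simple processes H^n such that
   int_0^t (H^n_s - H_s)^2 ds tends to 0 in probability. It is determined only up to almost sure
   equality, hence a relation. The inner integrals are nonnegative (ennreal-valued) ones because
   the Bochner integral would be 0 where the integral diverges. *)
definition has_ito_integral ::
    "'a measure \<Rightarrow> (real \<Rightarrow> 'a measure) \<Rightarrow> (real \<Rightarrow> 'a \<Rightarrow> real) \<Rightarrow>
     (real \<Rightarrow> 'a \<Rightarrow> real) \<Rightarrow> real \<Rightarrow> ('a \<Rightarrow> real) \<Rightarrow> bool" where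
  "has_ito_integral M F B H t I \<longleftrightarrow>
     I \<in> borel_measurable M \<and>
     progressive_on F t H \<and>
     (AE \<omega> in M. (\<integral>\<^sup>+s\<in>{0..t}. ennreal ((H s \<omega>)\<^sup>2) \<partial>lborel) < \<infinity>) \<and>
     (\<exists>m \<tau> \<xi>.
        (\<forall>n. simple_process_data M F (m n) (\<tau> n) (\<xi> n)) \<and>
        (\<forall>\<epsilon>>0. (\<lambda>n. measure M {\<omega> \<in> space M.
            (\<integral>\<^sup>+s\<in>{0..t}. ennreal ((simple_process (m n) (\<tau> n) (\<xi> n) s \<omega> - H s \<omega>)\<^sup>2) \<partial>lborel)
              > ennreal \<epsilon>}) \<longlonglongrightarrow> 0) \<and>
        (\<forall>\<epsilon>>0. (\<lambda>n. measure M {\<omega> \<in> space M.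
            \<bar>simple_integral B (m n) (\<tau> n) (\<xi> n) t \<omega> - I \<omega>\<bar> > \<epsilon>}) \<longlonglongrightarrow> 0))"

(* v solves v_t = v0 + int_0^t K(t-s) b(v_s) ds + int_0^t K(t-s) sigma(v_s) dB_s on (M, F, B).
   For each t the stochastic convolution is the Ito integral over [0,t] of the integrand with
   this t fixed; the equation at t = 0 says that v_0 = v0 almost surely. *)
definition continuous_weak_solution ::
    "(real \<Rightarrow> real) \<Rightarrow> (real \<Rightarrow> real) \<Rightarrow> (real \<Rightarrow> real) \<Rightarrow> real \<Rightarrow>
     'a measure \<Rightarrow> (real \<Rightarrow> 'a measure) \<Rightarrow> (real \<Rightarrow> 'a \<Rightarrow> real) \<Rightarrow> (real \<Rightarrow> 'a \<Rightarrow> real) \<Rightarrow> bool" where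
  "continuous_weak_solution K b \<sigma> v0 M F B v \<longleftrightarrow>
     filtered_prob_space M F \<and>
     brownian_motion M F B \<and>
     (\<forall>t\<ge>0. v t \<in> borel_measurable (F t)) \<and>
     (\<forall>\<omega>\<in>space M. continuous_on {0..} (\<lambda>t. v t \<omega>)) \<and>
     (\<forall>t\<ge>0. \<exists>I. has_ito_integral M F B (\<lambda>s \<omega>. K (t - s) * \<sigma> (v s \<omega>)) t I \<and>
        (AE \<omega> in M. v t \<omega> = v0 + (LBINT s:{0..t}. K (t - s) * b (v s \<omega>)) + I \<omega>))"

end

theory Submission
  imports Defs
begin

text \<open>The quantity to understand is the normalised deviation
\<open>sqrt (\<lambda> n) * (\<V> - v0)\<close>, where \<open>\<V>\<close> is the average of \<open>v\<close> over \<open>[0, 1/n]\<close>. It converges in law to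
a centred normal variable with standard deviation \<open>\<sigma> v0 * sqrt S\<close>, where \<open>S\<close> is the integral over
\<open>[0,1]\<close> of the square of the primitive of \<open>Kbar\<close>. The three limits are then values of the normal
distribution function, because the normalised strike \<open>sqrt (\<lambda> n) * n powr (- \<beta>) * a\<close> tends to \<open>0\<close> in
the first two cases and to \<open>Clam * a\<close> in the third.

For fixed \<open>n\<close> the average is replaced by a Riemann sum over a grid with \<open>N n\<close> points, where \<open>N n\<close> is so
large that the error is negligible. By linearity, the Riemann sum is \<open>v0\<close> plus an average of drift terms
plus one single stochastic integral, with integrand \<open>k s * \<sigma> (v s)\<close>, where \<open>k\<close> is the average over
the grid of the kernels \<open>s \<mapsto> K (t - s)\<close>; this takes the place of a stochastic Fubini theorem. The
normalisation is exactly such that \<open>\<lambda> n\<close> times the energy of \<open>K\<close> on \<open>[0, 1/n]\<close> is \<open>1\<close>. Consequently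
\<open>\<lambda> n\<close> times the energy of \<open>k\<close> is at most \<open>1\<close>, and on the event that \<open>v\<close> stays close to \<open>v0\<close> up to time
\<open>1/n\<close>, whose probability tends to \<open>1\<close> by continuity of the paths,
\<^item> the normalised drift is of order \<open>sqrt (1/n)\<close> by the Cauchy-Schwarz inequality, and
\<^item> replacing \<open>\<sigma> (v s)\<close> by \<open>\<sigma> v0\<close> changes the normalised integrand little in \<open>L\<^sup>2\<close>, pathwise.

A pathwise \<open>L\<^sup>2\<close> bound controls a stochastic integral in probability: this is the inequality
\<open>P (\<bar>\<integral> H dB\<bar> > \<epsilon>) \<le> P (\<integral> H\<^sup>2 > \<delta>) + c * \<delta> / \<epsilon>\<^sup>2\<close>, proved by stopping simple processes when their energy
exceeds \<open>\<delta>\<close> (\<open>step_sum_tail_bound\<close>, \<open>stoch_integral_tail_bound\<close>). The comparison variable is the integral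
of a deterministic step function, which is exactly normal (\<open>step_sum_normal\<close>). The step function is found
by freezing one good path in a simple process that approximates the integrand
(\<open>stoch_integral_frozen_path\<close>).

What remains is the variance: \<open>\<lambda> n\<close> times the energy of \<open>k\<close> is a double Riemann sum of normalised
covariances \<open>\<lambda> n * \<langle>K (s/n - \<cdot>), K (t/n - \<cdot>)\<rangle>\<close>. These are bounded by \<open>1\<close>, converge pointwise by
assumption, and are equicontinuous in \<open>(s, t)\<close> uniformly in \<open>n\<close>, since the Hoelder exponent of \<open>K\<close> in
\<open>L\<^sup>2\<close> matches the growth of \<open>\<lambda> n\<close>. Dominated convergence and Fubini give the limit \<open>S\<close>
(\<open>averaged_kern_energy_limit\<close>). It is positive because the limit covariance at \<open>s = t = 1\<close> forces
\<open>Kbar\<close> to have energy \<open>1\<close> on \<open>[0,1]\<close>.\<close>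

section \<open>Square-integrable functions and truncated kernels\<close>

definition sq_integrable :: "'b measure \<Rightarrow> ('b \<Rightarrow> real) \<Rightarrow> bool" where
  "sq_integrable N f \<longleftrightarrow> f \<in> borel_measurable N \<and> integrable N (\<lambda>x. (f x)\<^sup>2)"

lemma sq_integrable_mult:
  assumes "sq_integrable N f" "sq_integrable N g"
  shows "integrable N (\<lambda>x. f x * g x)"
proof (rule Bochner_Integration.integrable_bound[of N "\<lambda>x. (f x)\<^sup>2 + (g x)\<^sup>2"])
  show "AE x in N. norm (f x * g x) \<le> norm ((f x)\<^sup>2 + (g x)\<^sup>2)"
  proof (rule AE_I2)
    fix x
    have "2 * (\<bar>f x\<bar> * \<bar>g x\<bar>) \<le> (f x)\<^sup>2 + (g x)\<^sup>2"
      using sum_squares_bound[of "\<bar>f x\<bar>" "\<bar>g x\<bar>"] by simp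
    moreover have "0 \<le> \<bar>f x\<bar> * \<bar>g x\<bar>" by simp
    ultimately have "\<bar>f x\<bar> * \<bar>g x\<bar> \<le> (f x)\<^sup>2 + (g x)\<^sup>2" by linarith
    then show "norm (f x * g x) \<le> norm ((f x)\<^sup>2 + (g x)\<^sup>2)" by (simp add: abs_mult)
  qed
qed (use assms in \<open>auto simp: sq_integrable_def\<close>)

lemma sq_integrable_cmult: "sq_integrable N f \<Longrightarrow> sq_integrable N (\<lambda>x. c * f x)"
  by (auto simp: sq_integrable_def power_mult_distrib)

lemma sq_integrable_add:
  assumes "sq_integrable N f" "sq_integrable N g"
  shows "sq_integrable N (\<lambda>x. f x + g x)"
  using assms sq_integrable_mult[OF assms]
  by (auto simp: sq_integrable_def power2_sum mult.assoc)

lemma sq_integrable_diff: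
  assumes "sq_integrable N f" "sq_integrable N g"
  shows "sq_integrable N (\<lambda>x. f x - g x)"
  using sq_integrable_add[OF assms(1) sq_integrable_cmult[OF assms(2), of "-1"]] by simp

lemma sq_integrable_sum:
  assumes "finite J" "\<And>j. j \<in> J \<Longrightarrow> sq_integrable N (f j)"
  shows "sq_integrable N (\<lambda>x. \<Sum>j\<in>J. f j x)"
  using assms by (induction J rule: finite_induct) (auto intro: sq_integrable_add, auto simp: sq_integrable_def)

lemma integral_mult_le_L2:
  assumes "sq_integrable N f" "sq_integrable N g"
  shows "\<bar>\<integral>x. f x * g x \<partial>N\<bar> \<le> sqrt (\<integral>x. (f x)\<^sup>2 \<partial>N) * sqrt (\<integral>x. (g x)\<^sup>2 \<partial>N)"
proof -
  have [measurable]: "f \<in> borel_measurable N" "g \<in> borel_measurable N"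
    and i: "integrable N (\<lambda>x. (f x)\<^sup>2)" "integrable N (\<lambda>x. (g x)\<^sup>2)"
    using assms by (auto simp: sq_integrable_def)
  have ifg: "integrable N (\<lambda>x. \<bar>f x * g x\<bar>)" using sq_integrable_mult[OF assms] by (rule integrable_abs)
  have "ennreal ((\<integral>x. \<bar>f x * g x\<bar> \<partial>N)\<^sup>2) = (\<integral>\<^sup>+x. ennreal \<bar>f x\<bar> * ennreal \<bar>g x\<bar> \<partial>N)\<^sup>2"
    using nn_integral_eq_integral[OF ifg] by (simp add: ennreal_mult'[symmetric] abs_mult ennreal_power)
  also have "\<dots> \<le> (\<integral>\<^sup>+x. (ennreal \<bar>f x\<bar>)\<^sup>2 \<partial>N) * (\<integral>\<^sup>+x. (ennreal \<bar>g x\<bar>)\<^sup>2 \<partial>N)"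
    by (rule Cauchy_Schwarz_nn_integral) measurable
  also have "\<dots> = ennreal ((\<integral>x. (f x)\<^sup>2 \<partial>N) * (\<integral>x. (g x)\<^sup>2 \<partial>N))"
    using nn_integral_eq_integral[OF i(1)] nn_integral_eq_integral[OF i(2)]
    by (simp add: ennreal_power ennreal_mult')
  finally have "(\<integral>x. \<bar>f x * g x\<bar> \<partial>N)\<^sup>2 \<le> (\<integral>x. (f x)\<^sup>2 \<partial>N) * (\<integral>x. (g x)\<^sup>2 \<partial>N)"
    by (subst (asm) ennreal_le_iff) simp_all
  then have "\<bar>\<integral>x. \<bar>f x * g x\<bar> \<partial>N\<bar> \<le> sqrt ((\<integral>x. (f x)\<^sup>2 \<partial>N) * (\<integral>x. (g x)\<^sup>2 \<partial>N))"
    by (rule real_le_rsqrt[of "\<bar>_\<bar>", simplified])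
  then have "(\<integral>x. \<bar>f x * g x\<bar> \<partial>N) \<le> sqrt (\<integral>x. (f x)\<^sup>2 \<partial>N) * sqrt (\<integral>x. (g x)\<^sup>2 \<partial>N)"
    by (simp add: real_sqrt_mult)
  with integral_abs_bound[of N "\<lambda>x. f x * g x"] show ?thesis by (rule order_trans)
qed

text \<open>The reverse triangle inequality in \<open>L\<^sup>2\<close>: expand the square of the difference
  and bound the mixed term by Cauchy-Schwarz.\<close>

lemma L2_norm_diff_le:
  assumes "sq_integrable N f" "sq_integrable N g"
  shows "\<bar>sqrt (\<integral>x. (f x)\<^sup>2 \<partial>N) - sqrt (\<integral>x. (g x)\<^sup>2 \<partial>N)\<bar> \<le> sqrt (\<integral>x. (f x - g x)\<^sup>2 \<partial>N)"
proof -
  let ?n = "\<lambda>f. sqrt (\<integral>x. (f x)\<^sup>2 \<partial>N)"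
  have i: "integrable N (\<lambda>x. (f x)\<^sup>2)" "integrable N (\<lambda>x. (g x)\<^sup>2)"
    using assms by (auto simp: sq_integrable_def)
  have "(\<integral>x. (f x - g x)\<^sup>2 \<partial>N) = (\<integral>x. (f x)\<^sup>2 + (g x)\<^sup>2 - 2 * (f x * g x) \<partial>N)"
    by (simp add: power2_diff mult.assoc)
  also have "\<dots> = (\<integral>x. (f x)\<^sup>2 \<partial>N) + (\<integral>x. (g x)\<^sup>2 \<partial>N) - 2 * (\<integral>x. f x * g x \<partial>N)"
    using i sq_integrable_mult[OF assms] by simp
  also have "\<dots> \<ge> (?n f)\<^sup>2 + (?n g)\<^sup>2 - 2 * (?n f * ?n g)"
    using integral_mult_le_L2[OF assms] by simp
  finally have "(?n f - ?n g)\<^sup>2 \<le> (\<integral>x. (f x - g x)\<^sup>2 \<partial>N)" by (simp add: power2_diff mult.assoc)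
  then have "sqrt ((?n f - ?n g)\<^sup>2) \<le> ?n (\<lambda>x. f x - g x)" by (rule real_sqrt_le_mono)
  then show ?thesis by simp
qed

abbreviation energy :: "(real \<Rightarrow> real) \<Rightarrow> ennreal" where
  "energy f \<equiv> \<integral>\<^sup>+s. ennreal ((f s)\<^sup>2) \<partial>lborel"

text \<open>A form of the triangle inequality for energies that may be infinite, from \<open>(f + g)\<^sup>2
  \<le> 2 * f\<^sup>2 + 2 * g\<^sup>2\<close>.\<close>

lemma energy_add_le:
  assumes "f \<in> borel_measurable borel" "g \<in> borel_measurable borel"
    and "energy f \<le> ennreal a" "energy g \<le> ennreal c" "0 \<le> a" "0 \<le> c"
  shows "energy (\<lambda>s. f s + g s) \<le> ennreal (2 * a + 2 * c)"
proof -
  have [measurable]: "f \<in> borel_measurable lborel" "g \<in> borel_measurable lborel" using assms by auto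
  have "energy (\<lambda>s. f s + g s) \<le> (\<integral>\<^sup>+s. 2 * ennreal ((f s)\<^sup>2) + 2 * ennreal ((g s)\<^sup>2) \<partial>lborel)"
  proof (rule nn_integral_mono)
    fix s
    have "(f s + g s)\<^sup>2 \<le> 2 * (f s)\<^sup>2 + 2 * (g s)\<^sup>2"
      using sum_squares_bound[of "f s" "g s"] by (simp add: power2_sum)
    then have "ennreal ((f s + g s)\<^sup>2) \<le> ennreal (2 * (f s)\<^sup>2 + 2 * (g s)\<^sup>2)" by (rule ennreal_leI)
    then show "ennreal ((f s + g s)\<^sup>2) \<le> 2 * ennreal ((f s)\<^sup>2) + 2 * ennreal ((g s)\<^sup>2)"
      by (simp add: ennreal_mult')
  qed
  also have "\<dots> = 2 * energy f + 2 * energy g" by (simp add: nn_integral_add nn_integral_cmult)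
  also have "\<dots> \<le> 2 * ennreal a + 2 * ennreal c" using assms by (intro add_mono mult_left_mono) auto
  also have "\<dots> = ennreal (2 * a + 2 * c)"
    using assms ennreal_mult'[of 2 a] ennreal_mult'[of 2 c] by (subst ennreal_plus) auto
  finally show ?thesis .
qed

lemma nn_integral_square_le:
  assumes "sq_integrable lborel k" "\<And>s. \<bar>f s\<bar> \<le> c * \<bar>k s\<bar>" "0 \<le> c"
  shows "energy f \<le> ennreal (c\<^sup>2 * (\<integral>s. (k s)\<^sup>2 \<partial>lborel))"
proof -
  have "energy f \<le> (\<integral>\<^sup>+s. ennreal (c\<^sup>2 * (k s)\<^sup>2) \<partial>lborel)"
  proof (rule nn_integral_mono, rule ennreal_leI)
    fix s
    have "\<bar>f s\<bar>\<^sup>2 \<le> (c * \<bar>k s\<bar>)\<^sup>2" by (rule power_mono[OF assms(2)]) simp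
    then show "(f s)\<^sup>2 \<le> c\<^sup>2 * (k s)\<^sup>2" by (simp add: power_mult_distrib)
  qed
  also have "\<dots> = ennreal (\<integral>s. c\<^sup>2 * (k s)\<^sup>2 \<partial>lborel)"
    using assms(1) by (intro nn_integral_eq_integral) (auto simp: sq_integrable_def)
  finally show ?thesis by simp
qed

text \<open>Truncation to \<open>[0, t]\<close> turns the convolution kernels into functions on the whole
  line, so that covariances over varying intervals become scalar products in one space
  \<open>L\<^sup>2\<close>.\<close>

definition kern :: "(real \<Rightarrow> real) \<Rightarrow> real \<Rightarrow> real \<Rightarrow> real" where
  "kern K t u = indicat_real {0..t} u * K (t - u)"

lemma L2_loc_measurable:
  assumes "L2_loc K"
  shows "(\<lambda>x. indicat_real {0..} x * K x) \<in> borel_measurable borel"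
  using assms by (simp add: L2_loc_def set_borel_measurable_def)

lemma L2_loc_integrable:
  assumes "L2_loc K"
  shows "set_integrable lborel {0..t} (\<lambda>s. (K s)\<^sup>2)"
proof -
  have "set_integrable lborel {0..max 1 t} (\<lambda>s. (K s)\<^sup>2)" using assms by (simp add: L2_loc_def)
  then show ?thesis by (rule set_integrable_subset) auto
qed

lemma kern_pair_measurable:
  assumes "L2_loc K"
  shows "(\<lambda>(t, u). kern K t u) \<in> borel_measurable (borel \<Otimes>\<^sub>M borel)"
proof -
  note [measurable] = L2_loc_measurable[OF assms]
  have eq: "(\<lambda>(t, u). kern K t u) = (\<lambda>z. indicat_real {z. 0 \<le> snd z \<and> snd z \<le> fst z} z *
      (indicat_real {0..} (fst z - snd z) * K (fst z - snd z)))"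
    by (auto simp: kern_def indicator_def fun_eq_iff)
  show ?thesis unfolding eq by measurable
qed

lemma kern_measurable:
  assumes "L2_loc K"
  shows "kern K t \<in> borel_measurable borel"
  using measurable_compose[OF measurable_Pair1'[of t] kern_pair_measurable[OF assms]] by simp

lemma kern_reflect:
  "kern K t (t - u) = indicat_real {0..t} u * K u"
  by (auto simp: kern_def indicator_def)

lemma kern_sq_integrable:
  assumes "L2_loc K"
  shows "sq_integrable lborel (kern K t)"
  unfolding sq_integrable_def
proof
  show "kern K t \<in> borel_measurable lborel" using kern_measurable[OF assms] by simp
  have "(\<lambda>u. (kern K t (t + (-1) * u))\<^sup>2) = (\<lambda>u. indicat_real {0..t} u *\<^sub>R (K u)\<^sup>2)"
    by (auto simp: kern_reflect indicator_def fun_eq_iff)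
  then have "integrable lborel (\<lambda>u. (kern K t (t + (-1) * u))\<^sup>2)"
    using L2_loc_integrable[OF assms, of t] by (simp add: set_integrable_def)
  then show "integrable lborel (\<lambda>u. (kern K t u)\<^sup>2)"
    by (subst (asm) lborel_integrable_real_affine_iff[of "-1" "\<lambda>u. (kern K t u)\<^sup>2"]) auto
qed

text \<open>The reflection \<open>u = s - r\<close> produces the form in which covariances of \<open>K\<close>
  are given in the theorem.\<close>

lemma kern_covariance:
  assumes "s \<le> t"
  shows "(\<integral>u. kern K s u * kern K t u \<partial>lborel) = (LBINT r:{0..s}. K (t - s + r) * K r)"
proof -
  have "(\<integral>u. kern K s u * kern K t u \<partial>lborel) = (\<integral>r. kern K s (s + (-1) * r) * kern K t (s + (-1) * r) \<partial>lborel)"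
    by (subst lborel_integral_real_affine[of "-1" _ s]) auto
  also have "\<dots> = (\<integral>r. indicat_real {0..s} r * (K (t - s + r) * K r) \<partial>lborel)"
    using assms by (intro Bochner_Integration.integral_cong) (auto simp: kern_def indicator_def algebra_simps)
  finally show ?thesis by (simp add: set_lebesgue_integral_def)
qed

lemma kern_energy:
  "(\<integral>u. (kern K t u)\<^sup>2 \<partial>lborel) = (LBINT r:{0..t}. (K r)\<^sup>2)"
  using kern_covariance[of t t K] by (simp add: power2_eq_square)

text \<open>On \<open>[0, s]\<close> the two kernels differ by a shift of \<open>K\<close>; on \<open>(s,
  t]\<close> only the one for \<open>t\<close> is present and contributes its initial energy.\<close>

lemma kern_increment:
  assumes K: "L2_loc K" and st: "0 \<le> s" "s \<le> t" "t \<le> T"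
  shows "(\<integral>u. (kern K t u - kern K s u)\<^sup>2 \<partial>lborel) \<le>
    (LBINT r:{0..T}. \<bar>K (r + (t - s)) - K r\<bar>\<^sup>2) + (LBINT r:{0..t - s}. (K r)\<^sup>2)"
proof -
  let ?h = "t - s"
  have [measurable]: "kern K a \<in> borel_measurable borel" for a by (rule kern_measurable[OF K])
  have i1: "integrable lborel (\<lambda>r. indicat_real {0..T} r * (K (r + ?h) - K r)\<^sup>2)"
  proof -
    have "sq_integrable lborel (\<lambda>r. kern K (T + ?h) (T + (-1) * r) - kern K T (T + (-1) * r))"
    proof (rule sq_integrable_diff; unfold sq_integrable_def, intro conjI)
      show "integrable lborel (\<lambda>r. (kern K (T + ?h) (T + (-1) * r))\<^sup>2)"
        by (rule lborel_integrable_real_affine) (use kern_sq_integrable[OF K] in \<open>auto simp: sq_integrable_def\<close>)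
      show "integrable lborel (\<lambda>r. (kern K T (T + (-1) * r))\<^sup>2)"
        by (rule lborel_integrable_real_affine) (use kern_sq_integrable[OF K] in \<open>auto simp: sq_integrable_def\<close>)
      show "(\<lambda>r. kern K (T + ?h) (T + (-1) * r)) \<in> borel_measurable lborel" "(\<lambda>r. kern K T (T + (-1) * r)) \<in> borel_measurable lborel"
        by measurable
    qed
    then have "integrable lborel (\<lambda>r. indicat_real {0..T} r *\<^sub>R (kern K (T + ?h) (T + (-1) * r) - kern K T (T + (-1) * r))\<^sup>2)"
      by (intro integrable_mult_indicator) (auto simp: sq_integrable_def)
    also have "(\<lambda>r. indicat_real {0..T} r *\<^sub>R (kern K (T + ?h) (T + (-1) * r) - kern K T (T + (-1) * r))\<^sup>2) =
       (\<lambda>r. indicat_real {0..T} r * (K (r + ?h) - K r)\<^sup>2)"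
      using st by (auto simp: kern_def indicator_def fun_eq_iff algebra_simps)
    finally show ?thesis .
  qed
  have i2: "integrable lborel (\<lambda>r. indicat_real {0..?h} (?h + 1 * r) * (K (?h + 1 * r))\<^sup>2)"
    by (rule lborel_integrable_real_affine)
      (use L2_loc_integrable[OF K, of ?h] in \<open>auto simp: set_integrable_def\<close>)
  have "(\<integral>u. (kern K t u - kern K s u)\<^sup>2 \<partial>lborel) = (\<integral>r. (kern K t (s + (-1) * r) - kern K s (s + (-1) * r))\<^sup>2 \<partial>lborel)"
    by (subst lborel_integral_real_affine[of "-1" _ s]) auto
  also have "\<dots> \<le> (\<integral>r. indicat_real {0..T} r * (K (r + ?h) - K r)\<^sup>2 + indicat_real {0..?h} (?h + 1 * r) * (K (?h + 1 * r))\<^sup>2 \<partial>lborel)"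
    using st by (intro integral_mono' Bochner_Integration.integrable_add i1 i2) (auto simp: kern_def indicator_def algebra_simps)
  also have "\<dots> = (\<integral>r. indicat_real {0..T} r * (K (r + ?h) - K r)\<^sup>2 \<partial>lborel) + (\<integral>r. indicat_real {0..?h} (?h + 1 * r) * (K (?h + 1 * r))\<^sup>2 \<partial>lborel)"
    by (intro Bochner_Integration.integral_add i1 i2)
  also have "(\<integral>r. indicat_real {0..?h} (?h + 1 * r) * (K (?h + 1 * r))\<^sup>2 \<partial>lborel) = (LBINT r:{0..?h}. (K r)\<^sup>2)"
    using lborel_integral_real_affine[of 1 "\<lambda>r. indicat_real {0..?h} r * (K r)\<^sup>2" ?h] by (simp add: set_lebesgue_integral_def)
  finally show ?thesis by (simp add: set_lebesgue_integral_def)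
qed

section \<open>Double Riemann sums and integrated covariances\<close>

definition cell :: "nat \<Rightarrow> nat \<Rightarrow> real set" where
  "cell N i = {(real i - 1) / real N<..real i / real N}"

lemma cell_measurable [measurable]: "cell N i \<in> sets borel"
  by (simp add: cell_def)

text \<open>The cells of a grid are half open so that they partition \<open>(0, 1]\<close>: a point lies in
  exactly one of them, and its number is a ceiling.\<close>

lemma sum_over_cells:
  assumes "1 \<le> N" "x \<in> {0<..1}"
  shows "nat \<lceil>real N * x\<rceil> \<in> {1..N}"
    "(\<Sum>i=1..N. f i * indicat_real (cell N i) x) = f (nat \<lceil>real N * x\<rceil>)"
    "\<bar>real (nat \<lceil>real N * x\<rceil>) / real N - x\<bar> \<le> 1 / real N"
proof -
  have N: "0 < real N" using assms by simp
  define k where "k = nat \<lceil>real N * x\<rceil>"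
  have pos: "0 < real N * x" "real N * x \<le> real N"
    using assms N mult_left_mono[of x 1 "real N"] by auto
  define c where "c = \<lceil>real N * x\<rceil>"
  have c1: "1 \<le> c" using pos(1) zero_less_ceiling[of "real N * x"] unfolding c_def by linarith
  have "c \<le> int N" using pos(2) unfolding c_def by (simp only: ceiling_le_iff of_int_of_nat_eq)
  with c1 have "nat c \<in> {1..N}" by auto
  then show k1: "nat \<lceil>real N * x\<rceil> \<in> {1..N}" by (simp only: c_def)
  have kk: "real k - 1 < real N * x" "real N * x \<le> real k"
    using c1 ceiling_correct[of "real N * x"] unfolding k_def c_def[symmetric] by auto
  have iff: "x \<in> cell N i \<longleftrightarrow> i = k" for i
  proof -
    have "x \<in> cell N i \<longleftrightarrow> real i - 1 < real N * x \<and> real N * x \<le> real i"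
      using N by (simp add: cell_def field_simps)
    also have "\<dots> \<longleftrightarrow> i = k"
    proof
      assume "real i - 1 < real N * x \<and> real N * x \<le> real i"
      then have "real i < real k + 1" "real k < real i + 1" using kk by linarith+
      then show "i = k" by linarith
    qed (use kk in simp)
    finally show ?thesis .
  qed
  have "(\<Sum>i=1..N. f i * indicat_real (cell N i) x) = (\<Sum>i=1..N. if i = k then f i else 0)"
    by (intro sum.cong refl) (auto simp: indicator_def iff)
  then show "(\<Sum>i=1..N. f i * indicat_real (cell N i) x) = f (nat \<lceil>real N * x\<rceil>)"
    using k1 by (simp add: k_def)
  have "real k / real N - x = (real k - real N * x) / real N" using N by (simp add: field_simps)
  then have "\<bar>real k / real N - x\<bar> = \<bar>real k - real N * x\<bar> / real N" using N by (simp add: abs_divide)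
  also have "\<dots> \<le> 1 / real N" using kk N by (intro divide_right_mono) auto
  finally show "\<bar>real (nat \<lceil>real N * x\<rceil>) / real N - x\<bar> \<le> 1 / real N" unfolding k_def .
qed

lemma grid_point_tendsto:
  assumes N: "\<And>n. 1 \<le> N n" "filterlim N at_top sequentially" and x: "x \<in> {0<..1}"
  shows "(\<lambda>n. real (nat \<lceil>real (N n) * x\<rceil>) / real (N n)) \<longlonglongrightarrow> x"
proof (rule Lim_null_comparison[THEN LIM_zero_cancel])
  show "\<forall>\<^sub>F n in sequentially. norm (real (nat \<lceil>real (N n) * x\<rceil>) / real (N n) - x) \<le> 1 / real (N n)"
    using sum_over_cells(3)[OF N(1) x] by auto
  show "(\<lambda>n. 1 / real (N n)) \<longlonglongrightarrow> 0"
    using N(2) by (intro tendsto_divide_0[OF tendsto_const] filterlim_at_top_imp_at_infinity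
        filterlim_compose[OF filterlim_real_sequentially])
qed

lemma cell_outside:
  assumes "1 \<le> N" "i \<in> {1..N}" "x \<notin> {0<..1}"
  shows "indicat_real (cell N i) x = 0"
proof -
  have "0 \<le> (real i - 1) / real N" "real i / real N \<le> 1" using assms by auto
  then have "cell N i \<subseteq> {0<..1}" unfolding cell_def by auto
  then show ?thesis using assms(3) by (auto simp: indicator_def)
qed

lemma integral_cell_product:
  assumes "1 \<le> N"
  shows "integrable (lborel \<Otimes>\<^sub>M lborel) (\<lambda>z. indicat_real (cell N i) (fst z) * indicat_real (cell N j) (snd z))"
    "(\<integral>z. indicat_real (cell N i) (fst z) * indicat_real (cell N j) (snd z) \<partial>(lborel \<Otimes>\<^sub>M lborel)) = 1 / (real N)\<^sup>2"
proof -
  have eq: "(\<lambda>z. indicat_real (cell N i) (fst z) * indicat_real (cell N j) (snd z)) = indicat_real (cell N i \<times> cell N j)"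
    by (auto simp: indicator_def fun_eq_iff)
  have N: "0 < real N" using assms by simp
  have len: "emeasure lborel (cell N k) = ennreal (1 / real N)" for k
    using N by (simp add: cell_def divide_right_mono diff_divide_distrib[symmetric])
  have em: "emeasure (lborel \<Otimes>\<^sub>M lborel) (cell N i \<times> cell N j) = ennreal (1 / (real N)\<^sup>2)"
    using N by (subst lborel.emeasure_pair_measure_Times) (auto simp: len ennreal_mult'[symmetric] power2_eq_square)
  have ms: "cell N i \<times> cell N j \<in> sets (lborel \<Otimes>\<^sub>M lborel)" by (intro pair_measureI) (auto simp: cell_def)
  show "integrable (lborel \<Otimes>\<^sub>M lborel) (\<lambda>z. indicat_real (cell N i) (fst z) * indicat_real (cell N j) (snd z))"
    unfolding eq using em ms by (intro integrable_real_indicator) auto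
  show "(\<integral>z. indicat_real (cell N i) (fst z) * indicat_real (cell N j) (snd z) \<partial>(lborel \<Otimes>\<^sub>M lborel)) = 1 / (real N)\<^sup>2"
    unfolding eq using em ms by (simp add: measure_def)
qed

text \<open>A double Riemann sum is the integral of a step function over the unit square, so dominated
  convergence applies. The sampling points move with \<open>n\<close>, hence the functions have to converge
  continuously and not just pointwise.\<close>

lemma double_riemann_sums:
  fixes G :: "nat \<Rightarrow> real \<Rightarrow> real \<Rightarrow> real"
  assumes N: "\<And>n. 1 \<le> N n" "filterlim N at_top sequentially"
    and bound: "\<And>n s t. s \<in> {0..1} \<Longrightarrow> t \<in> {0..1} \<Longrightarrow> \<bar>G n s t\<bar> \<le> 1"
    and conv: "\<And>x y s t. x \<in> {0..1} \<Longrightarrow> y \<in> {0..1} \<Longrightarrow> (\<And>n. s n \<in> {0..1}) \<Longrightarrow> (\<And>n. t n \<in> {0..1}) \<Longrightarrow>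
      s \<longlonglongrightarrow> x \<Longrightarrow> t \<longlonglongrightarrow> y \<Longrightarrow> (\<lambda>n. G n (s n) (t n)) \<longlonglongrightarrow> c x y"
  shows "(\<lambda>n. (\<Sum>i=1..N n. \<Sum>j=1..N n. G n (real i / real (N n)) (real j / real (N n))) / (real (N n))\<^sup>2)
    \<longlonglongrightarrow> (\<integral>z. indicat_real {0<..1} (fst z) * indicat_real {0<..1} (snd z) * c (fst z) (snd z) \<partial>(lborel \<Otimes>\<^sub>M lborel))"
proof -
  let ?P = "lborel \<Otimes>\<^sub>M lborel :: (real \<times> real) measure"
  let ?i = "indicat_real {0<..1}"
  define \<phi> where "\<phi> n x = real (nat \<lceil>real (N n) * x\<rceil>) / real (N n)" for n x
  define Fn where "Fn n z = (\<Sum>i=1..N n. \<Sum>j=1..N n. G n (real i / real (N n)) (real j / real (N n)) *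
     (indicat_real (cell (N n) i) (fst z) * indicat_real (cell (N n) j) (snd z)))" for n z
  have int: "(\<integral>z. Fn n z \<partial>?P) = (\<Sum>i=1..N n. \<Sum>j=1..N n. G n (real i / real (N n)) (real j / real (N n))) / (real (N n))\<^sup>2" for n
    unfolding Fn_def using integral_cell_product[OF N(1)[of n]]
    by (simp add: Bochner_Integration.integral_sum Bochner_Integration.integrable_sum sum_divide_distrib)
  have Fn_eq: "Fn n z = ?i (fst z) * ?i (snd z) * G n (\<phi> n (fst z)) (\<phi> n (snd z))" for n z
  proof (cases "fst z \<in> {0<..1} \<and> snd z \<in> {0<..1}")
    case True
    have "Fn n z = (\<Sum>i=1..N n. (\<Sum>j=1..N n. G n (real i / real (N n)) (real j / real (N n)) *
        indicat_real (cell (N n) j) (snd z)) * indicat_real (cell (N n) i) (fst z))"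
      unfolding Fn_def sum_distrib_right by (intro sum.cong refl) (simp only: ac_simps)
    also have "\<dots> = (\<Sum>i=1..N n. G n (real i / real (N n)) (\<phi> n (snd z)) * indicat_real (cell (N n) i) (fst z))"
      using True by (simp only: sum_over_cells(2)[OF N(1)] \<phi>_def)
    also have "\<dots> = G n (\<phi> n (fst z)) (\<phi> n (snd z))"
      using True sum_over_cells(2)[OF N(1), of "fst z" "\<lambda>i. G n (real i / real (N n)) (\<phi> n (snd z))"]
      by (simp only: \<phi>_def)
    finally show ?thesis using True by simp
  next
    case False
    then show ?thesis using cell_outside[OF N(1)[of n]] by (auto simp: Fn_def intro!: sum.neutral)
  qed
  have phi: "\<phi> n x \<in> {0..1}" if "x \<in> {0<..1}" for n x
    using sum_over_cells(1)[OF N(1)[of n] that] N(1)[of n] by (auto simp: \<phi>_def)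
  have philim: "(\<lambda>n. \<phi> n x) \<longlonglongrightarrow> x" if "x \<in> {0<..1}" for x
    unfolding \<phi>_def by (rule grid_point_tendsto[OF N that])
  have lim: "(\<lambda>n. Fn n z) \<longlonglongrightarrow> ?i (fst z) * ?i (snd z) * c (fst z) (snd z)" for z
  proof (cases "fst z \<in> {0<..1} \<and> snd z \<in> {0<..1}")
    case True
    then have "(\<lambda>n. G n (\<phi> n (fst z)) (\<phi> n (snd z))) \<longlonglongrightarrow> c (fst z) (snd z)"
      by (intro conv phi philim) auto
    then show ?thesis using True by (simp add: Fn_eq)
  qed (auto simp: Fn_eq)
  have meas: "Fn n \<in> borel_measurable ?P" for n
    unfolding Fn_def by measurable
  have "(\<lambda>n. \<integral>z. Fn n z \<partial>?P) \<longlonglongrightarrow> (\<integral>z. ?i (fst z) * ?i (snd z) * c (fst z) (snd z) \<partial>?P)"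
  \<comment> \<open>the only cell of the trivial grid is \<open>(0, 1]\<close> itself\<close>
  proof (rule integral_dominated_convergence[where w="\<lambda>z. indicat_real (cell 1 1) (fst z) * indicat_real (cell 1 1) (snd z)"])
    show "(\<lambda>z. ?i (fst z) * ?i (snd z) * c (fst z) (snd z)) \<in> borel_measurable ?P"
      by (rule borel_measurable_LIMSEQ_real[OF lim meas])
    show "AE z in ?P. norm (Fn n z) \<le> indicat_real (cell 1 1) (fst z) * indicat_real (cell 1 1) (snd z)" for n
      using bound[OF phi phi] by (intro AE_I2) (auto simp: Fn_eq cell_def indicator_def)
  qed (use lim meas integral_cell_product(1)[of 1 1 1] in auto)
  then show ?thesis unfolding int .
qed

text \<open>By Fubini the integrated scalar products are the square norm of the integrated kernel
  \<open>\<integral> kern K x u dx\<close>, which is the primitive of \<open>K\<close> at \<open>1 -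
  u\<close>; a reflection of \<open>u\<close> removes the \<open>1 - u\<close>.\<close>

lemma integral_kern_covariance:
  assumes K: "L2_loc K"
  shows "(\<integral>z. indicat_real {0<..1} (fst z) * indicat_real {0<..1} (snd z) *
      (\<integral>u. kern K (fst z) u * kern K (snd z) u \<partial>lborel) \<partial>(lborel \<Otimes>\<^sub>M lborel)) =
    (LBINT s:{0..1}. (LBINT t:{0..s}. K t)\<^sup>2)"
proof -
  let ?P = "lborel \<Otimes>\<^sub>M lborel :: (real \<times> real) measure"
  define a where "a x u = indicat_real {0<..1} x * kern K x u" for x u
  define h where "h = (\<lambda>(z, u). a (fst z) u * a (snd z) u)"
  interpret P: pair_sigma_finite ?P "lborel :: real measure"
    unfolding lborel_prod by unfold_locales
  have am: "(\<lambda>(x, u). a x u) \<in> borel_measurable (borel \<Otimes>\<^sub>M borel)"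
    using kern_pair_measurable[OF K] unfolding a_def split_beta' by measurable
  have hm: "h \<in> borel_measurable (?P \<Otimes>\<^sub>M lborel)"
  proof -
    have "(\<lambda>w. a (fst (fst w)) (snd w)) \<in> borel_measurable (?P \<Otimes>\<^sub>M lborel)"
    proof -
      have "(\<lambda>w. (fst (fst w), snd w)) \<in> measurable (?P \<Otimes>\<^sub>M lborel) (borel \<Otimes>\<^sub>M borel)" by measurable
      from measurable_compose[OF this am] show ?thesis by simp
    qed
    moreover have "(\<lambda>w. a (snd (fst w)) (snd w)) \<in> borel_measurable (?P \<Otimes>\<^sub>M lborel)"
    proof -
      have "(\<lambda>w. (snd (fst w), snd w)) \<in> measurable (?P \<Otimes>\<^sub>M lborel) (borel \<Otimes>\<^sub>M borel)" by measurable
      from measurable_compose[OF this am] show ?thesis by simp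
    qed
    ultimately show ?thesis unfolding h_def split_beta' by (rule borel_measurable_times)
  qed
  define c where "c = (LBINT r:{0..1}. (K r)\<^sup>2)"
  have asq: "sq_integrable lborel (a x)" for x
    unfolding a_def by (rule sq_integrable_cmult[OF kern_sq_integrable[OF K]])
  have c0: "0 \<le> c" unfolding c_def set_lebesgue_integral_def by (intro integral_nonneg_AE AE_I2) auto
  have energy: "(\<integral>u. (a x u)\<^sup>2 \<partial>lborel) \<le> indicat_real (cell 1 1) x * c" for x
  proof (cases "x \<in> {0<..1}")
    case True
    have "(LBINT r:{0..x}. (K r)\<^sup>2) \<le> c"
      unfolding c_def set_lebesgue_integral_def
      using L2_loc_integrable[OF K] True by (intro integral_mono) (auto simp: set_integrable_def indicator_def)
    then show ?thesis using True by (simp add: a_def kern_energy cell_def)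
  qed (use c0 in \<open>auto simp: a_def indicator_def\<close>)
  have hi: "integrable (?P \<Otimes>\<^sub>M lborel) h"
  proof (rule P.Fubini_integrable[OF hm])
    show "AE z in ?P. integrable lborel (\<lambda>u. h (z, u))"
      by (intro AE_I2) (simp add: h_def sq_integrable_mult[OF asq asq])
    show "integrable ?P (\<lambda>z. \<integral>u. norm (h (z, u)) \<partial>lborel)"
    proof (rule Bochner_Integration.integrable_bound)
      show "integrable ?P (\<lambda>z. c * (indicat_real (cell 1 1) (fst z) * indicat_real (cell 1 1) (snd z)))"
        using integral_cell_product(1)[of 1 1 1] by simp
      show "(\<lambda>z. \<integral>u. norm (h (z, u)) \<partial>lborel) \<in> borel_measurable ?P"
        using hm by measurable
      show "AE z in ?P. norm (\<integral>u. norm (h (z, u)) \<partial>lborel) \<le> norm (c * (indicat_real (cell 1 1) (fst z) * indicat_real (cell 1 1) (snd z)))"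
      proof (rule AE_I2)
        fix z :: "real \<times> real"
        have absq: "sq_integrable lborel (\<lambda>u. \<bar>a x u\<bar>)" for x
          using asq[of x] by (auto simp: sq_integrable_def)
        have "(\<integral>u. norm (h (z, u)) \<partial>lborel) = (\<integral>u. \<bar>a (fst z) u\<bar> * \<bar>a (snd z) u\<bar> \<partial>lborel)"
          by (simp add: h_def abs_mult)
        also have "\<dots> \<le> sqrt (\<integral>u. (a (fst z) u)\<^sup>2 \<partial>lborel) * sqrt (\<integral>u. (a (snd z) u)\<^sup>2 \<partial>lborel)"
          using integral_mult_le_L2[OF absq[of "fst z"] absq[of "snd z"]] by simp
        also have "\<dots> \<le> sqrt (indicat_real (cell 1 1) (fst z) * c) * sqrt (indicat_real (cell 1 1) (snd z) * c)"
          using c0 by (intro mult_mono real_sqrt_le_mono energy) auto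
        also have "\<dots> = c * (indicat_real (cell 1 1) (fst z) * indicat_real (cell 1 1) (snd z))"
          using c0 by (auto simp: indicator_def)
        finally show "norm (\<integral>u. norm (h (z, u)) \<partial>lborel) \<le> norm (c * (indicat_real (cell 1 1) (fst z) * indicat_real (cell 1 1) (snd z)))"
          using c0 by simp
      qed
    qed
  qed
  define J where "J s = (LBINT t:{0..s}. K t)" for s
  have inner: "(\<integral>x. a x u \<partial>lborel) = indicat_real {0..1} u * J (1 - u)" if "u \<noteq> 0" for u
  proof -
    have "(\<integral>x. a x u \<partial>lborel) = (\<integral>r. a (u + 1 * r) u \<partial>lborel)"
      by (subst lborel_integral_real_affine[of 1 _ u]) auto
    also have "\<dots> = (\<integral>r. indicat_real {0..1} u * (indicat_real {0..1 - u} r * K r) \<partial>lborel)"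
      using that by (intro Bochner_Integration.integral_cong) (auto simp: a_def kern_def indicator_def)
    finally show ?thesis by (simp add: J_def set_lebesgue_integral_def)
  qed
  have "(\<integral>z. indicat_real {0<..1} (fst z) * indicat_real {0<..1} (snd z) *
      (\<integral>u. kern K (fst z) u * kern K (snd z) u \<partial>lborel) \<partial>?P) = (\<integral>z. (\<integral>u. h (z, u) \<partial>lborel) \<partial>?P)"
  proof (intro Bochner_Integration.integral_cong refl)
    fix z :: "real \<times> real"
    have "(\<integral>u. h (z, u) \<partial>lborel) = (\<integral>u. (indicat_real {0<..1} (fst z) * indicat_real {0<..1} (snd z)) * (kern K (fst z) u * kern K (snd z) u) \<partial>lborel)"
      by (intro Bochner_Integration.integral_cong) (auto simp: h_def a_def)
    then show "indicat_real {0<..1} (fst z) * indicat_real {0<..1} (snd z) * (\<integral>u. kern K (fst z) u * kern K (snd z) u \<partial>lborel) = (\<integral>u. h (z, u) \<partial>lborel)"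
      by simp
  qed
  also have "\<dots> = (\<integral>u. (\<integral>z. h (z, u) \<partial>?P) \<partial>lborel)"
    using P.Fubini_integral[of "\<lambda>z u. h (z, u)"] hi by simp
  also have "\<dots> = (\<integral>u. indicat_real {0..1} u * (J (1 - u))\<^sup>2 \<partial>lborel)"
  proof (rule integral_cong_AE)
    have "AE u in lborel. integrable ?P (\<lambda>z. h (z, u))"
      using P.AE_integrable_snd[of "\<lambda>z u. h (z, u)"] hi by simp
    with AE_lborel_singleton[of 0]
    have ae: "AE u in lborel. (\<integral>z. h (z, u) \<partial>?P) = indicat_real {0..1} u * (J (1 - u))\<^sup>2"
    proof eventually_elim
      case (elim u)
      have "(\<integral>z. h (z, u) \<partial>?P) = (\<integral>x. (\<integral>y. h ((x, y), u) \<partial>lborel) \<partial>lborel)"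
        using lborel_pair.integral_fst'[OF elim(2)] by simp
      also have "\<dots> = (\<integral>x. a x u \<partial>lborel)\<^sup>2"
        by (simp add: h_def power2_eq_square)
      also have "\<dots> = indicat_real {0..1} u * (J (1 - u))\<^sup>2"
        using inner[OF elim(1)] by (auto simp: indicator_def)
      finally show ?case .
    qed
    then show "AE u in lborel. (\<integral>z. h (z, u) \<partial>?P) = indicat_real {0..1} u * (J (1 - u))\<^sup>2" .
    show "(\<lambda>u. \<integral>z. h (z, u) \<partial>?P) \<in> borel_measurable lborel"
      using P.integrable_snd[of "\<lambda>z u. h (z, u)"] hi by (auto intro: borel_measurable_integrable)
    have Jm: "J \<in> borel_measurable borel"
    proof -
      have "(\<lambda>s. \<integral>x. kern K s x \<partial>lborel) \<in> borel_measurable borel"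
        using kern_pair_measurable[OF K] by measurable
      moreover have "(\<integral>x. kern K s x \<partial>lborel) = J s" for s
      proof -
        have "(\<integral>x. kern K s x \<partial>lborel) = (\<integral>x. kern K s (s + (-1) * x) \<partial>lborel)"
          by (subst lborel_integral_real_affine[of "-1" _ s]) auto
        then show ?thesis by (simp add: kern_reflect J_def set_lebesgue_integral_def)
      qed
      ultimately show ?thesis by (simp add: J_def[abs_def])
    qed
    then show "(\<lambda>u. indicat_real {0..1} u * (J (1 - u))\<^sup>2) \<in> borel_measurable lborel" by measurable
  qed
  also have "\<dots> = (\<integral>u. indicat_real {0..1} (1 + (-1) * u) * (J (1 - (1 + (-1) * u)))\<^sup>2 \<partial>lborel)"
    by (subst lborel_integral_real_affine[of "-1" _ 1]) auto
  also have "\<dots> = (LBINT s:{0..1}. (J s)\<^sup>2)"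
    unfolding set_lebesgue_integral_def by (intro Bochner_Integration.integral_cong) (auto simp: indicator_def)
  finally show ?thesis by (simp add: J_def)
qed

text \<open>The measures whose densities are the positive and the negative part of \<open>f\<close> agree on
  all rays, which determine a measure.\<close>

lemma AE_zero_of_integral_rays_zero:
  fixes f :: "real \<Rightarrow> real"
  assumes f: "integrable lborel f" and z: "\<And>x. (\<integral>u. indicat_real {x<..} u * f u \<partial>lborel) = 0"
  shows "AE u in lborel. f u = 0"
proof -
  have [measurable]: "f \<in> borel_measurable borel" using f by auto
  define p q where "p u = max 0 (f u)" and "q u = max 0 (- f u)" for u
  have [measurable]: "p \<in> borel_measurable borel" "q \<in> borel_measurable borel"
    unfolding p_def[abs_def] q_def[abs_def] by measurable
  have pq: "integrable lborel p" "integrable lborel q"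
    using f unfolding p_def[abs_def] q_def[abs_def] by (intro integrable_max; simp)+
  have ip: "integrable lborel (\<lambda>u. indicat_real {x<..} u * g u)" if "integrable lborel g" for x :: real and g
    using integrable_mult_indicator[of "{x<..}" lborel g] that by simp
  have em: "emeasure (density lborel (\<lambda>u. ennreal (g u))) {x<..} = ennreal (\<integral>u. indicat_real {x<..} u * g u \<partial>lborel)"
    if g: "integrable lborel g" "\<And>u. 0 \<le> g u" "g \<in> borel_measurable borel" for g and x :: real
  proof -
    have "emeasure (density lborel (\<lambda>u. ennreal (g u))) {x<..} = (\<integral>\<^sup>+u. ennreal (indicat_real {x<..} u * g u) \<partial>lborel)"
      using g(3) by (subst emeasure_density) (auto intro!: nn_integral_cong simp: indicator_def)
    also have "\<dots> = ennreal (\<integral>u. indicat_real {x<..} u * g u \<partial>lborel)"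
      using g ip[OF g(1)] by (intro nn_integral_eq_integral) auto
    finally show ?thesis .
  qed
  have pn: "0 \<le> p u" "0 \<le> q u" "p u - q u = f u" for u by (auto simp: p_def q_def)
  have "density lborel (\<lambda>u. ennreal (p u)) = density lborel (\<lambda>u. ennreal (q u))"
  proof (rule measure_eqI_lessThan)
    fix x
    have "(\<integral>u. indicat_real {x<..} u * p u \<partial>lborel) - (\<integral>u. indicat_real {x<..} u * q u \<partial>lborel) =
        (\<integral>u. indicat_real {x<..} u * f u \<partial>lborel)"
      by (subst Bochner_Integration.integral_diff[symmetric]) (auto simp: pn(3)[symmetric] right_diff_distrib intro!: ip pq)
    then show "emeasure (density lborel (\<lambda>u. ennreal (p u))) {x<..} = emeasure (density lborel (\<lambda>u. ennreal (q u))) {x<..}"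
      using z[of x] by (simp add: em pq pn)
  qed (simp_all add: em pq pn)
  then have "AE u in lborel. ennreal (p u) = ennreal (q u)"
    by (intro sigma_finite_measure.density_unique[OF sigma_finite_lborel]) auto
  then show ?thesis
    by eventually_elim (auto simp: p_def q_def max_def split: if_splits)
qed

text \<open>The primitive of \<open>K\<close> is continuous. If its square had integral zero, it would vanish
  on \<open>[0,1]\<close>, and then \<open>K\<close> would vanish almost everywhere there.\<close>

lemma integrated_kernel_energy_pos:
  assumes K: "L2_loc K" and pos: "(LBINT r:{0..1}. (K r)\<^sup>2) \<noteq> 0"
  shows "0 < (LBINT s:{0..1}. (LBINT t:{0..s}. K t)\<^sup>2)"
proof (rule ccontr)
  define J where "J s = (LBINT t:{0..s}. K t)" for s
  define f where "f u = indicat_real {0..1} u * K u" for u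
  have fm: "f \<in> borel_measurable borel"
  proof -
    have "f = (\<lambda>u. indicat_real {0..1} u * (indicat_real {0..} u * K u))" by (auto simp: f_def indicator_def fun_eq_iff)
    then show ?thesis using L2_loc_measurable[OF K] by simp
  qed
  have fsq: "sq_integrable lborel f"
  proof -
    have "(\<lambda>u. (f u)\<^sup>2) = (\<lambda>u. indicat_real {0..1} u *\<^sub>R (K u)\<^sup>2)" by (auto simp: f_def indicator_def fun_eq_iff)
    then show ?thesis using fm L2_loc_integrable[OF K, of 1] by (simp add: sq_integrable_def set_integrable_def)
  qed
  have isq: "sq_integrable lborel (indicat_real {0..1::real})"
  proof -
    have "(\<lambda>u. (indicat_real {0..1::real} u)\<^sup>2) = indicat_real {0..1}" by (auto simp: indicator_def fun_eq_iff)
    then show ?thesis by (simp add: sq_integrable_def integrable_real_indicator)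
  qed
  have fi: "integrable lborel f"
  proof -
    have "(\<lambda>u. indicat_real {0..1} u * f u) = f" by (auto simp: f_def indicator_def fun_eq_iff)
    then show ?thesis using sq_integrable_mult[OF isq fsq] by simp
  qed
  have Ki: "set_integrable lborel {0..s} K" if "s \<le> 1" for s
  proof (rule set_integrable_subset)
    show "set_integrable lborel {0..1} K" using fi by (simp add: f_def[abs_def] set_integrable_def)
  qed (use that in auto)
  have Jeq: "J s = integral {0..s} K" if "s \<le> 1" for s
    unfolding J_def using set_borel_integral_eq_integral(2)[OF Ki[OF that]] .
  have cont: "continuous_on {0..1} (\<lambda>s. (J s)\<^sup>2)"
  proof -
    have "continuous_on {0..1} (\<lambda>s. integral {0..s} K)"
      using set_borel_integral_eq_integral(1)[OF Ki[of 1]] by (intro indefinite_integral_continuous_1) auto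
    then have "continuous_on {0..1} J" by (rule continuous_on_eq) (use Jeq in auto)
    then show ?thesis by (intro continuous_intros)
  qed
  have Jint: "(LBINT s:{0..1}. (J s)\<^sup>2) = integral {0..1} (\<lambda>s. (J s)\<^sup>2)"
    by (rule set_borel_integral_eq_integral(2)[OF borel_integrable_atLeastAtMost'[OF cont]])
  assume "\<not> 0 < (LBINT s:{0..1}. (LBINT t:{0..s}. K t)\<^sup>2)"
  then have "(LBINT s:{0..1}. (J s)\<^sup>2) \<le> 0" by (simp add: J_def)
  moreover have "0 \<le> (LBINT s:{0..1}. (J s)\<^sup>2)"
    unfolding set_lebesgue_integral_def by (intro integral_nonneg_AE AE_I2) auto
  ultimately have "integral {0..1} (\<lambda>s. (J s)\<^sup>2) = 0" using Jint by simp
  then have J0: "J s = 0" if "s \<in> {0..1}" for s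
    using integral_eq_0_iff[OF cont] that by auto
  have "(\<integral>u. indicat_real {x<..} u * f u \<partial>lborel) = 0" for x
  proof -
    have "(\<integral>u. indicat_real {x<..} u * f u \<partial>lborel) = (\<integral>u. f u - indicat_real {..x} u * f u \<partial>lborel)"
      by (intro Bochner_Integration.integral_cong) (auto simp: indicator_def)
    also have "\<dots> = (\<integral>u. f u \<partial>lborel) - (\<integral>u. indicat_real {..x} u * f u \<partial>lborel)"
      using fi integrable_mult_indicator[of "{..x}" lborel f] by (intro Bochner_Integration.integral_diff) auto
    also have "(\<integral>u. f u \<partial>lborel) = J 1" by (simp add: J_def f_def[abs_def] set_lebesgue_integral_def)
    also have "(\<integral>u. indicat_real {..x} u * f u \<partial>lborel) = J (min x 1)"
      unfolding J_def set_lebesgue_integral_def by (intro Bochner_Integration.integral_cong) (auto simp: f_def indicator_def)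
    also have "J (min x 1) = 0"
      using J0[of "min x 1"] by (cases "x < 0") (auto simp: J_def set_lebesgue_integral_def)
    finally show ?thesis using J0[of 1] by simp
  qed
  then have "AE u in lborel. f u = 0" by (rule AE_zero_of_integral_rays_zero[OF fi])
  then have "AE u in lborel. (f u)\<^sup>2 = 0" by eventually_elim simp
  then have "(\<integral>u. (f u)\<^sup>2 \<partial>lborel) = 0" by (rule integral_eq_zero_AE)
  moreover have "(\<integral>u. (f u)\<^sup>2 \<partial>lborel) = (LBINT r:{0..1}. (K r)\<^sup>2)"
    unfolding set_lebesgue_integral_def by (intro Bochner_Integration.integral_cong) (auto simp: f_def indicator_def)
  ultimately show False using pos by simp
qed

section \<open>The kernel at small times\<close>

locale small_time_kernel =
  fixes K Kbar :: "real \<Rightarrow> real" and C Cs \<gamma> \<gamma>s \<gamma>bar :: real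
  assumes K: "L2_loc K"
    and const_pos: "C > 0" "Cs > 0" "\<gamma>s > 0"
    and K_bounds: "\<And>t. t \<in> {0<..1} \<Longrightarrow>
          Cs * t powr (2 * \<gamma>s) \<le> (LBINT s:{0..t}. (K s)\<^sup>2) \<and>
          (LBINT s:{0..t}. (K s)\<^sup>2) \<le> C * t powr (2 * \<gamma>)"
    and Kbar: "L2_loc Kbar"
    and covariance_limit: "\<And>s t. 0 \<le> s \<Longrightarrow> s \<le> t \<Longrightarrow> t \<le> 1 \<Longrightarrow>
          (\<lambda>n. lam K n * (LBINT r:{0..s / real n}. K ((t - s) / real n + r) * K r))
            \<longlonglongrightarrow> (LBINT r:{0..s}. Kbar (t - s + r) * Kbar r)"
    and shift_bound: "\<exists>CT>0. \<forall>h\<in>{0<..1}.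
          (LBINT s:{0..1}. \<bar>K (s + h) - K s\<bar>\<^sup>2) \<le> CT * h powr (2 * \<gamma>bar)"
    and min_exponent: "min \<gamma> \<gamma>bar = \<gamma>s"
begin

lemma energy_pos: "t \<in> {0<..1} \<Longrightarrow> 0 < (LBINT s:{0..t}. (K s)\<^sup>2)"
  by (rule less_le_trans[OF _ K_bounds[THEN conjunct1]]) (use const_pos in simp_all)

lemma lam_pos: "1 \<le> n \<Longrightarrow> 0 < lam K n"
  using energy_pos[of "1 / real n"] by (simp add: lam_def)

lemma lam_times_energy: "1 \<le> n \<Longrightarrow> lam K n * (LBINT s:{0..1 / real n}. (K s)\<^sup>2) = 1"
  using energy_pos[of "1 / real n"] by (simp add: lam_def)

lemma lam_upper:
  assumes "1 \<le> n"
  shows "lam K n \<le> real n powr (2 * \<gamma>s) / Cs"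
proof -
  have t: "1 / real n \<in> {0<..1}" using assms by (simp only: greaterThanAtMost_iff) (simp add: divide_le_eq)
  have "lam K n \<le> inverse (Cs * (1 / real n) powr (2 * \<gamma>s))"
    unfolding lam_def using K_bounds[OF t] const_pos assms by (intro le_imp_inverse_le) auto
  also have "\<dots> = real n powr (2 * \<gamma>s) / Cs"
    using assms by (simp add: powr_divide field_simps)
  finally show ?thesis .
qed

lemma scaled_kern_energy_le:
  assumes "1 \<le> n" "s \<in> {0..1}"
  shows "lam K n * (\<integral>u. (kern K (s / real n) u)\<^sup>2 \<partial>lborel) \<le> 1"
proof -
  have "(\<integral>u. (kern K (s / real n) u)\<^sup>2 \<partial>lborel) = (LBINT r:{0..s / real n}. (K r)\<^sup>2)"
    by (rule kern_energy)
  also have "\<dots> \<le> (LBINT r:{0..1 / real n}. (K r)\<^sup>2)"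
    unfolding set_lebesgue_integral_def
  proof (rule integral_mono)
    fix r
    have "s / real n \<le> 1 / real n" using assms by (intro divide_right_mono) auto
    then show "indicat_real {0..s / real n} r *\<^sub>R (K r)\<^sup>2 \<le> indicat_real {0..1 / real n} r *\<^sub>R (K r)\<^sup>2"
      by (auto simp: indicator_def)
  qed (use L2_loc_integrable[OF K] in \<open>auto simp: set_integrable_def\<close>)
  finally have "lam K n * (\<integral>u. (kern K (s / real n) u)\<^sup>2 \<partial>lborel) \<le> lam K n * (LBINT r:{0..1 / real n}. (K r)\<^sup>2)"
    using lam_pos[OF assms(1)] by (intro mult_left_mono) auto
  then show ?thesis using lam_times_energy[OF assms(1)] by simp
qed

definition shift_const :: real where
  "shift_const = (SOME c. 0 < c \<and> (\<forall>h\<in>{0<..1}. (LBINT s:{0..1}. \<bar>K (s + h) - K s\<bar>\<^sup>2) \<le> c * h powr (2 * \<gamma>bar)))"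

lemma shift_const:
  "0 < shift_const" "h \<in> {0<..1} \<Longrightarrow> (LBINT s:{0..1}. \<bar>K (s + h) - K s\<bar>\<^sup>2) \<le> shift_const * h powr (2 * \<gamma>bar)"
proof -
  have "0 < shift_const \<and> (\<forall>h\<in>{0<..1}. (LBINT s:{0..1}. \<bar>K (s + h) - K s\<bar>\<^sup>2) \<le> shift_const * h powr (2 * \<gamma>bar))"
    unfolding shift_const_def by (rule someI_ex[OF shift_bound[unfolded Bex_def]])
  then show "0 < shift_const" "h \<in> {0<..1} \<Longrightarrow> (LBINT s:{0..1}. \<bar>K (s + h) - K s\<bar>\<^sup>2) \<le> shift_const * h powr (2 * \<gamma>bar)"
    by auto
qed

text \<open>The point is uniformity in \<open>n\<close>. Both the shift and the initial energy are at most of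
  order \<open>h powr (2 * \<gamma>s)\<close> for \<open>h = (t - s) / n\<close>, because
  \<open>\<gamma>s\<close> is the smaller one of the two exponents; the resulting factor \<open>n powr (- 2 *
  \<gamma>s)\<close> cancels the growth of \<open>lam K n\<close>.\<close>

lemma scaled_kern_increment_le:
  assumes n: "1 \<le> n" and "s \<in> {0..1}" "t \<in> {0..1}"
  shows "lam K n * (\<integral>u. (kern K (t / real n) u - kern K (s / real n) u)\<^sup>2 \<partial>lborel)
    \<le> (shift_const + C) / Cs * \<bar>t - s\<bar> powr (2 * \<gamma>s)"
  using assms(2,3)
proof (induction s t rule: linorder_wlog)
  case (le s t)
  show ?case
  proof (cases "s = t")
    case False
    define h where "h = (t - s) / real n"
    have h: "0 < h" "h \<le> 1" using False le n by (auto simp: h_def field_simps)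
    have "t / real n \<le> t" using le n mult_left_mono[of 1 "real n" t] by (simp add: divide_le_eq)
    then have "t / real n \<le> 1" using le by simp
    then have "(\<integral>u. (kern K (t / real n) u - kern K (s / real n) u)\<^sup>2 \<partial>lborel)
        \<le> (LBINT r:{0..1}. \<bar>K (r + h) - K r\<bar>\<^sup>2) + (LBINT r:{0..h}. (K r)\<^sup>2)"
      using kern_increment[OF K, of "s / real n" "t / real n" 1] le n
      by (simp add: h_def divide_right_mono diff_divide_distrib)
    also have "\<dots> \<le> shift_const * h powr (2 * \<gamma>bar) + C * h powr (2 * \<gamma>)"
      using h by (intro add_mono shift_const K_bounds[THEN conjunct2]) auto
    also have "\<dots> \<le> shift_const * h powr (2 * \<gamma>s) + C * h powr (2 * \<gamma>s)"
      using h const_pos shift_const(1) min_exponent by (intro add_mono mult_left_mono powr_mono') auto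
    finally have "lam K n * (\<integral>u. (kern K (t / real n) u - kern K (s / real n) u)\<^sup>2 \<partial>lborel)
        \<le> (real n powr (2 * \<gamma>s) / Cs) * ((shift_const + C) * h powr (2 * \<gamma>s))"
      using lam_pos[OF n] lam_upper[OF n] const_pos
      by (intro mult_mono) (auto simp: distrib_right intro!: integral_nonneg_AE)
    also have "\<dots> = (shift_const + C) / Cs * \<bar>t - s\<bar> powr (2 * \<gamma>s)"
      using le n by (simp add: h_def powr_divide)
    finally show ?thesis .
  qed simp
next
  case (sym s t)
  then show ?case by (simp add: power2_commute[of "kern K (s / real n) _"] abs_minus_commute)
qed

definition scaled_cov :: "nat \<Rightarrow> real \<Rightarrow> real \<Rightarrow> real" where
  "scaled_cov n s t = lam K n * (\<integral>u. kern K (s / real n) u * kern K (t / real n) u \<partial>lborel)"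

lemma scaled_cov_le_1:
  assumes "1 \<le> n" "s \<in> {0..1}" "t \<in> {0..1}"
  shows "\<bar>scaled_cov n s t\<bar> \<le> 1"
proof -
  let ?e = "\<lambda>s. \<integral>u. (kern K (s / real n) u)\<^sup>2 \<partial>lborel"
  have L: "0 < lam K n" using lam_pos[OF assms(1)] .
  have "\<bar>scaled_cov n s t\<bar> \<le> lam K n * (sqrt (?e s) * sqrt (?e t))"
    using L integral_mult_le_L2[OF kern_sq_integrable[OF K] kern_sq_integrable[OF K]]
    by (simp add: scaled_cov_def abs_mult)
  also have "\<dots> = (sqrt (lam K n) * sqrt (lam K n)) * (sqrt (?e s) * sqrt (?e t))"
    using L by simp
  also have "\<dots> = sqrt (lam K n * ?e s) * sqrt (lam K n * ?e t)"
    by (simp only: real_sqrt_mult ac_simps)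
  also have "\<dots> \<le> 1 * 1"
    using scaled_kern_energy_le[OF assms(1,2)] scaled_kern_energy_le[OF assms(1,3)] L
    by (intro mult_mono) (auto intro!: integral_nonneg_AE)
  finally show ?thesis by simp
qed

text \<open>Cauchy-Schwarz splits the normalisation \<open>lam K n\<close> evenly between an increment of the
  kernel and a kernel of normalised energy at most \<open>1\<close>.\<close>

lemma scaled_cov_modulus:
  assumes n: "1 \<le> n" and "s \<in> {0..1}" "t \<in> {0..1}" "x \<in> {0..1}"
  shows "\<bar>scaled_cov n s t - scaled_cov n x t\<bar> \<le> sqrt ((shift_const + C) / Cs * \<bar>s - x\<bar> powr (2 * \<gamma>s))"
proof -
  let ?k = "\<lambda>s. kern K (s / real n)"
  let ?e = "\<integral>u. (?k t u)\<^sup>2 \<partial>lborel" and ?d = "\<integral>u. (?k s u - ?k x u)\<^sup>2 \<partial>lborel"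
  have L: "0 < lam K n" using lam_pos[OF n] .
  note sq = kern_sq_integrable[OF K]
  have "scaled_cov n s t - scaled_cov n x t = lam K n * (\<integral>u. (?k s u - ?k x u) * ?k t u \<partial>lborel)"
    using sq_integrable_mult[OF sq sq] by (simp add: scaled_cov_def left_diff_distrib right_diff_distrib)
  then have "\<bar>scaled_cov n s t - scaled_cov n x t\<bar> \<le> lam K n * (sqrt ?d * sqrt ?e)"
    using L integral_mult_le_L2[OF sq_integrable_diff[OF sq sq] sq] by (simp add: abs_mult)
  also have "\<dots> = (sqrt (lam K n) * sqrt (lam K n)) * (sqrt ?d * sqrt ?e)"
    using L by simp
  also have "\<dots> = sqrt (lam K n * ?d) * sqrt (lam K n * ?e)"
    by (simp only: real_sqrt_mult ac_simps)
  also have "\<dots> \<le> sqrt ((shift_const + C) / Cs * \<bar>s - x\<bar> powr (2 * \<gamma>s)) * 1"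
  proof (rule mult_mono)
    show "sqrt (lam K n * ?d) \<le> sqrt ((shift_const + C) / Cs * \<bar>s - x\<bar> powr (2 * \<gamma>s))"
      by (rule real_sqrt_le_mono[OF scaled_kern_increment_le[OF n assms(4) assms(2)]])
    show "sqrt (lam K n * ?e) \<le> 1" using scaled_kern_energy_le[OF n assms(3)] by simp
    show "0 \<le> sqrt ((shift_const + C) / Cs * \<bar>s - x\<bar> powr (2 * \<gamma>s))"
      using shift_const(1) const_pos by simp
    show "0 \<le> sqrt (lam K n * ?e)" using L by (simp add: integral_nonneg_AE)
  qed
  finally show ?thesis by simp
qed

lemma scaled_cov_commute: "scaled_cov n s t = scaled_cov n t s"
  by (simp add: scaled_cov_def mult.commute)

lemma scaled_cov_pointwise_limit:
  assumes "x \<in> {0..1}" "y \<in> {0..1}"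
  shows "(\<lambda>n. scaled_cov n x y) \<longlonglongrightarrow> (\<integral>u. kern Kbar x u * kern Kbar y u \<partial>lborel)"
  using assms
proof (induction x y rule: linorder_wlog)
  case (le x y)
  have "scaled_cov n x y = lam K n * (LBINT r:{0..x / real n}. K ((y - x) / real n + r) * K r)" for n
    unfolding scaled_cov_def using kern_covariance[of "x / real n" "y / real n" K] le
    by (simp add: divide_right_mono diff_divide_distrib)
  then show ?case using covariance_limit[of x y] le by (simp add: kern_covariance)
next
  case (sym x y)
  then show ?case by (simp add: scaled_cov_commute[of _ x y] mult.commute)
qed

text \<open>Pointwise convergence together with the modulus of continuity, which does not depend on
  \<open>n\<close>, gives convergence along moving arguments.\<close>

lemma scaled_cov_limit:
  assumes "x \<in> {0..1}" "y \<in> {0..1}" and s: "\<And>n. s n \<in> {0..1}" and t: "\<And>n. t n \<in> {0..1}"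
    and "s \<longlonglongrightarrow> x" "t \<longlonglongrightarrow> y"
  shows "(\<lambda>n. scaled_cov (Suc n) (s n) (t n)) \<longlonglongrightarrow> (\<integral>u. kern Kbar x u * kern Kbar y u \<partial>lborel)"
proof -
  define m where "m a b = sqrt ((shift_const + C) / Cs * \<bar>a - b :: real\<bar> powr (2 * \<gamma>s))" for a b
  have m0: "(\<lambda>n. m (f n) z) \<longlonglongrightarrow> 0" if "f \<longlonglongrightarrow> z" for f :: "nat \<Rightarrow> real" and z
  proof -
    have "(\<lambda>n. \<bar>f n - z\<bar>) \<longlonglongrightarrow> 0" using that by (intro tendsto_rabs_zero) (simp add: LIM_zero)
    then have "(\<lambda>n. \<bar>f n - z\<bar> powr (2 * \<gamma>s)) \<longlonglongrightarrow> 0"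
      using const_pos by (intro tendsto_zero_powrI[OF _ tendsto_const]) auto
    from tendsto_real_sqrt[OF tendsto_mult_left[OF this, of "(shift_const + C) / Cs"]]
    show ?thesis by (simp add: m_def)
  qed
  have "\<bar>scaled_cov (Suc n) (s n) (t n) - scaled_cov (Suc n) x y\<bar> \<le> m (s n) x + m (t n) y" for n
  proof -
    have "\<bar>scaled_cov (Suc n) (s n) (t n) - scaled_cov (Suc n) x (t n)\<bar> \<le> m (s n) x"
      unfolding m_def by (rule scaled_cov_modulus) (use s t assms(1) in auto)
    moreover have "\<bar>scaled_cov (Suc n) x (t n) - scaled_cov (Suc n) x y\<bar> \<le> m (t n) y"
      unfolding m_def scaled_cov_commute[of "Suc n" x] by (rule scaled_cov_modulus) (use t assms(1,2) in auto)
    ultimately show ?thesis by linarith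
  qed
  then have "eventually (\<lambda>n. norm (scaled_cov (Suc n) (s n) (t n) - scaled_cov (Suc n) x y) \<le> m (s n) x + m (t n) y) sequentially"
    by (simp add: always_eventually)
  moreover have "(\<lambda>n. m (s n) x + m (t n) y) \<longlonglongrightarrow> 0"
    using tendsto_add[OF m0[OF assms(5)] m0[OF assms(6)]] by simp
  ultimately have "(\<lambda>n. scaled_cov (Suc n) (s n) (t n) - scaled_cov (Suc n) x y) \<longlonglongrightarrow> 0"
    by (rule Lim_null_comparison)
  from tendsto_add[OF this LIMSEQ_Suc[OF scaled_cov_pointwise_limit[OF assms(1,2)]]]
  show ?thesis by simp
qed

text \<open>The integrand of the Riemann sum, with \<open>N\<close> grid points in \<open>[0, 1/n]\<close>, of
  the convolutions \<open>t \<mapsto> \<integral> K (t - s) dB s\<close>.\<close>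

definition averaged_kern :: "nat \<Rightarrow> nat \<Rightarrow> real \<Rightarrow> real" where
  "averaged_kern n N u = (\<Sum>j=1..N. 1 / real N * kern K (real j / real N / real n) u)"

lemma averaged_kern_sq_integrable: "sq_integrable lborel (averaged_kern n N)"
  unfolding averaged_kern_def[abs_def]
  by (intro sq_integrable_sum sq_integrable_cmult kern_sq_integrable[OF K]) auto

lemma scaled_averaged_kern_energy:
  "lam K n * (\<integral>u. (averaged_kern n N u)\<^sup>2 \<partial>lborel) =
    (\<Sum>i=1..N. \<Sum>j=1..N. scaled_cov n (real i / real N) (real j / real N)) / (real N)\<^sup>2"
proof -
  let ?k = "\<lambda>j. kern K (real j / real N / real n)"
  note i = sq_integrable_mult[OF kern_sq_integrable[OF K] kern_sq_integrable[OF K]]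
  have "(\<integral>u. (averaged_kern n N u)\<^sup>2 \<partial>lborel) = (\<integral>u. (\<Sum>i=1..N. \<Sum>j=1..N. 1 / (real N)\<^sup>2 * (?k i u * ?k j u)) \<partial>lborel)"
    unfolding averaged_kern_def power2_eq_square sum_product
    by (intro Bochner_Integration.integral_cong sum.cong refl) simp
  also have "\<dots> = (\<Sum>i=1..N. \<Sum>j=1..N. 1 / (real N)\<^sup>2 * (\<integral>u. ?k i u * ?k j u \<partial>lborel))"
    using i by (simp add: Bochner_Integration.integral_sum Bochner_Integration.integrable_sum)
  finally show ?thesis
    by (simp add: scaled_cov_def sum_distrib_left sum_divide_distrib)
qed

lemma scaled_averaged_kern_energy_le:
  assumes "1 \<le> n"
  shows "lam K n * (\<integral>u. (averaged_kern n N u)\<^sup>2 \<partial>lborel) \<le> 1"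
proof -
  have "(\<Sum>i=1..N. \<Sum>j=1..N. scaled_cov n (real i / real N) (real j / real N)) \<le> (\<Sum>i=1..N. \<Sum>j=1..N. 1)"
  proof (intro sum_mono)
    fix i j assume "i \<in> {1..N}" "j \<in> {1..N}"
    then have "real i / real N \<in> {0..1}" "real j / real N \<in> {0..1}" by simp_all
    from scaled_cov_le_1[OF assms this] show "scaled_cov n (real i / real N) (real j / real N) \<le> 1" by linarith
  qed
  then have "(\<Sum>i=1..N. \<Sum>j=1..N. scaled_cov n (real i / real N) (real j / real N)) \<le> (real N)\<^sup>2"
    by (simp add: power2_eq_square)
  then show ?thesis
    unfolding scaled_averaged_kern_energy by (cases "N = 0") (simp_all add: divide_le_eq_1)
qed

definition limit_variance :: real where
  "limit_variance = (LBINT s:{0..1}. (LBINT t:{0..s}. Kbar t)\<^sup>2)"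

lemma averaged_kern_energy_limit:
  assumes N: "\<And>n. 1 \<le> N n" "filterlim N at_top sequentially"
  shows "(\<lambda>n. lam K n * (\<integral>u. (averaged_kern n (N n) u)\<^sup>2 \<partial>lborel)) \<longlonglongrightarrow> limit_variance"
proof -
  have "(\<lambda>n. lam K (Suc n) * (\<integral>u. (averaged_kern (Suc n) (N (Suc n)) u)\<^sup>2 \<partial>lborel)) \<longlonglongrightarrow> limit_variance"
    unfolding scaled_averaged_kern_energy limit_variance_def integral_kern_covariance[OF Kbar, symmetric]
  proof (rule double_riemann_sums[where N="\<lambda>n. N (Suc n)" and G="\<lambda>n. scaled_cov (Suc n)"])
    show "1 \<le> N (Suc n)" for n by (rule N(1))
    show "filterlim (\<lambda>n. N (Suc n)) at_top sequentially"
      using N(2) by (simp add: filterlim_sequentially_Suc)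
    show "\<bar>scaled_cov (Suc n) s t\<bar> \<le> 1" if "s \<in> {0..1}" "t \<in> {0..1}" for n s t
      by (rule scaled_cov_le_1[OF _ that]) simp
  qed (rule scaled_cov_limit)
  then show ?thesis by (rule LIMSEQ_imp_Suc)
qed

text \<open>At \<open>s = t = 1\<close> the normalised covariances are all equal to \<open>1\<close>, hence so
  is the energy of \<open>Kbar\<close> on \<open>[0,1]\<close>.\<close>

lemma limit_variance_pos: "0 < limit_variance"
  unfolding limit_variance_def
proof (rule integrated_kernel_energy_pos[OF Kbar])
  have "(\<lambda>n. lam K n * (LBINT r:{0..1 / real n}. K r * K r)) \<longlonglongrightarrow> (LBINT r:{0..1}. Kbar r * Kbar r)"
    using covariance_limit[of 1 1] by simp
  moreover have "(\<lambda>n. lam K n * (LBINT r:{0..1 / real n}. K r * K r)) \<longlonglongrightarrow> 1"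
    using lam_times_energy by (intro tendsto_eventually eventually_sequentiallyI[of 1]) (simp add: power2_eq_square)
  ultimately have "(LBINT r:{0..1}. Kbar r * Kbar r) = 1" by (rule LIMSEQ_unique)
  then show "(LBINT r:{0..1}. (Kbar r)\<^sup>2) \<noteq> 0" by (simp add: power2_eq_square)
qed

end

section \<open>Step sums of Brownian increments\<close>

lemma (in prob_space) prob_le_Un:
  assumes "A \<subseteq> B \<union> C" "B \<in> events" "C \<in> events"
  shows "prob A \<le> prob B + prob C"
  using finite_measure_mono[OF assms(1)] measure_Un_le[OF assms(2,3)] assms(2,3) by auto

locale brownian_space = filtered_prob_space M F
  for M :: "'a measure" and F :: "real \<Rightarrow> 'a measure" +
  fixes B :: "real \<Rightarrow> 'a \<Rightarrow> real"
  assumes BM: "brownian_motion M F B"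
begin

lemma subalgebra_F_mono: "s \<le> t \<Longrightarrow> subalgebra (F t) (F s)"
  using sets_F_mono[of s t] by (simp add: subalgebra_def space_F)

lemma subalgebra_F: "0 \<le> t \<Longrightarrow> subalgebra M (F t)"
  using sets_F_subset[of t] by (simp add: subalgebra_def space_F)

lemma measurable_F_mono: "s \<le> t \<Longrightarrow> f \<in> measurable (F s) N \<Longrightarrow> f \<in> measurable (F t) N"
  using measurable_from_subalg subalgebra_F_mono by blast

lemma measurable_F_M: "0 \<le> t \<Longrightarrow> f \<in> measurable (F t) N \<Longrightarrow> f \<in> measurable M N"
  using measurable_from_subalg subalgebra_F by blast

lemma B_adapted: "0 \<le> s \<Longrightarrow> s \<le> t \<Longrightarrow> B s \<in> borel_measurable (F t)"
  using BM measurable_F_mono unfolding brownian_motion_def by blast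

lemma B_measurable: "0 \<le> t \<Longrightarrow> B t \<in> borel_measurable M"
  using B_adapted[of t t] measurable_F_M by auto

lemma increment_distributed:
  "0 \<le> s \<Longrightarrow> s < t \<Longrightarrow> distributed M lborel (\<lambda>\<omega>. B t \<omega> - B s \<omega>) (normal_density 0 (sqrt (t - s)))"
  using BM unfolding brownian_motion_def by blast

lemma increment_indep:
  assumes "0 \<le> s" "s < t" and X: "X \<in> borel_measurable (F s)"
  shows "indep_var borel X borel (\<lambda>\<omega>. B t \<omega> - B s \<omega>)"
proof -
  let ?D = "\<lambda>\<omega>. B t \<omega> - B s \<omega>"
  let ?E = "{?D -` A \<inter> space M | A. A \<in> sets borel}"
  have D: "?D \<in> borel_measurable M"
    using assms by (intro borel_measurable_diff B_measurable) auto
  have "indep_set (sets (F s)) ?E"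
    using BM assms unfolding brownian_motion_def by blast
  moreover have "Int_stable ?E"
  proof (rule Int_stableI)
    fix a b assume "a \<in> ?E" "b \<in> ?E"
    then obtain A A' where "a = ?D -` A \<inter> space M" "b = ?D -` A' \<inter> space M" "A \<in> sets borel" "A' \<in> sets borel"
      by blast
    then have "a \<inter> b = ?D -` (A \<inter> A') \<inter> space M" "A \<inter> A' \<in> sets borel" by auto
    then show "a \<inter> b \<in> ?E" by blast
  qed
  ultimately have ind: "indep_set (sigma_sets (space M) (sets (F s))) (sigma_sets (space M) ?E)"
    using sets.Int_stable by (intro indep_set_sigma_sets) auto
  have "sigma_sets (space M) {X -` A \<inter> space M | A. A \<in> sets borel} \<subseteq> sigma_sets (space M) (sets (F s))"
    using X space_F[of s] by (intro sigma_sets_mono') (auto simp: measurable_def)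
  then have "indep_set (sigma_sets (space M) {X -` A \<inter> space M | A. A \<in> sets borel}) (sigma_sets (space M) ?E)"
    using ind unfolding indep_set_def
    by (elim indep_sets_mono_sets) (auto split: bool.split)
  then show ?thesis
    using D measurable_F_M[OF assms(1) X] unfolding indep_var_eq by simp
qed

lemma increment_moments:
  assumes "0 \<le> s" "s < t"
  shows "integrable M (\<lambda>\<omega>. B t \<omega> - B s \<omega>)" "expectation (\<lambda>\<omega>. B t \<omega> - B s \<omega>) = 0"
    "integrable M (\<lambda>\<omega>. (B t \<omega> - B s \<omega>)\<^sup>2)" "expectation (\<lambda>\<omega>. (B t \<omega> - B s \<omega>)\<^sup>2) = t - s"
proof -
  note d = increment_distributed[OF assms]
  have pos: "0 < sqrt (t - s)" using assms by simp
  show "integrable M (\<lambda>\<omega>. B t \<omega> - B s \<omega>)"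
    using distributed_integrable[OF d, of "\<lambda>x. x"] integrable_normal_moment_nz_1[OF pos, of 0] by simp
  show E0: "expectation (\<lambda>\<omega>. B t \<omega> - B s \<omega>) = 0"
    using normal_distributed_expectation[OF pos d] .
  show "integrable M (\<lambda>\<omega>. (B t \<omega> - B s \<omega>)\<^sup>2)"
    using distributed_integrable[OF d, of "\<lambda>x. x\<^sup>2"] integrable_normal_moment[OF pos, of 0 2] by simp
  show "expectation (\<lambda>\<omega>. (B t \<omega> - B s \<omega>)\<^sup>2) = t - s"
    using normal_distributed_variance[OF pos d] E0 assms by simp
qed

end

text \<open>A Riemann-Stieltjes sum against an arbitrary function \<open>f\<close>. For a Brownian path
  \<open>f\<close> it is the stochastic integral of a simple process; for \<open>f = -
  1\<^bsub>{..<s}\<^esub>\<close> it is the value at time \<open>s\<close> of the simple process itself.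
  Changes of the grid can therefore be treated for both at once.\<close>

definition step_sum :: "nat \<Rightarrow> (nat \<Rightarrow> real) \<Rightarrow> (nat \<Rightarrow> real) \<Rightarrow> (real \<Rightarrow> real) \<Rightarrow> real" where
  "step_sum m \<tau> x f = (\<Sum>i<m. x i * (f (\<tau> (Suc i)) - f (\<tau> i)))"

lemma simple_process_data_grid:
  assumes "simple_process_data M F m \<tau> \<xi>" "i \<le> j" "j \<le> m"
  shows "\<tau> i \<le> \<tau> j" "0 \<le> \<tau> i"
proof -
  have "\<And>i j. i \<le> j \<Longrightarrow> j \<le> m \<Longrightarrow> \<tau> i \<le> \<tau> j"
  proof -
    fix i j :: nat assume "i \<le> j" "j \<le> m"
    then show "\<tau> i \<le> \<tau> j"
    proof (induction j rule: dec_induct)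
      case (step n)
      then have "\<tau> n \<le> \<tau> (Suc n)" using assms(1) by (auto simp: simple_process_data_def)
      then show ?case using step by force
    qed simp
  qed
  from this[of i j] this[of 0 i] assms show "\<tau> i \<le> \<tau> j" "0 \<le> \<tau> i"
    by (auto simp: simple_process_data_def)
qed

lemma simple_process_data_less:
  "simple_process_data M F (Suc m) \<tau> \<xi> \<Longrightarrow> simple_process_data M F m \<tau> \<xi>"
  by (auto simp: simple_process_data_def)

context brownian_space begin

abbreviation ito_sum :: "nat \<Rightarrow> (nat \<Rightarrow> real) \<Rightarrow> (nat \<Rightarrow> 'a \<Rightarrow> real) \<Rightarrow> 'a \<Rightarrow> real" where
  "ito_sum m \<tau> \<xi> \<omega> \<equiv> step_sum m \<tau> (\<lambda>i. \<xi> i \<omega>) (\<lambda>t. B t \<omega>)"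

lemma step_sum_adapted:
  assumes d: "simple_process_data M F m \<tau> \<xi>"
  shows "(\<lambda>\<omega>. ito_sum m \<tau> \<xi> \<omega>) \<in> borel_measurable (F (\<tau> m))"
proof -
  note g = simple_process_data_grid[OF d]
  have "\<xi> i \<in> borel_measurable (F (\<tau> m))" if "i < m" for i
    using d that g[of i m] measurable_F_mono[of "\<tau> i" "\<tau> m" "\<xi> i"] by (auto simp: simple_process_data_def)
  moreover have "B (\<tau> i) \<in> borel_measurable (F (\<tau> m))" if "i \<le> m" for i
    using g[of i m] that by (intro B_adapted) auto
  ultimately show ?thesis unfolding step_sum_def
    by (intro borel_measurable_sum borel_measurable_times borel_measurable_diff) auto
qed

lemma step_sum_measurable:
  assumes d: "simple_process_data M F m \<tau> \<xi>"
  shows "(\<lambda>\<omega>. ito_sum m \<tau> \<xi> \<omega>) \<in> borel_measurable M"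
  using step_sum_adapted[OF d] simple_process_data_grid(2)[OF d, of m m] measurable_F_M by auto

text \<open>Ito isometry. Each increment is independent of the past, so the mixed terms have mean zero and the
  squares factorise.\<close>

lemma step_sum_isometry:
  assumes "simple_process_data M F m \<tau> \<xi>"
  defines "S \<equiv> \<lambda>m \<omega>. ito_sum m \<tau> \<xi> \<omega>"
  shows "integrable M (\<lambda>\<omega>. (S m \<omega>)\<^sup>2) \<and>
    expectation (\<lambda>\<omega>. (S m \<omega>)\<^sup>2) = (\<Sum>i<m. expectation (\<lambda>\<omega>. (\<xi> i \<omega>)\<^sup>2) * (\<tau> (Suc i) - \<tau> i))"
  using assms(1)
proof (induction m)
  case 0
  then show ?case by (simp add: S_def step_sum_def)
next
  case (Suc m)
  note d' = simple_process_data_less[OF Suc.prems]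
  note g = simple_process_data_grid[OF Suc.prems]
  define D where "D = (\<lambda>\<omega>. B (\<tau> (Suc m)) \<omega> - B (\<tau> m) \<omega>)"
  have S: "S (Suc m) \<omega> = S m \<omega> + \<xi> m \<omega> * D \<omega>" for \<omega>
    by (simp add: S_def step_sum_def D_def)
  have IH: "integrable M (\<lambda>\<omega>. (S m \<omega>)\<^sup>2)"
    "expectation (\<lambda>\<omega>. (S m \<omega>)\<^sup>2) = (\<Sum>i<m. expectation (\<lambda>\<omega>. (\<xi> i \<omega>)\<^sup>2) * (\<tau> (Suc i) - \<tau> i))"
    using Suc.IH[OF d'] by auto
  show ?case
  proof (cases "\<tau> (Suc m) = \<tau> m")
    case True
    then have "D = (\<lambda>_. 0)" by (simp add: D_def)
    then show ?thesis using IH True by (simp add: S)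
  next
    case False
    have t: "0 \<le> \<tau> m" "\<tau> m < \<tau> (Suc m)" using g[of m "Suc m"] False by auto
    have mom: "integrable M D" "expectation D = 0" "integrable M (\<lambda>\<omega>. (D \<omega>)\<^sup>2)"
        "expectation (\<lambda>\<omega>. (D \<omega>)\<^sup>2) = \<tau> (Suc m) - \<tau> m"
      using increment_moments[OF t] by (simp_all add: D_def)
    have Sm: "S m \<in> borel_measurable (F (\<tau> m))"
      using step_sum_adapted[OF d'] by (simp add: S_def)
    have xm: "\<xi> m \<in> borel_measurable (F (\<tau> m))"
      using Suc.prems by (simp add: simple_process_data_def)
    obtain c where c: "\<And>\<omega>. \<omega> \<in> space M \<Longrightarrow> \<bar>\<xi> m \<omega>\<bar> \<le> c"
      using Suc.prems unfolding simple_process_data_def by blast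
    note SmM [measurable] = measurable_F_M[OF t(1) Sm] and xmM [measurable] = measurable_F_M[OF t(1) xm]
    have ix: "integrable M (\<lambda>\<omega>. (\<xi> m \<omega>)\<^sup>2)"
      using c by (intro integrable_const_bound[where B="c\<^sup>2"]) (auto simp: abs_le_square_iff[symmetric] intro!: AE_I2 order_trans[OF c])
    have iS: "integrable M (S m)"
      using square_integrable_imp_integrable[OF SmM IH(1)] .
    have iSx: "integrable M (\<lambda>\<omega>. S m \<omega> * \<xi> m \<omega>)"
    proof (rule Bochner_Integration.integrable_bound[of M "\<lambda>\<omega>. c * S m \<omega>"])
      show "AE \<omega> in M. norm (S m \<omega> * \<xi> m \<omega>) \<le> norm (c * S m \<omega>)"
        using c by (intro AE_I2) (auto simp: abs_mult mult.commute[of c] intro!: mult_left_mono order_trans[OF c])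
    qed (use iS in auto)
    have ind1: "indep_var borel (\<lambda>\<omega>. S m \<omega> * \<xi> m \<omega>) borel D"
      unfolding D_def using Sm xm by (intro increment_indep t) auto
    have ind2: "indep_var borel (\<lambda>\<omega>. (\<xi> m \<omega>)\<^sup>2) borel (\<lambda>\<omega>. (D \<omega>)\<^sup>2)"
    proof -
      have "indep_var borel ((\<lambda>x. x) \<circ> (\<lambda>\<omega>. (\<xi> m \<omega>)\<^sup>2)) borel ((\<lambda>x. x\<^sup>2) \<circ> D)"
        unfolding D_def using xm by (intro indep_var_compose[OF increment_indep] t) auto
      then show ?thesis by (simp add: o_def)
    qed
    note c1 = indep_var_integrable[OF ind1 iSx mom(1)] indep_var_lebesgue_integral[OF ind1 iSx mom(1)]
    note c2 = indep_var_integrable[OF ind2 ix mom(3)] indep_var_lebesgue_integral[OF ind2 ix mom(3)]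
    have eq: "(S (Suc m) \<omega>)\<^sup>2 = (S m \<omega>)\<^sup>2 + 2 * (S m \<omega> * \<xi> m \<omega> * D \<omega>) + (\<xi> m \<omega>)\<^sup>2 * (D \<omega>)\<^sup>2" for \<omega>
      unfolding S by (simp add: power2_eq_square algebra_simps)
    show ?thesis
      unfolding eq using IH c1 c2 mom by simp
  qed
qed

text \<open>A sum of independent centred normal variables. Degenerate summands are split off in the induction,
  as the normal density is only meaningful for a positive standard deviation.\<close>

lemma step_sum_normal:
  fixes c \<tau> :: "nat \<Rightarrow> real"
  assumes "0 \<le> \<tau> 0" "\<And>i. i < m \<Longrightarrow> \<tau> i \<le> \<tau> (Suc i)"
  defines "V \<equiv> \<lambda>m. \<Sum>i<m. (c i)\<^sup>2 * (\<tau> (Suc i) - \<tau> i)"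
  assumes pos: "0 < V m"
  shows "distributed M lborel (\<lambda>\<omega>. step_sum m \<tau> c (\<lambda>t. B t \<omega>)) (normal_density 0 (sqrt (V m)))"
proof -
  define S where "S = (\<lambda>m \<omega>. step_sum m \<tau> c (\<lambda>t. B t \<omega>))"
  have "(0 < V m \<longrightarrow> distributed M lborel (S m) (normal_density 0 (sqrt (V m)))) \<and>
        (V m = 0 \<longrightarrow> S m = (\<lambda>_. 0)) \<and> 0 \<le> V m"
    using assms(1,2)
  proof (induction m)
    case 0
    then show ?case by (simp add: V_def S_def step_sum_def fun_eq_iff)
  next
    case (Suc m)
    have dat: "simple_process_data M F (Suc m) \<tau> (\<lambda>i _. c i)"
      using Suc.prems by (auto simp: simple_process_data_def)
    note g = simple_process_data_grid[OF dat]
    define D where "D = (\<lambda>\<omega>. B (\<tau> (Suc m)) \<omega> - B (\<tau> m) \<omega>)"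
    have S: "S (Suc m) = (\<lambda>\<omega>. S m \<omega> + c m * D \<omega>)"
      by (simp add: S_def step_sum_def D_def fun_eq_iff)
    have IH: "0 < V m \<Longrightarrow> distributed M lborel (S m) (normal_density 0 (sqrt (V m)))"
        "V m = 0 \<Longrightarrow> S m = (\<lambda>_. 0)" "0 \<le> V m" using Suc by auto
    have V: "V (Suc m) = V m + (c m)\<^sup>2 * (\<tau> (Suc m) - \<tau> m)" by (simp add: V_def)
    have nn: "0 \<le> \<tau> m" "\<tau> m \<le> \<tau> (Suc m)" using g[of m "Suc m"] by auto
    show ?case
    proof (cases "c m = 0 \<or> \<tau> (Suc m) = \<tau> m")
      case True
      then have "V (Suc m) = V m" "S (Suc m) = S m" by (auto simp: V S D_def fun_eq_iff)
      then show ?thesis using IH by simp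
    next
      case False
      then have t: "0 \<le> \<tau> m" "\<tau> m < \<tau> (Suc m)" "c m \<noteq> 0" using nn by auto
      define u where "u = sqrt (\<tau> (Suc m) - \<tau> m)"
      have u: "0 < u" "u\<^sup>2 = \<tau> (Suc m) - \<tau> m" using t by (auto simp: u_def)
      have dD: "distributed M lborel (\<lambda>\<omega>. c m * D \<omega>) (normal_density 0 (\<bar>c m\<bar> * u))"
        using normal_density_affine[OF increment_distributed[OF t(1,2)], of "c m" 0] t
        by (simp add: D_def u_def)
      have Vp: "0 < V (Suc m)" using IH(3) t by (simp add: V add_nonneg_pos)
      have "distributed M lborel (S (Suc m)) (normal_density 0 (sqrt (V (Suc m))))"
      proof (cases "V m = 0")
        case True
        then have "sqrt (V (Suc m)) = \<bar>c m\<bar> * u" by (simp add: V real_sqrt_mult u_def)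
        then show ?thesis using dD IH(2)[OF True] by (simp add: S)
      next
        case False
        then have Vm: "0 < V m" using IH(3) by simp
        have Sm: "S m \<in> borel_measurable (F (\<tau> m))"
          using step_sum_adapted[OF simple_process_data_less[OF dat]] by (simp add: S_def)
        have "indep_var borel ((\<lambda>x. x) \<circ> S m) borel ((\<lambda>x. c m * x) \<circ> D)"
          unfolding D_def using Sm by (intro indep_var_compose[OF increment_indep] t) auto
        then have "indep_var borel (S m) borel (\<lambda>\<omega>. c m * D \<omega>)"
          by (simp add: o_def)
        from add_indep_normal[OF this _ _ IH(1)[OF Vm] dD] Vm t u
        show ?thesis by (simp add: S V power_mult_distrib)
      qed
      then show ?thesis using Vp by simp
    qed
  qed
  then show ?thesis using pos by (simp add: S_def)
qed

end

lemma simple_process_eq_step_sum: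
  assumes "simple_process_data M F m \<tau> \<xi>"
  shows "simple_process m \<tau> \<xi> s \<omega> = step_sum m \<tau> (\<lambda>i. \<xi> i \<omega>) (\<lambda>p. - indicat_real {..<s} p)"
  unfolding simple_process_def step_sum_def
proof (intro sum.cong refl arg_cong2[where f="(*)"])
  fix i assume "i \<in> {..<m}"
  then have "\<tau> i \<le> \<tau> (Suc i)" using assms by (auto simp: simple_process_data_def)
  then show "indicat_real {\<tau> i<..\<tau> (Suc i)} s = - indicat_real {..<s} (\<tau> (Suc i)) - - indicat_real {..<s} (\<tau> i)"
    by (auto simp: indicator_def)
qed

lemma simple_process_square:
  assumes "simple_process_data M F m \<tau> \<xi>"
  shows "(simple_process m \<tau> \<xi> s \<omega>)\<^sup>2 = (\<Sum>i<m. (\<xi> i \<omega>)\<^sup>2 * indicat_real {\<tau> i<..\<tau> (Suc i)} s)"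
  using assms
proof (induction m)
  case (Suc m)
  note g = simple_process_data_grid[OF Suc.prems]
  have z: "simple_process m \<tau> \<xi> s \<omega> * indicat_real {\<tau> m<..\<tau> (Suc m)} s = 0"
    unfolding simple_process_def sum_distrib_right
  proof (rule sum.neutral, intro ballI)
    fix i assume "i \<in> {..<m}"
    then have "\<tau> (Suc i) \<le> \<tau> m" using g(1)[of "Suc i" m] by auto
    then show "\<xi> i \<omega> * indicat_real {\<tau> i<..\<tau> (Suc i)} s * indicat_real {\<tau> m<..\<tau> (Suc m)} s = 0"
      by (auto simp: indicator_def)
  qed
  have "simple_process (Suc m) \<tau> \<xi> s \<omega> = simple_process m \<tau> \<xi> s \<omega> + \<xi> m \<omega> * indicat_real {\<tau> m<..\<tau> (Suc m)} s"
    by (simp add: simple_process_def)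
  then have "(simple_process (Suc m) \<tau> \<xi> s \<omega>)\<^sup>2 =
      (simple_process m \<tau> \<xi> s \<omega>)\<^sup>2 + (\<xi> m \<omega> * indicat_real {\<tau> m<..\<tau> (Suc m)} s)\<^sup>2
      + 2 * \<xi> m \<omega> * (simple_process m \<tau> \<xi> s \<omega> * indicat_real {\<tau> m<..\<tau> (Suc m)} s)"
    by (simp add: power2_eq_square algebra_simps)
  moreover have "(\<xi> m \<omega> * indicat_real {\<tau> m<..\<tau> (Suc m)} s)\<^sup>2 = (\<xi> m \<omega>)\<^sup>2 * indicat_real {\<tau> m<..\<tau> (Suc m)} s"
    by (simp add: power_mult_distrib indicator_def)
  ultimately show ?case
    using Suc.IH[OF simple_process_data_less[OF Suc.prems]] z by simp
qed (simp add: simple_process_def)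

lemma nn_integral_simple_process_square:
  assumes "simple_process_data M F m \<tau> \<xi>"
  shows "energy (\<lambda>s. simple_process m \<tau> \<xi> s \<omega>) =
    ennreal (\<Sum>i<m. (\<xi> i \<omega>)\<^sup>2 * (\<tau> (Suc i) - \<tau> i))"
proof -
  have t: "\<tau> i \<le> \<tau> (Suc i)" if "i < m" for i using assms that by (auto simp: simple_process_data_def)
  have "energy (\<lambda>s. simple_process m \<tau> \<xi> s \<omega>) =
     (\<integral>\<^sup>+s. (\<Sum>i<m. ennreal ((\<xi> i \<omega>)\<^sup>2) * indicator {\<tau> i<..\<tau> (Suc i)} s) \<partial>lborel)"
    unfolding simple_process_square[OF assms]
    by (intro nn_integral_cong, subst sum_ennreal[symmetric]) (auto simp: ennreal_mult' ennreal_indicator intro!: sum.cong)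
  also have "\<dots> = (\<Sum>i<m. ennreal ((\<xi> i \<omega>)\<^sup>2) * ennreal (\<tau> (Suc i) - \<tau> i))"
    using t by (subst nn_integral_sum) (auto simp: nn_integral_cmult_indicator intro!: sum.cong)
  also have "\<dots> = ennreal (\<Sum>i<m. (\<xi> i \<omega>)\<^sup>2 * (\<tau> (Suc i) - \<tau> i))"
    using t by (subst sum_ennreal[symmetric]) (auto simp: ennreal_mult' intro!: sum.cong)
  finally show ?thesis .
qed

text \<open>The indicator in the sum selects the grid intervals inside \<open>[p \<alpha>, p \<beta>)\<close>,
  over which the increments of \<open>f\<close> telescope.\<close>

lemma telescope_on_grid:
  fixes p :: "nat \<Rightarrow> real" and f :: "real \<Rightarrow> real"
  assumes mono: "\<And>i j. i < j \<Longrightarrow> j \<le> L \<Longrightarrow> p i < p j" and "\<alpha> \<le> \<beta>" "\<beta> \<le> L"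
  shows "(\<Sum>k<L. of_bool (p \<alpha> \<le> p k \<and> p k < p \<beta>) * (f (p (Suc k)) - f (p k))) = f (p \<beta>) - f (p \<alpha>)"
proof -
  have le: "p i \<le> p j \<longleftrightarrow> i \<le> j" "p i < p j \<longleftrightarrow> i < j" if "i \<le> L" "j \<le> L" for i j
    using mono[of i j] mono[of j i] that by (cases i j rule: linorder_cases; force)+
  have "(\<Sum>k<L. of_bool (p \<alpha> \<le> p k \<and> p k < p \<beta>) * (f (p (Suc k)) - f (p k))) =
        (\<Sum>k\<in>{\<alpha>..<\<beta>}. f (p (Suc k)) - f (p k))"
    using assms(2,3) by (intro sum.mono_neutral_cong_right) (auto simp: le)
  then show ?thesis using sum_Suc_diff'[OF assms(2), of "\<lambda>k. f (p k)"] by simp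
qed

context brownian_space begin

text \<open>On a finer grid the coefficient of an interval is the coefficient of the coarse interval that
  contains it. It is known at the left end point of the fine interval because the coarse one starts
  earlier.\<close>

lemma simple_process_refine:
  assumes d: "simple_process_data M F m \<tau> \<xi>"
    and mono: "\<And>i j. i < j \<Longrightarrow> j \<le> L \<Longrightarrow> p i < p j" and sub: "\<tau> ` {..m} \<subseteq> p ` {..L}" and p0: "0 \<le> p 0"
  shows "\<exists>\<eta>. simple_process_data M F L p \<eta> \<and>
    (\<forall>\<omega> f. step_sum L p (\<lambda>k. \<eta> k \<omega>) f = step_sum m \<tau> (\<lambda>i. \<xi> i \<omega>) f)"
proof -
  define \<eta> where "\<eta> k \<omega> = (\<Sum>i<m. \<xi> i \<omega> * of_bool (\<tau> i \<le> p k \<and> p k < \<tau> (Suc i)))" for k \<omega>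
  note g = simple_process_data_grid[OF d]
  have le: "p i \<le> p j \<longleftrightarrow> i \<le> j" "p i < p j \<longleftrightarrow> i < j" if "i \<le> L" "j \<le> L" for i j
    using mono[of i j] mono[of j i] that by (cases i j rule: linorder_cases; force)+
  have "step_sum L p (\<lambda>k. \<eta> k \<omega>) f = step_sum m \<tau> (\<lambda>i. \<xi> i \<omega>) f" for \<omega> f
  proof -
    have "step_sum L p (\<lambda>k. \<eta> k \<omega>) f =
       (\<Sum>i<m. \<xi> i \<omega> * (\<Sum>k<L. of_bool (\<tau> i \<le> p k \<and> p k < \<tau> (Suc i)) * (f (p (Suc k)) - f (p k))))"
      unfolding step_sum_def \<eta>_def sum_distrib_right sum_distrib_left
      by (subst sum.swap) (simp add: mult.assoc)
    also have "\<dots> = step_sum m \<tau> (\<lambda>i. \<xi> i \<omega>) f"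
      unfolding step_sum_def
    proof (intro sum.cong refl arg_cong2[where f="(*)"])
      fix i assume i: "i \<in> {..<m}"
      obtain \<alpha> \<beta> where ab: "\<tau> i = p \<alpha>" "\<alpha> \<le> L" "\<tau> (Suc i) = p \<beta>" "\<beta> \<le> L"
      proof -
        have "\<tau> i \<in> p ` {..L}" "\<tau> (Suc i) \<in> p ` {..L}" using sub i by (auto intro!: subsetD[OF sub])
        then show ?thesis using that by auto
      qed
      have "\<alpha> \<le> \<beta>" using g(1)[of i "Suc i"] i ab by (auto simp: le)
      then show "(\<Sum>k<L. of_bool (\<tau> i \<le> p k \<and> p k < \<tau> (Suc i)) * (f (p (Suc k)) - f (p k))) = f (\<tau> (Suc i)) - f (\<tau> i)"
        using telescope_on_grid[of L p \<alpha> \<beta> f] mono ab by simp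
    qed
    finally show ?thesis .
  qed
  moreover have "simple_process_data M F L p \<eta>"
    unfolding simple_process_data_def
  proof (intro conjI allI impI p0)
    fix k assume k: "k < L"
    show "p k \<le> p (Suc k)" using mono[of k "Suc k"] k by simp
    have "(\<lambda>\<omega>. \<xi> i \<omega> * of_bool (\<tau> i \<le> p k \<and> p k < \<tau> (Suc i))) \<in> borel_measurable (F (p k))" if "i < m" for i
    proof (cases "\<tau> i \<le> p k")
      case True
      then show ?thesis using d that measurable_F_mono[OF True, of "\<xi> i"]
        by (intro borel_measurable_times) (auto simp: simple_process_data_def)
    qed simp
    then show "\<eta> k \<in> borel_measurable (F (p k))" unfolding \<eta>_def[abs_def]
      by (intro borel_measurable_sum) auto
    have "\<forall>i\<in>{..<m}. \<exists>c. \<forall>\<omega>\<in>space M. \<bar>\<xi> i \<omega>\<bar> \<le> c" using d by (auto simp: simple_process_data_def)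
    then obtain c where c: "\<And>i \<omega>. i < m \<Longrightarrow> \<omega> \<in> space M \<Longrightarrow> \<bar>\<xi> i \<omega>\<bar> \<le> c i" by (metis lessThan_iff)
    show "\<exists>c. \<forall>\<omega>\<in>space M. \<bar>\<eta> k \<omega>\<bar> \<le> c"
    proof (intro exI[of _ "\<Sum>i<m. c i"] ballI)
      fix \<omega> assume "\<omega> \<in> space M"
      then have "\<bar>\<xi> i \<omega> * of_bool (\<tau> i \<le> p k \<and> p k < \<tau> (Suc i))\<bar> \<le> c i" if "i < m" for i
        using c[OF that, of \<omega>] by (auto simp: of_bool_def)
      then show "\<bar>\<eta> k \<omega>\<bar> \<le> (\<Sum>i<m. c i)"
        unfolding \<eta>_def by (intro order_trans[OF sum_abs] sum_mono) auto
    qed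
  qed
  ultimately show ?thesis by blast
qed

text \<open>Refine both processes to the union of their grids and add the coefficients there.\<close>

lemma simple_process_add:
  assumes d1: "simple_process_data M F m1 \<tau>1 \<xi>1" and d2: "simple_process_data M F m2 \<tau>2 \<xi>2"
  shows "\<exists>m \<tau> \<xi>. simple_process_data M F m \<tau> \<xi> \<and>
    (\<forall>\<omega> f. step_sum m \<tau> (\<lambda>i. \<xi> i \<omega>) f = step_sum m1 \<tau>1 (\<lambda>i. \<xi>1 i \<omega>) f + step_sum m2 \<tau>2 (\<lambda>i. \<xi>2 i \<omega>) f) \<and>
    (\<forall>s \<omega>. simple_process m \<tau> \<xi> s \<omega> = simple_process m1 \<tau>1 \<xi>1 s \<omega> + simple_process m2 \<tau>2 \<xi>2 s \<omega>)"
proof -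
  define P where "P = \<tau>1 ` {..m1} \<union> \<tau>2 ` {..m2}"
  define p where "p = nth (sorted_list_of_set P)"
  define L where "L = card P - 1"
  have P: "finite P" "P \<noteq> {}" by (auto simp: P_def)
  then have L: "card P = Suc L" by (simp add: L_def card_gt_0_iff)
  have im: "p ` {..L} = P"
    using P L nth_image[of "Suc L" "sorted_list_of_set P"] by (simp add: p_def atLeast0LessThan lessThan_Suc_atMost)
  have mono: "p i < p j" if "i < j" "j \<le> L" for i j
    unfolding p_def using that L P strict_sorted_list_of_set[of P] by (auto simp: sorted_wrt_iff_nth_less)
  have "p 0 \<in> P" using im by auto
  then have p0: "0 \<le> p 0"
    using simple_process_data_grid(2)[OF d1] simple_process_data_grid(2)[OF d2] by (auto simp: P_def)
  have ref1: "\<exists>\<eta>. simple_process_data M F L p \<eta> \<and>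
      (\<forall>\<omega> f. step_sum L p (\<lambda>k. \<eta> k \<omega>) f = step_sum m1 \<tau>1 (\<lambda>i. \<xi>1 i \<omega>) f)"
    by (rule simple_process_refine[OF d1]) (use mono p0 im in \<open>auto simp: P_def\<close>)
  obtain \<eta>1 where 1: "simple_process_data M F L p \<eta>1"
    "\<And>\<omega> f. step_sum L p (\<lambda>k. \<eta>1 k \<omega>) f = step_sum m1 \<tau>1 (\<lambda>i. \<xi>1 i \<omega>) f"
    using ref1 by blast
  have ref2: "\<exists>\<eta>. simple_process_data M F L p \<eta> \<and>
      (\<forall>\<omega> f. step_sum L p (\<lambda>k. \<eta> k \<omega>) f = step_sum m2 \<tau>2 (\<lambda>i. \<xi>2 i \<omega>) f)"
    by (rule simple_process_refine[OF d2]) (use mono p0 im in \<open>auto simp: P_def\<close>)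
  obtain \<eta>2 where 2: "simple_process_data M F L p \<eta>2"
    "\<And>\<omega> f. step_sum L p (\<lambda>k. \<eta>2 k \<omega>) f = step_sum m2 \<tau>2 (\<lambda>i. \<xi>2 i \<omega>) f"
    using ref2 by blast
  have d: "simple_process_data M F L p (\<lambda>k \<omega>. \<eta>1 k \<omega> + \<eta>2 k \<omega>)"
    unfolding simple_process_data_def
  proof (intro conjI allI impI p0)
    fix k assume k: "k < L"
    show "p k \<le> p (Suc k)" using mono[of k "Suc k"] k by simp
    have "\<eta>1 k \<in> borel_measurable (F (p k))" "\<eta>2 k \<in> borel_measurable (F (p k))"
      using 1(1) 2(1) k unfolding simple_process_data_def by blast+
    then show "(\<lambda>\<omega>. \<eta>1 k \<omega> + \<eta>2 k \<omega>) \<in> borel_measurable (F (p k))"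
      by (rule borel_measurable_add)
    obtain c1 c2 where "\<forall>\<omega>\<in>space M. \<bar>\<eta>1 k \<omega>\<bar> \<le> c1" "\<forall>\<omega>\<in>space M. \<bar>\<eta>2 k \<omega>\<bar> \<le> c2"
      using 1(1) 2(1) k unfolding simple_process_data_def by blast
    then show "\<exists>c. \<forall>\<omega>\<in>space M. \<bar>\<eta>1 k \<omega> + \<eta>2 k \<omega>\<bar> \<le> c"
      by (intro exI[of _ "c1 + c2"]) (force intro: order_trans[OF abs_triangle_ineq] add_mono)
  qed
  have st: "step_sum L p (\<lambda>k. \<eta>1 k \<omega> + \<eta>2 k \<omega>) f = step_sum m1 \<tau>1 (\<lambda>i. \<xi>1 i \<omega>) f + step_sum m2 \<tau>2 (\<lambda>i. \<xi>2 i \<omega>) f" for \<omega> f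
    unfolding 1(2)[symmetric] 2(2)[symmetric]
    unfolding step_sum_def sum.distrib[symmetric] by (simp add: algebra_simps)
  show ?thesis
    using d st
    by (intro exI[of _ L] exI[of _ p] exI[of _ "\<lambda>k \<omega>. \<eta>1 k \<omega> + \<eta>2 k \<omega>"])
       (simp add: simple_process_eq_step_sum[OF d] simple_process_eq_step_sum[OF d1] simple_process_eq_step_sum[OF d2])
qed

text \<open>Lenglart-type inequality. The coefficient \<open>\<xi> i\<close> is set to zero as soon as the
  energy accumulated up to the end of the \<open>i\<close>-th interval exceeds \<open>\<delta>\<close>. That
  energy is already known at the beginning of the interval, so the modified process is again simple; its
  energy is at most \<open>\<delta>\<close>, and it is unchanged unless the total energy exceeds
  \<open>\<delta>\<close>. Isometry and Markov's inequality finish the argument.\<close>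

lemma step_sum_tail_bound:
  assumes d: "simple_process_data M F m \<tau> \<xi>" and "0 < \<epsilon>" "0 \<le> \<delta>"
  shows "\<P>(\<omega> in M. \<bar>ito_sum m \<tau> \<xi> \<omega>\<bar> > \<epsilon>)
    \<le> \<P>(\<omega> in M. (\<Sum>i<m. (\<xi> i \<omega>)\<^sup>2 * (\<tau> (Suc i) - \<tau> i)) > \<delta>) + \<delta> / \<epsilon>\<^sup>2"
proof -
  note g = simple_process_data_grid[OF d]
  define \<xi>' where "\<xi>' i \<omega> = (if (\<Sum>j<Suc i. (\<xi> j \<omega>)\<^sup>2 * (\<tau> (Suc j) - \<tau> j)) \<le> \<delta> then \<xi> i \<omega> else 0)" for i \<omega>
  let ?S = "\<lambda>\<omega>. ito_sum m \<tau> \<xi> \<omega>" and ?S' = "\<lambda>\<omega>. ito_sum m \<tau> \<xi>' \<omega>"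
  let ?E = "\<lambda>m \<omega>. \<Sum>i<m. (\<xi> i \<omega>)\<^sup>2 * (\<tau> (Suc i) - \<tau> i)"
  have nn: "0 \<le> (\<xi> i \<omega>)\<^sup>2 * (\<tau> (Suc i) - \<tau> i)" if "i < m" for i \<omega>
    using g(1)[of i "Suc i"] that by simp
  have xm: "\<xi> i \<in> borel_measurable (F (\<tau> i))" if "i < m" for i
    using d that by (auto simp: simple_process_data_def)
  have d': "simple_process_data M F m \<tau> \<xi>'"
    unfolding simple_process_data_def
  proof (intro conjI allI impI)
    show "0 \<le> \<tau> 0" using g(2)[of 0 0] by simp
    fix i assume i: "i < m"
    show "\<tau> i \<le> \<tau> (Suc i)" using g(1)[of i "Suc i"] i by simp
    have "\<xi> j \<in> borel_measurable (F (\<tau> i))" if "j < Suc i" for j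
    proof (rule measurable_F_mono)
      show "\<tau> j \<le> \<tau> i" using g(1)[of j i] that i by simp
      show "\<xi> j \<in> borel_measurable (F (\<tau> j))" using xm[of j] that i by simp
    qed
    then have [measurable]: "?E (Suc i) \<in> borel_measurable (F (\<tau> i))"
      by (intro borel_measurable_sum borel_measurable_times borel_measurable_power) auto
    note xm[OF i, measurable]
    show "\<xi>' i \<in> borel_measurable (F (\<tau> i))"
      unfolding \<xi>'_def[abs_def] by measurable
    obtain c where "\<forall>\<omega>\<in>space M. \<bar>\<xi> i \<omega>\<bar> \<le> c"
      using d i unfolding simple_process_data_def by blast
    then show "\<exists>c. \<forall>\<omega>\<in>space M. \<bar>\<xi>' i \<omega>\<bar> \<le> c"
      by (intro exI[of _ "max c 0"]) (auto simp: \<xi>'_def)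
  qed
  have xM: "\<xi> i \<in> borel_measurable M" if "i < m" for i
    using measurable_F_M[OF _ xm[OF that]] g(2)[of i i] that by simp
  have xM': "\<xi>' i \<in> borel_measurable M" if "i < m" for i
    using measurable_F_M[of "\<tau> i" "\<xi>' i"] g(2)[of i i] d' that by (auto simp: simple_process_data_def)
  have le: "k \<le> m \<Longrightarrow> (\<Sum>i<k. (\<xi>' i \<omega>)\<^sup>2 * (\<tau> (Suc i) - \<tau> i)) \<le> min \<delta> (?E k \<omega>)" for k \<omega>
  proof (induction k)
    case (Suc k)
    then have IH: "(\<Sum>i<k. (\<xi>' i \<omega>)\<^sup>2 * (\<tau> (Suc i) - \<tau> i)) \<le> min \<delta> (?E k \<omega>)" by simp
    show ?case
    proof (cases "?E (Suc k) \<omega> \<le> \<delta>")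
      case True
      then show ?thesis using IH by (simp add: \<xi>'_def)
    next
      case False
      then have "\<xi>' k \<omega> = 0" by (simp add: \<xi>'_def)
      then show ?thesis using IH nn[of k \<omega>] Suc.prems by simp
    qed
  qed (use assms in simp)
  have eq: "?S' \<omega> = ?S \<omega>" if "?E m \<omega> \<le> \<delta>" for \<omega>
    unfolding step_sum_def
  proof (intro sum.cong refl)
    fix i assume i: "i \<in> {..<m}"
    have "?E (Suc i) \<omega> \<le> ?E m \<omega>"
      using i nn by (intro sum_mono2) auto
    then show "\<xi>' i \<omega> * (B (\<tau> (Suc i)) \<omega> - B (\<tau> i) \<omega>) = \<xi> i \<omega> * (B (\<tau> (Suc i)) \<omega> - B (\<tau> i) \<omega>)"
      using that by (simp add: \<xi>'_def)
  qed
  have Em [measurable]: "?E m \<in> borel_measurable M"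
    using xM by (intro borel_measurable_sum borel_measurable_times borel_measurable_power) auto
  note Sm [measurable] = step_sum_measurable[OF d] step_sum_measurable[OF d']
  have iso: "integrable M (\<lambda>\<omega>. (?S' \<omega>)\<^sup>2)"
    "expectation (\<lambda>\<omega>. (?S' \<omega>)\<^sup>2) = (\<Sum>i<m. expectation (\<lambda>\<omega>. (\<xi>' i \<omega>)\<^sup>2) * (\<tau> (Suc i) - \<tau> i))"
    using step_sum_isometry[OF d'] by auto
  have ix: "integrable M (\<lambda>\<omega>. (\<xi>' i \<omega>)\<^sup>2)" if i: "i < m" for i
  proof -
    obtain c where c: "\<And>\<omega>. \<omega> \<in> space M \<Longrightarrow> \<bar>\<xi>' i \<omega>\<bar> \<le> c"
      using d' i unfolding simple_process_data_def by blast
    show ?thesis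
      using c xM'[OF i] by (intro integrable_const_bound[where B="c\<^sup>2"]) (auto simp: abs_le_square_iff[symmetric] intro!: AE_I2 order_trans[OF c])
  qed
  have "expectation (\<lambda>\<omega>. (?S' \<omega>)\<^sup>2) = expectation (\<lambda>\<omega>. \<Sum>i<m. (\<xi>' i \<omega>)\<^sup>2 * (\<tau> (Suc i) - \<tau> i))"
    unfolding iso(2) using ix by (subst Bochner_Integration.integral_sum) auto
  also have "\<dots> \<le> expectation (\<lambda>\<omega>. \<delta>)"
    using ix le[of m] by (intro integral_mono Bochner_Integration.integrable_sum) auto
  finally have E: "expectation (\<lambda>\<omega>. (?S' \<omega>)\<^sup>2) \<le> \<delta>" by (simp add: prob_space)
  have "\<P>(\<omega> in M. \<bar>?S' \<omega>\<bar> > \<epsilon>) \<le> \<P>(\<omega> in M. (?S' \<omega>)\<^sup>2 \<ge> \<epsilon>\<^sup>2)"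
    using assms(2) by (intro finite_measure_mono) (auto simp: abs_le_square_iff[symmetric])
  also have "\<dots> \<le> expectation (\<lambda>\<omega>. (?S' \<omega>)\<^sup>2) / \<epsilon>\<^sup>2"
    using iso(1) assms(2) by (intro integral_Markov_inequality_measure[where A="{}"]) auto
  also have "\<dots> \<le> \<delta> / \<epsilon>\<^sup>2" using E by (intro divide_right_mono) auto
  finally have 1: "\<P>(\<omega> in M. \<bar>?S' \<omega>\<bar> > \<epsilon>) \<le> \<delta> / \<epsilon>\<^sup>2" .
  have "\<P>(\<omega> in M. \<bar>?S \<omega>\<bar> > \<epsilon>) \<le> \<P>(\<omega> in M. ?E m \<omega> > \<delta>) + \<P>(\<omega> in M. \<bar>?S' \<omega>\<bar> > \<epsilon>)"
  proof (rule prob_le_Un, rule subsetI)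
    fix \<omega> assume "\<omega> \<in> {\<omega>\<in>space M. \<bar>?S \<omega>\<bar> > \<epsilon>}"
    then show "\<omega> \<in> {\<omega>\<in>space M. ?E m \<omega> > \<delta>} \<union> {\<omega>\<in>space M. \<bar>?S' \<omega>\<bar> > \<epsilon>}"
      using eq[of \<omega>] by (cases "?E m \<omega> \<le> \<delta>") auto
  qed measurable
  then show ?thesis using 1 by simp
qed

end

section \<open>Stochastic integrals over the half line\<close>

context brownian_space begin

abbreviation jointly_measurable :: "(real \<Rightarrow> 'a \<Rightarrow> real) \<Rightarrow> bool" where
  "jointly_measurable H \<equiv> (\<lambda>(s, \<omega>). H s \<omega>) \<in> borel_measurable (borel \<Otimes>\<^sub>M M)"

definition ito_approximation ::
    "(real \<Rightarrow> 'a \<Rightarrow> real) \<Rightarrow> ('a \<Rightarrow> real) \<Rightarrow> real \<Rightarrow> nat \<Rightarrow> (nat \<Rightarrow> real) \<Rightarrow> (nat \<Rightarrow> 'a \<Rightarrow> real) \<Rightarrow> bool" where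
  "ito_approximation H I \<epsilon> m \<tau> \<xi> \<longleftrightarrow> simple_process_data M F m \<tau> \<xi> \<and>
     \<P>(\<omega> in M. energy (\<lambda>s. simple_process m \<tau> \<xi> s \<omega> - H s \<omega>) > ennreal \<epsilon>) < \<epsilon> \<and>
     \<P>(\<omega> in M. \<bar>ito_sum m \<tau> \<xi> \<omega> - I \<omega>\<bar> > \<epsilon>) < \<epsilon>"

text \<open>The Ito integral over \<open>[0, \<infinity>)\<close>, with convergence in probability of simple
  processes and of their integrals written in terms of a single \<open>\<epsilon>\<close>. An integral over
  \<open>[0, t]\<close> is the case of an integrand that vanishes outside \<open>[0, t]\<close>; integrals
  over different intervals can thus be added. Joint measurability ensures that the events in the definition
  are measurable.\<close>

definition stoch_integral :: "(real \<Rightarrow> 'a \<Rightarrow> real) \<Rightarrow> ('a \<Rightarrow> real) \<Rightarrow> bool" where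
  "stoch_integral H I \<longleftrightarrow> I \<in> borel_measurable M \<and> jointly_measurable H \<and>
     (\<forall>\<epsilon>>0. \<exists>m \<tau> \<xi>. ito_approximation H I \<epsilon> m \<tau> \<xi>)"

lemma energy_measurable:
  assumes "jointly_measurable H"
  shows "(\<lambda>\<omega>. energy (\<lambda>s. H s \<omega>)) \<in> borel_measurable M"
proof -
  have "(\<lambda>(\<omega>, s). H s \<omega>) \<in> borel_measurable (M \<Otimes>\<^sub>M lborel)"
    using measurable_compose[OF measurable_pair_swap', OF assms] by (simp add: split_beta' cong: measurable_cong_sets)
  then show ?thesis by measurable
qed

lemma simple_process_data_measurable:
  assumes "simple_process_data M F m \<tau> \<xi>" "i < m"
  shows "\<xi> i \<in> borel_measurable M"
proof (rule measurable_F_M)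
  show "0 \<le> \<tau> i" using simple_process_data_grid(2)[OF assms(1), of i i] assms by simp
  show "\<xi> i \<in> borel_measurable (F (\<tau> i))" using assms by (simp add: simple_process_data_def)
qed

lemma simple_process_measurable:
  assumes "simple_process_data M F m \<tau> \<xi>"
  shows "jointly_measurable (simple_process m \<tau> \<xi>)"
proof -
  have "(\<lambda>z. \<xi> i (snd z) * indicat_real {\<tau> i<..\<tau> (Suc i)} (fst z)) \<in> borel_measurable (borel \<Otimes>\<^sub>M M)"
    if "i < m" for i
  proof -
    note [measurable] = simple_process_data_measurable[OF assms that]
    show ?thesis by measurable
  qed
  then show ?thesis
    unfolding simple_process_def split_beta' by (intro borel_measurable_sum) auto
qed

lemma jointly_measurable_diff:
  assumes "jointly_measurable H" "jointly_measurable G"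
  shows "jointly_measurable (\<lambda>s \<omega>. H s \<omega> - G s \<omega>)"
  using borel_measurable_diff[OF assms] by (simp add: split_beta')

lemma section_measurable:
  assumes "jointly_measurable H" "\<omega> \<in> space M"
  shows "(\<lambda>s. H s \<omega>) \<in> borel_measurable borel"
  using measurable_compose[OF measurable_Pair2'[OF assms(2)] assms(1)] by simp

lemma stoch_integral_simple:
  assumes d: "simple_process_data M F m \<tau> \<xi>"
  shows "stoch_integral (simple_process m \<tau> \<xi>) (ito_sum m \<tau> \<xi>)"
  unfolding stoch_integral_def
proof (intro conjI allI impI)
  fix \<epsilon> :: real assume "0 < \<epsilon>"
  with d have "ito_approximation (simple_process m \<tau> \<xi>) (ito_sum m \<tau> \<xi>) \<epsilon> m \<tau> \<xi>"
    by (simp add: ito_approximation_def)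
  then show "\<exists>m' \<tau>' \<xi>'. ito_approximation (simple_process m \<tau> \<xi>) (ito_sum m \<tau> \<xi>) \<epsilon> m' \<tau>' \<xi>'" by blast
qed (use step_sum_measurable[OF d] simple_process_measurable[OF d] in auto)

lemma stoch_integral_add:
  assumes 1: "stoch_integral H1 I1" and 2: "stoch_integral H2 I2"
  shows "stoch_integral (\<lambda>s \<omega>. H1 s \<omega> + H2 s \<omega>) (\<lambda>\<omega>. I1 \<omega> + I2 \<omega>)"
  unfolding stoch_integral_def
proof (intro conjI allI impI)
  have Hm: "jointly_measurable H1" "jointly_measurable H2"
    and [measurable]: "I1 \<in> borel_measurable M" "I2 \<in> borel_measurable M"
    using 1 2 by (auto simp: stoch_integral_def)
  show "(\<lambda>\<omega>. I1 \<omega> + I2 \<omega>) \<in> borel_measurable M" by measurable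
  show "jointly_measurable (\<lambda>s \<omega>. H1 s \<omega> + H2 s \<omega>)"
    using borel_measurable_add[OF Hm] by (simp add: split_beta')
  fix \<epsilon> :: real assume e: "0 < \<epsilon>"
  then have e4: "0 < \<epsilon> / 4" by simp
  from 1 e4 obtain m1 \<tau>1 \<xi>1 where "ito_approximation H1 I1 (\<epsilon> / 4) m1 \<tau>1 \<xi>1"
    unfolding stoch_integral_def by blast
  note d1 = this[unfolded ito_approximation_def]
  from 2 e4 obtain m2 \<tau>2 \<xi>2 where "ito_approximation H2 I2 (\<epsilon> / 4) m2 \<tau>2 \<xi>2"
    unfolding stoch_integral_def by blast
  note d2 = this[unfolded ito_approximation_def]
  obtain m \<tau> \<xi> where d: "simple_process_data M F m \<tau> \<xi>"
    "\<And>\<omega> f. step_sum m \<tau> (\<lambda>i. \<xi> i \<omega>) f = step_sum m1 \<tau>1 (\<lambda>i. \<xi>1 i \<omega>) f + step_sum m2 \<tau>2 (\<lambda>i. \<xi>2 i \<omega>) f"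
    "\<And>s \<omega>. simple_process m \<tau> \<xi> s \<omega> = simple_process m1 \<tau>1 \<xi>1 s \<omega> + simple_process m2 \<tau>2 \<xi>2 s \<omega>"
    using simple_process_add[of m1 \<tau>1 \<xi>1 m2 \<tau>2 \<xi>2] d1 d2 by blast
  let ?d1 = "\<lambda>s \<omega>. simple_process m1 \<tau>1 \<xi>1 s \<omega> - H1 s \<omega>" and ?d2 = "\<lambda>s \<omega>. simple_process m2 \<tau>2 \<xi>2 s \<omega> - H2 s \<omega>"
  have p: "jointly_measurable ?d1" "jointly_measurable ?d2"
    using d1 d2 Hm by (auto intro!: jointly_measurable_diff simple_process_measurable)
  have [measurable]: "ito_sum m1 \<tau>1 \<xi>1 \<in> borel_measurable M" "ito_sum m2 \<tau>2 \<xi>2 \<in> borel_measurable M"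
    using step_sum_measurable d1 d2 by auto
  note [measurable] = p[THEN energy_measurable]
  have "\<P>(\<omega> in M. energy (\<lambda>s. simple_process m \<tau> \<xi> s \<omega> - (H1 s \<omega> + H2 s \<omega>)) > ennreal \<epsilon>)
      \<le> \<P>(\<omega> in M. energy (\<lambda>s. ?d1 s \<omega>) > ennreal (\<epsilon> / 4)) + \<P>(\<omega> in M. energy (\<lambda>s. ?d2 s \<omega>) > ennreal (\<epsilon> / 4))"
  proof (rule prob_le_Un, rule subsetI, rule ccontr)
    fix \<omega> assume w: "\<omega> \<in> {\<omega> \<in> space M. energy (\<lambda>s. simple_process m \<tau> \<xi> s \<omega> - (H1 s \<omega> + H2 s \<omega>)) > ennreal \<epsilon>}"
      "\<omega> \<notin> {\<omega> \<in> space M. energy (\<lambda>s. ?d1 s \<omega>) > ennreal (\<epsilon> / 4)} \<union> {\<omega> \<in> space M. energy (\<lambda>s. ?d2 s \<omega>) > ennreal (\<epsilon> / 4)}"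
    then have s: "\<omega> \<in> space M" and le: "energy (\<lambda>s. ?d1 s \<omega>) \<le> ennreal (\<epsilon> / 4)" "energy (\<lambda>s. ?d2 s \<omega>) \<le> ennreal (\<epsilon> / 4)"
      by auto
    have "energy (\<lambda>s. ?d1 s \<omega> + ?d2 s \<omega>) \<le> ennreal (2 * (\<epsilon> / 4) + 2 * (\<epsilon> / 4))"
      by (rule energy_add_le[OF p[THEN section_measurable, OF s] le]) (use e in auto)
    also have "(\<lambda>s. ?d1 s \<omega> + ?d2 s \<omega>) = (\<lambda>s. simple_process m \<tau> \<xi> s \<omega> - (H1 s \<omega> + H2 s \<omega>))"
      by (simp add: d(3) algebra_simps)
    also have "2 * (\<epsilon> / 4) + 2 * (\<epsilon> / 4) = \<epsilon>" by simp
    finally show False using w(1) leD by blast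
  qed measurable
  moreover have "\<P>(\<omega> in M. \<bar>ito_sum m \<tau> \<xi> \<omega> - (I1 \<omega> + I2 \<omega>)\<bar> > \<epsilon>)
      \<le> \<P>(\<omega> in M. \<bar>ito_sum m1 \<tau>1 \<xi>1 \<omega> - I1 \<omega>\<bar> > \<epsilon> / 4) + \<P>(\<omega> in M. \<bar>ito_sum m2 \<tau>2 \<xi>2 \<omega> - I2 \<omega>\<bar> > \<epsilon> / 4)"
  proof (rule prob_le_Un)
    show "{\<omega> \<in> space M. \<bar>ito_sum m \<tau> \<xi> \<omega> - (I1 \<omega> + I2 \<omega>)\<bar> > \<epsilon>} \<subseteq>
        {\<omega> \<in> space M. \<bar>ito_sum m1 \<tau>1 \<xi>1 \<omega> - I1 \<omega>\<bar> > \<epsilon> / 4} \<union> {\<omega> \<in> space M. \<bar>ito_sum m2 \<tau>2 \<xi>2 \<omega> - I2 \<omega>\<bar> > \<epsilon> / 4}"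
      using e by (auto simp: d(2) abs_if split: if_splits)
  qed measurable
  ultimately have "ito_approximation (\<lambda>s \<omega>. H1 s \<omega> + H2 s \<omega>) (\<lambda>\<omega>. I1 \<omega> + I2 \<omega>) \<epsilon> m \<tau> \<xi>"
    using d(1) d1 d2 e unfolding ito_approximation_def by linarith
  then show "\<exists>m \<tau> \<xi>. ito_approximation (\<lambda>s \<omega>. H1 s \<omega> + H2 s \<omega>) (\<lambda>\<omega>. I1 \<omega> + I2 \<omega>) \<epsilon> m \<tau> \<xi>" by blast
qed

lemma stoch_integral_scale:
  assumes 1: "stoch_integral H I"
  shows "stoch_integral (\<lambda>s \<omega>. c * H s \<omega>) (\<lambda>\<omega>. c * I \<omega>)"
  unfolding stoch_integral_def
proof (intro conjI allI impI)
  have Hm: "jointly_measurable H" and [measurable]: "I \<in> borel_measurable M"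
    using 1 by (auto simp: stoch_integral_def)
  show "(\<lambda>\<omega>. c * I \<omega>) \<in> borel_measurable M" by measurable
  show "jointly_measurable (\<lambda>s \<omega>. c * H s \<omega>)"
    using borel_measurable_times[OF borel_measurable_const Hm, of c] by (simp add: split_beta')
  fix \<epsilon> :: real assume e: "0 < \<epsilon>"
  \<comment> \<open>the denominator dominates \<open>1\<close>, \<open>\<bar>c\<bar>\<close> and \<open>c\<^sup>2\<close> simultaneously\<close>
  define \<delta> where "\<delta> = \<epsilon> / (c\<^sup>2 + 1)"
  have c1: "0 < c\<^sup>2 + 1" by (simp add: add_nonneg_pos)
  have dl: "0 < \<delta>" using e c1 by (simp add: \<delta>_def)
  have dm: "(c\<^sup>2 + 1) * \<delta> = \<epsilon>" using c1 by (simp add: \<delta>_def)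
  have dle: "\<delta> \<le> \<epsilon>" "c\<^sup>2 * \<delta> \<le> \<epsilon>" using dm dl by (auto simp: algebra_simps)
  have "\<bar>c\<bar> \<le> c\<^sup>2 + 1" using sum_squares_bound[of "\<bar>c\<bar>" 1] by simp
  then have dc: "\<bar>c\<bar> * \<delta> \<le> \<epsilon>" using dm dl by (metis mult_right_mono less_imp_le)
  from 1 dl obtain m \<tau> \<xi> where "ito_approximation H I \<delta> m \<tau> \<xi>"
    unfolding stoch_integral_def by blast
  then have d: "simple_process_data M F m \<tau> \<xi>"
    "\<P>(\<omega> in M. energy (\<lambda>s. simple_process m \<tau> \<xi> s \<omega> - H s \<omega>) > ennreal \<delta>) < \<delta>"
    "\<P>(\<omega> in M. \<bar>ito_sum m \<tau> \<xi> \<omega> - I \<omega>\<bar> > \<delta>) < \<delta>"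
    by (auto simp: ito_approximation_def)
  let ?\<xi> = "\<lambda>i \<omega>. c * \<xi> i \<omega>"
  have d': "simple_process_data M F m \<tau> ?\<xi>"
    unfolding simple_process_data_def
  proof (intro conjI allI impI)
    show "0 \<le> \<tau> 0" using d(1) by (simp add: simple_process_data_def)
    fix i assume i: "i < m"
    show "\<tau> i \<le> \<tau> (Suc i)" using d(1) i by (simp add: simple_process_data_def)
    have "\<xi> i \<in> borel_measurable (F (\<tau> i))" using d(1) i by (simp add: simple_process_data_def)
    then show "(\<lambda>\<omega>. c * \<xi> i \<omega>) \<in> borel_measurable (F (\<tau> i))" by simp
    obtain C where "\<forall>\<omega>\<in>space M. \<bar>\<xi> i \<omega>\<bar> \<le> C"
      using d(1) i unfolding simple_process_data_def by blast
    then show "\<exists>C. \<forall>\<omega>\<in>space M. \<bar>c * \<xi> i \<omega>\<bar> \<le> C"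
      by (intro exI[of _ "\<bar>c\<bar> * C"]) (auto simp: abs_mult intro: mult_left_mono)
  qed
  have sp: "simple_process m \<tau> ?\<xi> s \<omega> = c * simple_process m \<tau> \<xi> s \<omega>" for s \<omega>
    unfolding simple_process_def sum_distrib_left by (intro sum.cong refl) (simp add: mult.assoc)
  have ss: "step_sum m \<tau> (\<lambda>i. c * \<xi> i \<omega>) f = c * step_sum m \<tau> (\<lambda>i. \<xi> i \<omega>) f" for f \<omega>
    by (simp add: step_sum_def sum_distrib_left mult.assoc)
  note p = jointly_measurable_diff[OF simple_process_measurable[OF d(1)] Hm]
  note [measurable] = energy_measurable[OF p] step_sum_measurable[OF d(1)]
  have A: "\<P>(\<omega> in M. energy (\<lambda>s. simple_process m \<tau> ?\<xi> s \<omega> - c * H s \<omega>) > ennreal \<epsilon>)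
     \<le> \<P>(\<omega> in M. energy (\<lambda>s. simple_process m \<tau> \<xi> s \<omega> - H s \<omega>) > ennreal \<delta>)"
  proof (rule finite_measure_mono, rule subsetI, rule ccontr)
    fix \<omega> assume w: "\<omega> \<in> {\<omega> \<in> space M. energy (\<lambda>s. simple_process m \<tau> ?\<xi> s \<omega> - c * H s \<omega>) > ennreal \<epsilon>}"
      "\<omega> \<notin> {\<omega> \<in> space M. energy (\<lambda>s. simple_process m \<tau> \<xi> s \<omega> - H s \<omega>) > ennreal \<delta>}"
    then have s: "\<omega> \<in> space M" and le: "energy (\<lambda>s. simple_process m \<tau> \<xi> s \<omega> - H s \<omega>) \<le> ennreal \<delta>" by auto
    have [measurable]: "(\<lambda>s. simple_process m \<tau> \<xi> s \<omega> - H s \<omega>) \<in> borel_measurable lborel"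
      using section_measurable[OF p s] by simp
    have "energy (\<lambda>s. simple_process m \<tau> ?\<xi> s \<omega> - c * H s \<omega>) =
        (\<integral>\<^sup>+s. ennreal (c\<^sup>2) * ennreal ((simple_process m \<tau> \<xi> s \<omega> - H s \<omega>)\<^sup>2) \<partial>lborel)"
      by (intro nn_integral_cong) (simp add: sp ennreal_mult'[symmetric] power_mult_distrib[symmetric] right_diff_distrib)
    also have "\<dots> = ennreal (c\<^sup>2) * energy (\<lambda>s. simple_process m \<tau> \<xi> s \<omega> - H s \<omega>)"
      by (rule nn_integral_cmult) measurable
    also have "\<dots> \<le> ennreal (c\<^sup>2) * ennreal \<delta>" by (intro mult_left_mono le) auto
    also have "\<dots> \<le> ennreal \<epsilon>" using dle(2) by (simp add: ennreal_mult'[symmetric] ennreal_leI)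
    finally show False using w(1) leD by blast
  qed measurable
  have "\<P>(\<omega> in M. \<bar>ito_sum m \<tau> ?\<xi> \<omega> - c * I \<omega>\<bar> > \<epsilon>) \<le> \<P>(\<omega> in M. \<bar>ito_sum m \<tau> \<xi> \<omega> - I \<omega>\<bar> > \<delta>)"
  proof (rule finite_measure_mono, rule subsetI, rule ccontr)
    fix \<omega> assume w: "\<omega> \<in> {\<omega> \<in> space M. \<bar>ito_sum m \<tau> ?\<xi> \<omega> - c * I \<omega>\<bar> > \<epsilon>}"
      "\<omega> \<notin> {\<omega> \<in> space M. \<bar>ito_sum m \<tau> \<xi> \<omega> - I \<omega>\<bar> > \<delta>}"
    then have "\<bar>ito_sum m \<tau> \<xi> \<omega> - I \<omega>\<bar> \<le> \<delta>" by auto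
    then have "\<bar>c\<bar> * \<bar>ito_sum m \<tau> \<xi> \<omega> - I \<omega>\<bar> \<le> \<bar>c\<bar> * \<delta>" by (intro mult_left_mono) auto
    then show False using w(1) dc by (simp add: ss abs_mult[symmetric] right_diff_distrib)
  qed measurable
  with A d' d(2,3) dle(1) have "ito_approximation (\<lambda>s \<omega>. c * H s \<omega>) (\<lambda>\<omega>. c * I \<omega>) \<epsilon> m \<tau> ?\<xi>"
    unfolding ito_approximation_def by linarith
  then show "\<exists>m \<tau> \<xi>. ito_approximation (\<lambda>s \<omega>. c * H s \<omega>) (\<lambda>\<omega>. c * I \<omega>) \<epsilon> m \<tau> \<xi>" by blast
qed

lemma stoch_integral_sum:
  assumes "finite J" "\<And>j. j \<in> J \<Longrightarrow> stoch_integral (H j) (I j)"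
  shows "stoch_integral (\<lambda>s \<omega>. \<Sum>j\<in>J. H j s \<omega>) (\<lambda>\<omega>. \<Sum>j\<in>J. I j \<omega>)"
  using assms
proof (induction J rule: finite_induct)
  case empty
  have "stoch_integral (simple_process 0 (\<lambda>_. 0) (\<lambda>_ _. 0)) (ito_sum 0 (\<lambda>_. 0) (\<lambda>_ _. 0))"
    by (rule stoch_integral_simple) (simp add: simple_process_data_def)
  then show ?case by (simp add: simple_process_def[abs_def] step_sum_def)
next
  case (insert j J)
  then show ?case using stoch_integral_add[of "H j" "I j"] by simp
qed

text \<open>Transfer from simple processes: an approximating simple process has energy at most \<open>4 *
  \<delta>\<close> unless the energy of \<open>H\<close>, or its distance from \<open>H\<close>, exceeds
  \<open>\<delta>\<close>; and its integral exceeds \<open>\<epsilon> / 2\<close> if \<open>I\<close> exceeds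
  \<open>\<epsilon>\<close> and is close to it. This gives the constant \<open>4 / (1/2)\<^sup>2 =
  16\<close>.\<close>

lemma stoch_integral_tail_bound:
  assumes si: "stoch_integral H I" and e: "0 < \<epsilon>" and dl: "0 < \<delta>"
  shows "\<P>(\<omega> in M. \<bar>I \<omega>\<bar> > \<epsilon>) \<le> \<P>(\<omega> in M. energy (\<lambda>s. H s \<omega>) > ennreal \<delta>) + 16 * \<delta> / \<epsilon>\<^sup>2"
proof (rule field_le_epsilon)
  fix \<eta> :: real assume "0 < \<eta>"
  \<comment> \<open>the accuracy of the approximation: each of the two exceptional events of the approximation costs at most \<open>\<eta> / 2\<close>\<close>
  define \<theta> where "\<theta> = Min {\<eta> / 2, \<delta>, \<epsilon> / 2}"
  have th: "0 < \<theta>" "\<theta> \<le> \<eta> / 2" "\<theta> \<le> \<delta>" "\<theta> \<le> \<epsilon> / 2" using \<open>0 < \<eta>\<close> e dl by (auto simp: \<theta>_def)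
  have Hm: "jointly_measurable H" and [measurable]: "I \<in> borel_measurable M" using si by (auto simp: stoch_integral_def)
  from si th(1) obtain m \<tau> \<xi> where "ito_approximation H I \<theta> m \<tau> \<xi>"
    unfolding stoch_integral_def by blast
  then have d: "simple_process_data M F m \<tau> \<xi>"
    "\<P>(\<omega> in M. energy (\<lambda>s. simple_process m \<tau> \<xi> s \<omega> - H s \<omega>) > ennreal \<theta>) < \<theta>"
    "\<P>(\<omega> in M. \<bar>ito_sum m \<tau> \<xi> \<omega> - I \<omega>\<bar> > \<theta>) < \<theta>"
    by (auto simp: ito_approximation_def)
  let ?D = "\<lambda>\<omega>. energy (\<lambda>s. simple_process m \<tau> \<xi> s \<omega> - H s \<omega>)" and ?Q = "\<lambda>\<omega>. energy (\<lambda>s. H s \<omega>)"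
  let ?S = "ito_sum m \<tau> \<xi>" and ?E = "\<lambda>\<omega>. \<Sum>i<m. (\<xi> i \<omega>)\<^sup>2 * (\<tau> (Suc i) - \<tau> i)"
  note p = jointly_measurable_diff[OF simple_process_measurable[OF d(1)] Hm]
  note [measurable] = energy_measurable[OF p] energy_measurable[OF Hm] step_sum_measurable[OF d(1)]
  have "\<P>(\<omega> in M. ?E \<omega> > 4 * \<delta>) \<le> \<P>(\<omega> in M. ?Q \<omega> > ennreal \<delta>) + \<P>(\<omega> in M. ?D \<omega> > ennreal \<theta>)"
  proof (rule prob_le_Un, rule subsetI, rule ccontr)
    fix \<omega> assume w: "\<omega> \<in> {\<omega> \<in> space M. ?E \<omega> > 4 * \<delta>}"
      "\<omega> \<notin> {\<omega> \<in> space M. ?Q \<omega> > ennreal \<delta>} \<union> {\<omega> \<in> space M. ?D \<omega> > ennreal \<theta>}"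
    then have s: "\<omega> \<in> space M" and Q: "?Q \<omega> \<le> ennreal \<delta>" and D: "?D \<omega> \<le> ennreal \<theta>" by auto
    have "ennreal (?E \<omega>) = energy (\<lambda>s. H s \<omega> + (simple_process m \<tau> \<xi> s \<omega> - H s \<omega>))"
      using nn_integral_simple_process_square[OF d(1), of \<omega>] by simp
    also have "\<dots> \<le> ennreal (2 * \<delta> + 2 * \<theta>)"
      by (rule energy_add_le[OF section_measurable[OF Hm s] section_measurable[OF p s] Q D]) (use dl th in auto)
    also have "\<dots> \<le> ennreal (4 * \<delta>)" using th by (intro ennreal_leI) simp
    finally show False using w(1) dl by (simp add: ennreal_le_iff)
  qed measurable
  then have 1: "\<P>(\<omega> in M. ?E \<omega> > 4 * \<delta>) \<le> \<P>(\<omega> in M. ?Q \<omega> > ennreal \<delta>) + \<theta>" using d(2) by simp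
  have 2: "\<P>(\<omega> in M. \<bar>?S \<omega>\<bar> > \<epsilon> / 2) \<le> \<P>(\<omega> in M. ?E \<omega> > 4 * \<delta>) + 16 * \<delta> / \<epsilon>\<^sup>2"
    using step_sum_tail_bound[OF d(1), of "\<epsilon> / 2" "4 * \<delta>"] e dl by (simp add: power_divide)
  have "\<P>(\<omega> in M. \<bar>I \<omega>\<bar> > \<epsilon>) \<le> \<P>(\<omega> in M. \<bar>?S \<omega>\<bar> > \<epsilon> / 2) + \<P>(\<omega> in M. \<bar>?S \<omega> - I \<omega>\<bar> > \<theta>)"
  proof (rule prob_le_Un)
    show "{\<omega> \<in> space M. \<bar>I \<omega>\<bar> > \<epsilon>} \<subseteq> {\<omega> \<in> space M. \<bar>?S \<omega>\<bar> > \<epsilon> / 2} \<union> {\<omega> \<in> space M. \<bar>?S \<omega> - I \<omega>\<bar> > \<theta>}"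
      using th by (auto simp: abs_if split: if_splits)
  qed measurable
  then show "\<P>(\<omega> in M. \<bar>I \<omega>\<bar> > \<epsilon>) \<le> \<P>(\<omega> in M. ?Q \<omega> > ennreal \<delta>) + 16 * \<delta> / \<epsilon>\<^sup>2 + \<eta>"
    using 1 2 d(3) th by linarith
qed

text \<open>An approximating simple process is close to \<open>H\<close> in \<open>L\<^sup>2\<close> along
  most paths, in particular along some path in \<open>A\<close>. Along a fixed path it is a deterministic step
  function.\<close>

lemma stoch_integral_frozen_path:
  assumes si: "stoch_integral H I" and A: "A \<in> events" "0 < prob A" and e: "0 < \<epsilon>"
  shows "\<exists>\<omega>\<in>A. \<exists>m \<tau> x. 0 \<le> \<tau> 0 \<and> (\<forall>i<m. \<tau> i \<le> \<tau> (Suc i)) \<and>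
    energy (\<lambda>s. simple_process m \<tau> (\<lambda>i _. x i) s \<omega> - H s \<omega>) \<le> ennreal \<epsilon>"
proof -
  define \<theta> where "\<theta> = min \<epsilon> (prob A)"
  have th: "0 < \<theta>" "\<theta> \<le> \<epsilon>" "\<theta> \<le> prob A" using e A by (auto simp: \<theta>_def)
  from si th(1) obtain m \<tau> \<xi> where "ito_approximation H I \<theta> m \<tau> \<xi>"
    unfolding stoch_integral_def by blast
  then have d: "simple_process_data M F m \<tau> \<xi>"
    "\<P>(\<omega> in M. energy (\<lambda>s. simple_process m \<tau> \<xi> s \<omega> - H s \<omega>) > ennreal \<theta>) < \<theta>"
    by (auto simp: ito_approximation_def)
  have "jointly_measurable H" using si by (simp add: stoch_integral_def)
  note [measurable] = energy_measurable[OF jointly_measurable_diff[OF simple_process_measurable[OF d(1)] this]]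
  let ?D = "{\<omega> \<in> space M. energy (\<lambda>s. simple_process m \<tau> \<xi> s \<omega> - H s \<omega>) > ennreal \<theta>}"
  have "\<not> A \<subseteq> ?D"
  proof
    assume "A \<subseteq> ?D"
    then have "prob A \<le> prob ?D" by (intro finite_measure_mono) measurable
    then show False using d(2) th by linarith
  qed
  then obtain \<omega> where w: "\<omega> \<in> A" "\<omega> \<notin> ?D" by blast
  then have "energy (\<lambda>s. simple_process m \<tau> \<xi> s \<omega> - H s \<omega>) \<le> ennreal \<theta>"
    using sets.sets_into_space[OF A(1)] by auto
  also have "\<dots> \<le> ennreal \<epsilon>" using th by (intro ennreal_leI)
  finally show ?thesis
    using w(1) d(1) by (intro bexI[of _ \<omega>] exI[of _ m] exI[of _ \<tau>] exI[of _ "\<lambda>i. \<xi> i \<omega>"])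
      (auto simp: simple_process_def simple_process_data_def)
qed

text \<open>The given simple processes are cut off at time \<open>t\<close>. This amounts to replacing every
  grid point \<open>\<tau> i\<close> by \<open>min t (\<tau> i)\<close> and dropping the coefficients of the
  intervals that collapse, which need not be known at time \<open>t\<close>.\<close>

lemma has_ito_integral_imp_stoch_integral:
  assumes ito: "has_ito_integral M F B H t I" and t: "0 \<le> t"
  shows "stoch_integral (\<lambda>s \<omega>. indicat_real {0..t} s * H s \<omega>) I"
  unfolding stoch_integral_def
proof (intro conjI allI impI)
  show "I \<in> borel_measurable M" using ito by (simp add: has_ito_integral_def)
  have pm: "(\<lambda>(s, \<omega>). H s \<omega>) \<in> borel_measurable (restrict_space borel {0..t} \<Otimes>\<^sub>M F t)"
    using ito t by (auto simp: has_ito_integral_def progressive_on_def)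
  have c: "(\<lambda>s. max 0 (min s t)) \<in> measurable borel (restrict_space borel {0..t})"
    using t by (intro measurable_restrict_space2) auto
  have i: "(\<lambda>\<omega>. \<omega>) \<in> measurable M (F t)"
    using subalgebra_F[OF t] by (auto simp: subalgebra_def measurable_def)
  \<comment> \<open>the map that projects time onto \<open>[0, t]\<close> transports progressive measurability to the whole line\<close>
  have "(\<lambda>z. (max 0 (min (fst z) t), snd z)) \<in> measurable (borel \<Otimes>\<^sub>M M) (restrict_space borel {0..t} \<Otimes>\<^sub>M F t)"
    by (intro measurable_Pair measurable_compose[OF measurable_fst c] measurable_compose[OF measurable_snd i])
  from measurable_compose[OF this pm]
  have "(\<lambda>z. H (max 0 (min (fst z) t)) (snd z)) \<in> borel_measurable (borel \<Otimes>\<^sub>M M)" by simp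
  then have "(\<lambda>z. indicat_real {0..t} (fst z) * H (max 0 (min (fst z) t)) (snd z)) \<in> borel_measurable (borel \<Otimes>\<^sub>M M)"
    by (intro borel_measurable_times) measurable
  also have "(\<lambda>z. indicat_real {0..t} (fst z) * H (max 0 (min (fst z) t)) (snd z)) = (\<lambda>(s, \<omega>). indicat_real {0..t} s * H s \<omega>)"
    by (auto simp: fun_eq_iff indicator_def)
  finally show "jointly_measurable (\<lambda>s \<omega>. indicat_real {0..t} s * H s \<omega>)" .
  fix \<epsilon> :: real assume e: "0 < \<epsilon>"
  from ito obtain m \<tau> \<xi> where d: "\<And>n. simple_process_data M F (m n) (\<tau> n) (\<xi> n)"
    and c1: "\<And>\<epsilon>. \<epsilon> > 0 \<Longrightarrow> (\<lambda>n. prob {\<omega> \<in> space M.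
            (\<integral>\<^sup>+s\<in>{0..t}. ennreal ((simple_process (m n) (\<tau> n) (\<xi> n) s \<omega> - H s \<omega>)\<^sup>2) \<partial>lborel)
              > ennreal \<epsilon>}) \<longlonglongrightarrow> 0"
    and c2: "\<And>\<epsilon>. \<epsilon> > 0 \<Longrightarrow> (\<lambda>n. prob {\<omega> \<in> space M.
            \<bar>simple_integral B (m n) (\<tau> n) (\<xi> n) t \<omega> - I \<omega>\<bar> > \<epsilon>}) \<longlonglongrightarrow> 0"
    unfolding has_ito_integral_def by blast
  have "eventually (\<lambda>n. prob {\<omega> \<in> space M.
            (\<integral>\<^sup>+s\<in>{0..t}. ennreal ((simple_process (m n) (\<tau> n) (\<xi> n) s \<omega> - H s \<omega>)\<^sup>2) \<partial>lborel)
              > ennreal \<epsilon>} < \<epsilon> \<and> prob {\<omega> \<in> space M.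
            \<bar>simple_integral B (m n) (\<tau> n) (\<xi> n) t \<omega> - I \<omega>\<bar> > \<epsilon>} < \<epsilon>) sequentially"
    using order_tendstoD(2)[OF c1[OF e] e] order_tendstoD(2)[OF c2[OF e] e] by (rule eventually_conj)
  then obtain n where n: "prob {\<omega> \<in> space M.
            (\<integral>\<^sup>+s\<in>{0..t}. ennreal ((simple_process (m n) (\<tau> n) (\<xi> n) s \<omega> - H s \<omega>)\<^sup>2) \<partial>lborel)
              > ennreal \<epsilon>} < \<epsilon>" "prob {\<omega> \<in> space M.
            \<bar>simple_integral B (m n) (\<tau> n) (\<xi> n) t \<omega> - I \<omega>\<bar> > \<epsilon>} < \<epsilon>"
    by (auto simp: eventually_sequentially)
  define \<tau>' where "\<tau>' = (\<lambda>i. min t (\<tau> n i))"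
  define \<xi>' where "\<xi>' = (\<lambda>i \<omega>. if \<tau> n i < t then \<xi> n i \<omega> else 0)"
  note g = simple_process_data_grid[OF d[of n]]
  have d': "simple_process_data M F (m n) \<tau>' \<xi>'"
    unfolding simple_process_data_def
  proof (intro conjI allI impI)
    show "0 \<le> \<tau>' 0" using t g(2)[of 0 0] by (simp add: \<tau>'_def)
    fix i assume i: "i < m n"
    show "\<tau>' i \<le> \<tau>' (Suc i)" using g(1)[of i "Suc i"] i by (simp add: \<tau>'_def)
    have x: "\<xi> n i \<in> borel_measurable (F (\<tau> n i))" using d[of n] i by (simp add: simple_process_data_def)
    show "\<xi>' i \<in> borel_measurable (F (\<tau>' i))"
    proof (cases "\<tau> n i < t")
      case True
      then have "\<xi>' i = \<xi> n i" "\<tau>' i = \<tau> n i" by (auto simp: \<xi>'_def \<tau>'_def)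
      then show ?thesis using x by simp
    next
      case False
      then have "\<xi>' i = (\<lambda>_. 0)" by (auto simp: \<xi>'_def)
      then show ?thesis by simp
    qed
    obtain C where "\<forall>\<omega>\<in>space M. \<bar>\<xi> n i \<omega>\<bar> \<le> C"
      using d[of n] i unfolding simple_process_data_def by blast
    then show "\<exists>C. \<forall>\<omega>\<in>space M. \<bar>\<xi>' i \<omega>\<bar> \<le> C"
      by (intro exI[of _ "max C 0"]) (auto simp: \<xi>'_def)
  qed
  have sp: "simple_process (m n) \<tau>' \<xi>' s \<omega> = indicat_real {0..t} s * simple_process (m n) (\<tau> n) (\<xi> n) s \<omega>" for s \<omega>
    unfolding simple_process_def sum_distrib_left
  proof (intro sum.cong refl)
    fix i assume "i \<in> {..<m n}"
    then have "0 \<le> \<tau> n i" using g(2)[of i i] by simp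
    then show "\<xi>' i \<omega> * indicat_real {\<tau>' i<..\<tau>' (Suc i)} s =
        indicat_real {0..t} s * (\<xi> n i \<omega> * indicat_real {\<tau> n i<..\<tau> n (Suc i)} s)"
      by (auto simp: \<xi>'_def \<tau>'_def indicator_def)
  qed
  have ss: "ito_sum (m n) \<tau>' \<xi>' \<omega> = simple_integral B (m n) (\<tau> n) (\<xi> n) t \<omega>" for \<omega>
    unfolding simple_integral_def step_sum_def
  proof (intro sum.cong refl)
    fix i assume "i \<in> {..<m n}"
    then have "\<tau> n i \<le> \<tau> n (Suc i)" using g(1)[of i "Suc i"] by simp
    then show "\<xi>' i \<omega> * (B (\<tau>' (Suc i)) \<omega> - B (\<tau>' i) \<omega>) =
        \<xi> n i \<omega> * (B (min t (\<tau> n (Suc i))) \<omega> - B (min t (\<tau> n i)) \<omega>)"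
      by (auto simp: \<xi>'_def \<tau>'_def min_absorb1)
  qed
  have D: "energy (\<lambda>s. simple_process (m n) \<tau>' \<xi>' s \<omega> - indicat_real {0..t} s * H s \<omega>)
     = (\<integral>\<^sup>+s\<in>{0..t}. ennreal ((simple_process (m n) (\<tau> n) (\<xi> n) s \<omega> - H s \<omega>)\<^sup>2) \<partial>lborel)" for \<omega>
    by (intro nn_integral_cong) (auto simp: sp indicator_def)
  from n d' have "ito_approximation (\<lambda>s \<omega>. indicat_real {0..t} s * H s \<omega>) I \<epsilon> (m n) \<tau>' \<xi>'"
    by (simp add: ito_approximation_def D ss)
  then show "\<exists>m \<tau> \<xi>. ito_approximation (\<lambda>s \<omega>. indicat_real {0..t} s * H s \<omega>) I \<epsilon> m \<tau> \<xi>" by blast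
qed

end

section \<open>Normal tails and averages over grids\<close>

lemma std_normal_singleton_null: "measure std_normal_distribution {x} = 0"
proof -
  have "emeasure std_normal_distribution {x} = (\<integral>\<^sup>+y. ennreal (std_normal_density y) * indicator {x} y \<partial>lborel)"
    by (rule emeasure_density) auto
  also have "\<dots> = nn_integral lborel (\<lambda>y::real. 0)"
  proof (rule nn_integral_cong_AE)
    show "AE y in lborel. ennreal (std_normal_density y) * indicator {x} y = 0"
      using AE_lborel_singleton[of x] by eventually_elim (simp add: indicator_def)
  qed
  finally show ?thesis by (simp add: measure_def)
qed

lemma isCont_std_normal_cdf: "isCont (cdf std_normal_distribution) x"
proof -
  interpret real_distribution std_normal_distribution by (rule real_dist_normal_dist)
  show ?thesis using std_normal_singleton_null by (simp add: isCont_cdf)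
qed

lemma std_normal_upper_tail:
  "measure std_normal_distribution {x..} = 1 - cdf std_normal_distribution x"
proof -
  interpret real_distribution std_normal_distribution by (rule real_dist_normal_dist)
  have "measure std_normal_distribution {..x} = measure std_normal_distribution {..<x} + measure std_normal_distribution {x}"
    by (subst finite_measure_Union[symmetric]) (auto intro!: arg_cong[where f="measure _"])
  moreover have "measure std_normal_distribution {x..} = 1 - measure std_normal_distribution {..<x}"
    using prob_compl[of "{..<x}"] by (simp add: Compl_eq_Diff_UNIV[symmetric] not_less)
  ultimately show ?thesis by (simp add: std_normal_singleton_null cdf_def)
qed

lemma std_normal_cdf_0: "cdf std_normal_distribution 0 = 1 / 2"
proof -
  have "emeasure std_normal_distribution {0..} = (\<integral>\<^sup>+y. ennreal (std_normal_density y) * indicator {0..} y \<partial>lborel)"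
    by (rule emeasure_density) auto
  also have "\<dots> = (\<integral>\<^sup>+y. ennreal (std_normal_density (- y)) * indicator {0..} (- y) \<partial>lborel)"
    using nn_integral_real_affine[of "\<lambda>y. ennreal (std_normal_density y) * indicator {0..} y" "-1" 0] by simp
  also have "\<dots> = (\<integral>\<^sup>+y. ennreal (std_normal_density y) * indicator {..0} y \<partial>lborel)"
    by (intro nn_integral_cong) (auto simp: std_normal_density_def indicator_def)
  also have "\<dots> = emeasure std_normal_distribution {..0}"
    by (rule emeasure_density[symmetric]) auto
  finally have "measure std_normal_distribution {0..} = cdf std_normal_distribution 0"
    by (simp add: cdf_def measure_def)
  then show ?thesis using std_normal_upper_tail[of 0] by simp
qed

lemma (in prob_space) normal_upper_tail:
  assumes X: "distributed M lborel X (normal_density 0 s)" and s: "0 < s"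
  shows "\<P>(\<omega> in M. X \<omega> \<ge> y) = 1 - cdf std_normal_distribution (y / s)"
proof -
  have d: "distributed M lborel (\<lambda>\<omega>. X \<omega> / s) std_normal_density"
    using X normal_standard_normal_convert[OF s, of X 0] by simp
  then have m: "(\<lambda>\<omega>. X \<omega> / s) \<in> measurable M lborel" and dd: "distr M lborel (\<lambda>\<omega>. X \<omega> / s) = std_normal_distribution"
    by (auto simp: distributed_def)
  have "\<P>(\<omega> in M. X \<omega> \<ge> y) = prob ((\<lambda>\<omega>. X \<omega> / s) -` {y / s..} \<inter> space M)"
    using s by (intro arg_cong[where f=prob]) (auto simp: divide_le_cancel)
  also have "\<dots> = measure (distr M lborel (\<lambda>\<omega>. X \<omega> / s)) {y / s..}"
    using m by (subst measure_distr) auto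
  finally show ?thesis by (simp add: dd std_normal_upper_tail)
qed

lemma (in prob_space) prob_tendsto_0_of_pointwise:
  fixes f :: "nat \<Rightarrow> 'a \<Rightarrow> real"
  assumes fm: "\<And>n. f n \<in> borel_measurable M" and f: "\<And>\<omega>. \<omega> \<in> space M \<Longrightarrow> (\<lambda>n. f n \<omega>) \<longlonglongrightarrow> 0" and "0 < \<delta>"
  shows "(\<lambda>n. \<P>(\<omega> in M. \<bar>f n \<omega>\<bar> > \<delta>)) \<longlonglongrightarrow> 0"
proof -
  note [measurable] = fm
  have "(\<lambda>n. \<integral>\<omega>. indicat_real {\<omega>\<in>space M. \<bar>f n \<omega>\<bar> > \<delta>} \<omega> \<partial>M) \<longlonglongrightarrow> (\<integral>\<omega>. 0 \<partial>M)"
  proof (rule integral_dominated_convergence[where w="\<lambda>_. 1"])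
    show "AE \<omega> in M. (\<lambda>n. indicat_real {\<omega>\<in>space M. \<bar>f n \<omega>\<bar> > \<delta>} \<omega>) \<longlonglongrightarrow> 0"
    proof (rule AE_I2)
      fix \<omega> assume w: "\<omega> \<in> space M"
      from tendsto_rabs_zero[OF f[OF w]] \<open>0 < \<delta>\<close> have "eventually (\<lambda>n. \<bar>f n \<omega>\<bar> < \<delta>) sequentially"
        by (rule order_tendstoD)
      then show "(\<lambda>n. indicat_real {\<omega>\<in>space M. \<bar>f n \<omega>\<bar> > \<delta>} \<omega>) \<longlonglongrightarrow> 0"
        by (intro tendsto_eventually) (auto elim!: eventually_mono simp: indicator_def)
    qed
  qed (auto simp: indicator_def)
  then show ?thesis by simp
qed

text \<open>If \<open>Y n\<close> is within \<open>\<epsilon>\<close> of a normal variable \<open>X\<close> up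
  to probability \<open>\<epsilon>\<close>, then the event \<open>Y n \<ge> x n\<close> lies between \<open>X
  \<ge> x n + \<epsilon>\<close> and \<open>X \<ge> x n - \<epsilon>\<close> up to probability
  \<open>\<epsilon>\<close>; the normal tail is continuous in the threshold and in the standard
  deviation.\<close>

lemma (in prob_space) prob_ge_tendsto_normal_tail:
  fixes Y :: "nat \<Rightarrow> 'a \<Rightarrow> real"
  assumes Ym: "\<And>n. Y n \<in> borel_measurable M" and s0: "0 < s0"
    and approx: "\<And>\<epsilon>. 0 < \<epsilon> \<Longrightarrow> \<epsilon> < s0 \<Longrightarrow> eventually (\<lambda>n. \<exists>X s. 0 < s \<and> \<bar>s - s0\<bar> < \<epsilon> \<and>
       distributed M lborel X (normal_density 0 s) \<and> \<P>(\<omega> in M. \<bar>Y n \<omega> - X \<omega>\<bar> > \<epsilon>) \<le> \<epsilon>) sequentially"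
    and x: "x \<longlonglongrightarrow> x0"
  shows "(\<lambda>n. \<P>(\<omega> in M. Y n \<omega> \<ge> x n)) \<longlonglongrightarrow> 1 - cdf std_normal_distribution (x0 / s0)"
proof (rule LIMSEQ_I)
  define \<Psi> where "\<Psi> z = 1 - cdf std_normal_distribution (fst z / snd z)" for z
  fix \<eta> :: real assume eta: "0 < \<eta>"
  have "isCont \<Psi> (x0, s0)"
    unfolding \<Psi>_def using s0
    by (intro continuous_intros isCont_o2[OF _ isCont_std_normal_cdf]) auto
  then obtain d where d: "0 < d" "\<And>z. dist z (x0, s0) < d \<Longrightarrow> \<bar>\<Psi> z - \<Psi> (x0, s0)\<bar> < \<eta> / 2"
    using eta unfolding continuous_at_eps_delta dist_real_def by (metis half_gt_zero)
  define \<epsilon> where "\<epsilon> = Min {d / 4, s0 / 2, \<eta> / 2}"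
  have e: "0 < \<epsilon>" "\<epsilon> \<le> d / 4" "\<epsilon> < s0" "\<epsilon> \<le> \<eta> / 2" using d s0 eta by (auto simp: \<epsilon>_def min_def)
  have close: "\<bar>\<Psi> (y, s) - \<Psi> (x0, s0)\<bar> < \<eta> / 2" if "\<bar>y - x0\<bar> < 2 * \<epsilon>" "\<bar>s - s0\<bar> < \<epsilon>" for y s
  proof (rule d(2))
    have "dist (y, s) (x0, s0) \<le> \<bar>y - x0\<bar> + \<bar>s - s0\<bar>"
      using sqrt_sum_squares_le_sum_abs[of "y - x0" "s - s0"] by (simp add: dist_prod_def dist_real_def)
    then show "dist (y, s) (x0, s0) < d" using that e by linarith
  qed
  have "eventually (\<lambda>n. \<bar>x n - x0\<bar> < \<epsilon>) sequentially"
    using tendstoD[OF x e(1)] by (simp add: dist_real_def)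
  with approx[OF e(1,3)]
  have "eventually (\<lambda>n. norm (\<P>(\<omega> in M. Y n \<omega> \<ge> x n) - \<Psi> (x0, s0)) < \<eta>) sequentially"
  proof eventually_elim
    case (elim n)
    then obtain X s where X: "0 < s" "\<bar>s - s0\<bar> < \<epsilon>" "distributed M lborel X (normal_density 0 s)"
      "\<P>(\<omega> in M. \<bar>Y n \<omega> - X \<omega>\<bar> > \<epsilon>) \<le> \<epsilon>" and xn: "\<bar>x n - x0\<bar> < \<epsilon>" by blast
    have [measurable]: "X \<in> borel_measurable M" using X(3) by (auto simp: distributed_def)
    note [measurable] = Ym
    have tail: "\<P>(\<omega> in M. X \<omega> \<ge> y) = \<Psi> (y, s)" for y
      using normal_upper_tail[OF X(3,1)] by (simp add: \<Psi>_def)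
    have "\<P>(\<omega> in M. Y n \<omega> \<ge> x n) \<le> \<P>(\<omega> in M. X \<omega> \<ge> x n - \<epsilon>) + \<P>(\<omega> in M. \<bar>Y n \<omega> - X \<omega>\<bar> > \<epsilon>)"
      by (rule prob_le_Un) auto
    then have 1: "\<P>(\<omega> in M. Y n \<omega> \<ge> x n) \<le> \<Psi> (x n - \<epsilon>, s) + \<epsilon>" using tail X(4) by simp
    have "\<P>(\<omega> in M. X \<omega> \<ge> x n + \<epsilon>) \<le> \<P>(\<omega> in M. Y n \<omega> \<ge> x n) + \<P>(\<omega> in M. \<bar>Y n \<omega> - X \<omega>\<bar> > \<epsilon>)"
      by (rule prob_le_Un) auto
    then have 2: "\<Psi> (x n + \<epsilon>, s) - \<epsilon> \<le> \<P>(\<omega> in M. Y n \<omega> \<ge> x n)" using tail X(4) by simp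
    have "\<bar>\<Psi> (x n - \<epsilon>, s) - \<Psi> (x0, s0)\<bar> < \<eta> / 2" "\<bar>\<Psi> (x n + \<epsilon>, s) - \<Psi> (x0, s0)\<bar> < \<eta> / 2"
      using xn X(2) e(1) by (intro close; linarith)+
    with 1 2 e(4) show ?case unfolding real_norm_def by linarith
  qed
  then show "\<exists>n0. \<forall>n\<ge>n0. norm (\<P>(\<omega> in M. Y n \<omega> \<ge> x n) - (1 - cdf std_normal_distribution (x0 / s0))) < \<eta>"
    by (simp add: eventually_sequentially \<Psi>_def)
qed

lemma riemann_sums_tendsto_average:
  fixes g :: "real \<Rightarrow> real"
  assumes g: "continuous_on {0..T} g" and T: "0 < T"
  shows "(\<lambda>N. (\<Sum>j=1..Suc N. g (real j / real (Suc N) * T)) / real (Suc N)) \<longlonglongrightarrow> 1 / T * (LBINT t:{0..T}. g t)"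
proof -
  let ?i = "indicat_real {0<..1}"
  obtain c where c: "\<And>x. x \<in> {0..T} \<Longrightarrow> \<bar>g x\<bar> \<le> c"
    using compact_imp_bounded[OF compact_continuous_image[OF g compact_Icc]] unfolding bounded_iff by (metis image_eqI real_norm_def)
  have c0: "0 \<le> c" using c[of 0] T by auto
  define \<phi> where "\<phi> n x = real (nat \<lceil>real (Suc n) * x\<rceil>) / real (Suc n)" for n x
  define Fn where "Fn n x = (\<Sum>j=1..Suc n. g (real j / real (Suc n) * T) * indicat_real (cell (Suc n) j) x)" for n x
  have cell: "integrable lborel (indicat_real (cell (Suc n) j))" "(\<integral>x. indicat_real (cell (Suc n) j) x \<partial>lborel) = 1 / real (Suc n)" for n j
    by (auto simp: cell_def divide_right_mono diff_divide_distrib[symmetric])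
  have int: "(\<integral>x. Fn n x \<partial>lborel) = (\<Sum>j=1..Suc n. g (real j / real (Suc n) * T)) / real (Suc n)" for n
    unfolding Fn_def using cell
    by (subst Bochner_Integration.integral_sum) (simp_all add: sum_divide_distrib del: of_nat_Suc sum.cl_ivl_Suc)
  have Fn_eq: "Fn n x = ?i x * g (\<phi> n x * T)" for n x
  proof (cases "x \<in> {0<..1}")
    case True
    then show ?thesis using sum_over_cells(2)[OF _ True, of "Suc n" "\<lambda>j. g (real j / real (Suc n) * T)"]
      unfolding Fn_def \<phi>_def by simp
  next
    case False
    then show ?thesis using cell_outside[of "Suc n"] unfolding Fn_def by (auto intro!: sum.neutral)
  qed
  have phi: "\<phi> n x * T \<in> {0..T}" if "x \<in> {0<..1}" for n x
  proof -
    have "nat \<lceil>real (Suc n) * x\<rceil> \<le> Suc n" using sum_over_cells(1)[OF _ that, of "Suc n"] by simp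
    then have "real (nat \<lceil>real (Suc n) * x\<rceil>) \<le> real (Suc n)" by (simp only: of_nat_le_iff)
    then have "\<phi> n x \<le> 1" unfolding \<phi>_def by (simp only: divide_le_eq) simp
    then show ?thesis using T mult_right_mono[of "\<phi> n x" 1 T] by (simp add: \<phi>_def)
  qed
  have philim: "(\<lambda>n. \<phi> n x * T) \<longlonglongrightarrow> x * T" if "x \<in> {0<..1}" for x
    unfolding \<phi>_def using grid_point_tendsto[OF _ filterlim_Suc that]
    by (intro tendsto_mult tendsto_const) simp
  have lim: "(\<lambda>n. Fn n x) \<longlonglongrightarrow> ?i x * g (x * T)" for x
  proof (cases "x \<in> {0<..1}")
    case True
    then have "x * T \<in> {0..T}" using T by (simp add: mult_le_cancel_right1)
    then have "(\<lambda>n. g (\<phi> n x * T)) \<longlonglongrightarrow> g (x * T)"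
      using phi[OF True] by (intro continuous_on_tendsto_compose[OF g philim[OF True]]) auto
    then show ?thesis using True by (simp add: Fn_eq)
  qed (auto simp: Fn_eq)
  have meas: "Fn n \<in> borel_measurable lborel" for n unfolding Fn_def by measurable
  have "(\<lambda>n. \<integral>x. Fn n x \<partial>lborel) \<longlonglongrightarrow> (\<integral>x. ?i x * g (x * T) \<partial>lborel)"
  proof (rule integral_dominated_convergence[where w="\<lambda>x. c * ?i x"])
    show "(\<lambda>x. ?i x * g (x * T)) \<in> borel_measurable lborel" by (rule borel_measurable_LIMSEQ_real[OF lim meas])
    show "AE x in lborel. norm (Fn n x) \<le> c * ?i x" for n
      using c[OF phi] c0 by (intro AE_I2) (auto simp: Fn_eq indicator_def)
  qed (use lim meas in auto)
  also have "(\<integral>x. ?i x * g (x * T) \<partial>lborel) = (\<integral>x. ?i x * g (0 + T * x) \<partial>lborel)" by (simp add: mult.commute)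
  also have "\<dots> = (\<integral>x. indicat_real {0<..T} (0 + T * x) * g (0 + T * x) \<partial>lborel)"
    using T by (intro Bochner_Integration.integral_cong) (auto simp: indicator_def mult_le_cancel_left1 zero_less_mult_iff)
  also have "\<dots> = 1 / T * (\<integral>x. indicat_real {0<..T} x * g x \<partial>lborel)"
    using T lborel_integral_real_affine[of T "\<lambda>x. indicat_real {0<..T} x * g x" 0] by simp
  also have "(\<integral>x. indicat_real {0<..T} x * g x \<partial>lborel) = (LBINT t:{0..T}. g t)"
    unfolding set_lebesgue_integral_def
  proof (rule integral_cong_AE)
    have gm: "(\<lambda>x. indicat_real {0..T} x *\<^sub>R g x) \<in> borel_measurable lborel"
      using borel_integrable_atLeastAtMost'[OF g] by (auto simp: set_integrable_def)
    have "(\<lambda>x. indicat_real {0<..T} x * (indicat_real {0..T} x *\<^sub>R g x)) \<in> borel_measurable lborel"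
      using gm by measurable
    moreover have "(\<lambda>x. indicat_real {0<..T} x * (indicat_real {0..T} x *\<^sub>R g x)) = (\<lambda>x. indicat_real {0<..T} x * g x)"
      by (auto simp: indicator_def fun_eq_iff)
    ultimately show "(\<lambda>x. indicat_real {0<..T} x * g x) \<in> borel_measurable lborel" by simp
    show "(\<lambda>x. indicat_real {0..T} x *\<^sub>R g x) \<in> borel_measurable lborel" by (rule gm)
    show "AE x in lborel. indicat_real {0<..T} x * g x = indicat_real {0..T} x *\<^sub>R g x"
      using AE_lborel_singleton[of 0] by eventually_elim (auto simp: indicator_def)
  qed
  finally show ?thesis unfolding int .
qed

section \<open>The Volterra process near time zero\<close>

locale small_time_volterra = small_time_kernel K Kbar C Cs \<gamma> \<gamma>s \<gamma>bar + brownian_space M F B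
  for K Kbar :: "real \<Rightarrow> real" and C Cs \<gamma> \<gamma>s \<gamma>bar :: real
    and M :: "'a measure" and F :: "real \<Rightarrow> 'a measure" and B :: "real \<Rightarrow> 'a \<Rightarrow> real" +
  fixes b \<sigma> :: "real \<Rightarrow> real" and v :: "real \<Rightarrow> 'a \<Rightarrow> real" and v0 :: real
  assumes solution: "continuous_weak_solution K b \<sigma> v0 M F B v"
    and b_cont: "isCont b v0" and \<sigma>_cont: "isCont \<sigma> v0" and \<sigma>_pos: "0 < \<sigma> v0"
begin

lemma path_continuous: "\<omega> \<in> space M \<Longrightarrow> continuous_on {0..} (\<lambda>t. v t \<omega>)"
  using solution by (simp add: continuous_weak_solution_def)

lemma v_measurable: "0 \<le> t \<Longrightarrow> v t \<in> borel_measurable M"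
  using solution measurable_F_M[of t "v t"] by (simp add: continuous_weak_solution_def)

definition grid_mean :: "nat \<Rightarrow> nat \<Rightarrow> 'a \<Rightarrow> real" where
  "grid_mean n N \<omega> = (\<Sum>j=1..N. v (real j / real N / real n) \<omega>) / real N"

lemma grid_mean_measurable: "grid_mean n N \<in> borel_measurable M"
  unfolding grid_mean_def[abs_def] by (intro borel_measurable_divide borel_measurable_sum v_measurable) auto

lemma grid_mean_tendsto:
  assumes "1 \<le> n" "\<omega> \<in> space M"
  shows "(\<lambda>N. grid_mean n (Suc N) \<omega>) \<longlonglongrightarrow> time_average v (1 / real n) \<omega>"
proof -
  have "continuous_on {0..1 / real n} (\<lambda>t. v t \<omega>)"
    by (rule continuous_on_subset[OF path_continuous[OF assms(2)]]) auto
  from riemann_sums_tendsto_average[OF this] assms(1) show ?thesis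
    by (simp add: grid_mean_def time_average_def)
qed

lemma time_average_measurable:
  assumes "1 \<le> n"
  shows "time_average v (1 / real n) \<in> borel_measurable M"
  by (rule borel_measurable_LIMSEQ_real[OF grid_mean_tendsto[OF assms] grid_mean_measurable])

definition near_start :: "real \<Rightarrow> nat \<Rightarrow> 'a set" where
  "near_start \<rho> n = {\<omega> \<in> space M. \<forall>s\<in>{0..1 / real n}. \<bar>v s \<omega> - v0\<bar> \<le> \<rho>}"

text \<open>By continuity of the paths it suffices to test the condition at the countably many times \<open>j
  / N / n\<close>.\<close>

lemma near_start_measurable [measurable]:
  assumes n: "1 \<le> n"
  shows "near_start \<rho> n \<in> events"
proof -
  define P where "P N j \<omega> \<longleftrightarrow> \<bar>v (real j / real (Suc N) / real n) \<omega> - v0\<bar> \<le> \<rho>" for N j \<omega>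
  let ?G = "{\<omega> \<in> space M. \<forall>N. \<forall>j. j \<le> Suc N \<longrightarrow> P N j \<omega>}"
  have Pm: "{\<omega> \<in> space M. P N j \<omega>} \<in> events" for N j
    unfolding P_def
    by (intro borel_measurable_le borel_measurable_abs borel_measurable_diff v_measurable borel_measurable_const) simp
  have eq: "near_start \<rho> n = ?G"
  proof (intro set_eqI iffI)
    fix \<omega> assume w: "\<omega> \<in> near_start \<rho> n"
    have "real j / real (Suc N) / real n \<in> {0..1 / real n}" if "j \<le> Suc N" for j N
    proof -
      have "real j / real (Suc N) \<le> 1" using that by (simp add: divide_le_eq del: of_nat_Suc)
      then show ?thesis unfolding atLeastAtMost_iff by (intro conjI divide_right_mono) auto
    qed
    with w show "\<omega> \<in> ?G" unfolding near_start_def P_def by blast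
  next
    fix \<omega> assume w: "\<omega> \<in> ?G"
    have "\<bar>v s \<omega> - v0\<bar> \<le> \<rho>" if s: "s \<in> {0..1 / real n}" for s
    proof (cases "s = 0")
      case True
      \<comment> \<open>the grid points \<open>j = 0\<close> represent the time \<open>0\<close>\<close>
      have "P 0 0 \<omega>" using w by blast
      with True show ?thesis by (simp add: P_def)
    next
      case False
      define x where "x = real n * s"
      have x: "x \<in> {0<..1}" "x / real n = s" using False s n by (auto simp: x_def field_simps)
      define \<phi> where "\<phi> N = real (nat \<lceil>real (Suc N) * x\<rceil>) / real (Suc N)" for N
      have "\<phi> \<longlonglongrightarrow> x"
        unfolding \<phi>_def using grid_point_tendsto[OF _ filterlim_Suc x(1)] by simp
      then have "(\<lambda>N. \<phi> N / real n) \<longlonglongrightarrow> s" using tendsto_divide[OF _ tendsto_const, of \<phi> x sequentially "real n"] n x(2) by simp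
      then have lim: "(\<lambda>N. v (\<phi> N / real n) \<omega>) \<longlonglongrightarrow> v s \<omega>"
        using s w by (intro continuous_on_tendsto_compose[OF path_continuous]) (auto simp: \<phi>_def)
      have le: "\<bar>v (\<phi> N / real n) \<omega> - v0\<bar> \<le> \<rho>" for N
      proof -
        have "nat \<lceil>real (Suc N) * x\<rceil> \<le> Suc N" using sum_over_cells(1)[OF _ x(1), of "Suc N"] by simp
        then have "P N (nat \<lceil>real (Suc N) * x\<rceil>) \<omega>" using w by blast
        then show ?thesis unfolding \<phi>_def P_def .
      qed
      show ?thesis
        by (rule LIMSEQ_le_const2[OF tendsto_rabs[OF tendsto_diff[OF lim tendsto_const]]]) (use le in blast)
    qed
    then show "\<omega> \<in> near_start \<rho> n" using w by (simp add: near_start_def)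
  qed
  show ?thesis
    unfolding eq by (intro sets.sets_Collect_countable_All sets.sets_Collect_imp sets.sets_Collect_const Pm)
qed

text \<open>At \<open>t = 0\<close> the integrand of the stochastic integral has energy zero, so the integral
  vanishes by the tail bound.\<close>

lemma initial_value: "AE \<omega> in M. v 0 \<omega> = v0"
proof -
  obtain I where ito: "has_ito_integral M F B (\<lambda>s \<omega>. K (0 - s) * \<sigma> (v s \<omega>)) 0 I"
    and eq: "AE \<omega> in M. v 0 \<omega> = v0 + (LBINT s:{0..0}. K (0 - s) * b (v s \<omega>)) + I \<omega>"
    using solution unfolding continuous_weak_solution_def by blast
  note si = has_ito_integral_imp_stoch_integral[OF ito order_refl]
  have [measurable]: "I \<in> borel_measurable M" using si by (simp add: stoch_integral_def)
  have z: "energy (\<lambda>s. indicat_real {0..0} s * (K (0 - s) * \<sigma> (v s \<omega>))) = 0" for \<omega>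
  proof -
    have "energy (\<lambda>s. indicat_real {0..0} s * (K (0 - s) * \<sigma> (v s \<omega>))) = nn_integral lborel (\<lambda>s::real. 0)"
    proof (rule nn_integral_cong_AE)
      show "AE s in lborel. ennreal ((indicat_real {0..0} s * (K (0 - s) * \<sigma> (v s \<omega>)))\<^sup>2) = 0"
        using AE_lborel_singleton[of 0] by eventually_elim simp
    qed
    then show ?thesis by simp
  qed
  have p0: "\<P>(\<omega> in M. \<bar>I \<omega>\<bar> > \<epsilon>) = 0" if e: "0 < \<epsilon>" for \<epsilon>
  proof (rule antisym[OF _ measure_nonneg], rule field_le_epsilon)
    fix \<eta> :: real assume "0 < \<eta>"
    then have "\<P>(\<omega> in M. \<bar>I \<omega>\<bar> > \<epsilon>) \<le> 16 * (\<epsilon>\<^sup>2 * \<eta> / 16) / \<epsilon>\<^sup>2"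
      using stoch_integral_tail_bound[OF si e, of "\<epsilon>\<^sup>2 * \<eta> / 16"] e unfolding z by simp
    then show "\<P>(\<omega> in M. \<bar>I \<omega>\<bar> > \<epsilon>) \<le> 0 + \<eta>" using e by simp
  qed
  have "AE \<omega> in M. \<forall>k. \<not> \<bar>I \<omega>\<bar> > 1 / real (Suc k)"
    unfolding AE_all_countable
  proof
    fix k
    have "{\<omega> \<in> space M. \<bar>I \<omega>\<bar> > 1 / real (Suc k)} \<in> null_sets M"
      using p0[of "1 / real (Suc k)"] by (simp add: null_sets_def emeasure_eq_measure del: of_nat_Suc)
    then show "AE \<omega> in M. \<not> \<bar>I \<omega>\<bar> > 1 / real (Suc k)"
      by (rule AE_not_in[THEN AE_mp]) auto
  qed
  with eq show ?thesis
  proof eventually_elim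
    case (elim \<omega>)
    have "I \<omega> = 0"
    proof (rule ccontr)
      assume "I \<omega> \<noteq> 0"
      then obtain k where "1 / real (Suc k) < \<bar>I \<omega>\<bar>" using nat_approx_posE[of "\<bar>I \<omega>\<bar>"] by auto
      with elim(2) show False by blast
    qed
    moreover have "(LBINT s:{0..0}. K (0 - s) * b (v s \<omega>)) = 0"
      unfolding set_lebesgue_integral_def
      by (rule integral_eq_zero_AE) (use AE_lborel_singleton[of 0] in eventually_elim, simp)
    ultimately show ?case using elim(1) by simp
  qed
qed

lemma prob_near_start_tendsto:
  assumes "0 < \<rho>"
  shows "(\<lambda>n. prob (near_start \<rho> n)) \<longlonglongrightarrow> 1"
proof -
  let ?A = "\<lambda>k. near_start \<rho> (Suc k)"
  have inc: "incseq ?A"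
  proof (rule incseq_SucI, rule subsetI)
    fix k \<omega> assume "\<omega> \<in> ?A k"
    moreover have "1 / real (Suc (Suc k)) \<le> 1 / real (Suc k)" by (intro divide_left_mono) auto
    ultimately show "\<omega> \<in> ?A (Suc k)" unfolding near_start_def by force
  qed
  have lim: "(\<lambda>k. prob (?A k)) \<longlonglongrightarrow> prob (\<Union>k. ?A k)"
    by (rule finite_Lim_measure_incseq[OF _ inc]) (use near_start_measurable in auto)
  have "AE \<omega> in M. \<omega> \<in> (\<Union>k. ?A k)"
    using initial_value AE_space
  proof eventually_elim
    case (elim \<omega>)
    have "\<forall>s\<in>{0..}. \<forall>e>0. \<exists>d>0. \<forall>s'\<in>{0..}. dist s' s < d \<longrightarrow> dist (v s' \<omega>) (v s \<omega>) < e"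
      using path_continuous[OF elim(2)] unfolding continuous_on_iff .
    from bspec[OF this, of 0] assms obtain e where "0 < e" "\<And>s. s \<in> {0..} \<Longrightarrow> dist s 0 < e \<Longrightarrow> dist (v s \<omega>) (v 0 \<omega>) < \<rho>"
      by auto
    then obtain d where d: "0 < d" "\<And>s. 0 \<le> s \<Longrightarrow> s < d \<Longrightarrow> \<bar>v s \<omega> - v0\<bar> < \<rho>"
      using elim(1) that[of e] by (simp add: dist_real_def)
    obtain k where "1 / real (Suc k) < d" using nat_approx_posE[OF d(1)] .
    then have "\<omega> \<in> ?A k" unfolding near_start_def using elim(2) d(2) by (auto intro!: less_imp_le)
    then show ?case by blast
  qed
  then have "prob (\<Union>k. ?A k) = 1"
    using near_start_measurable by (intro prob_eq_1[THEN iffD2]) auto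
  with lim have "(\<lambda>k. prob (?A k)) \<longlonglongrightarrow> 1" by simp
  then show ?thesis by (rule LIMSEQ_imp_Suc)
qed

text \<open>Averaging the Volterra equation over the grid collects the stochastic convolutions in the integral
  of one process.\<close>

lemma grid_mean_equation:
  assumes "1 \<le> n" "1 \<le> N"
  obtains J where "stoch_integral (\<lambda>s \<omega>. averaged_kern n N s * \<sigma> (v s \<omega>)) J"
    "AE \<omega> in M. grid_mean n N \<omega> = v0 + (\<Sum>j=1..N. 1 / real N *
        (LBINT s:{0..real j / real N / real n}. K (real j / real N / real n - s) * b (v s \<omega>))) + J \<omega>"
proof -
  have "\<forall>t\<in>{0..}. \<exists>I. has_ito_integral M F B (\<lambda>s \<omega>. K (t - s) * \<sigma> (v s \<omega>)) t I \<and>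
        (AE \<omega> in M. v t \<omega> = v0 + (LBINT s:{0..t}. K (t - s) * b (v s \<omega>)) + I \<omega>)"
    using solution unfolding continuous_weak_solution_def by simp
  from bchoice[OF this] obtain I where "\<forall>t\<in>{0..}. has_ito_integral M F B (\<lambda>s \<omega>. K (t - s) * \<sigma> (v s \<omega>)) t (I t) \<and>
        (AE \<omega> in M. v t \<omega> = v0 + (LBINT s:{0..t}. K (t - s) * b (v s \<omega>)) + I t \<omega>)" by blast
  then have I: "\<And>t. 0 \<le> t \<Longrightarrow> has_ito_integral M F B (\<lambda>s \<omega>. K (t - s) * \<sigma> (v s \<omega>)) t (I t)"
    "\<And>t. 0 \<le> t \<Longrightarrow> AE \<omega> in M. v t \<omega> = v0 + (LBINT s:{0..t}. K (t - s) * b (v s \<omega>)) + I t \<omega>"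
    by simp_all
  define t where "t j = real j / real N / real n" for j
  have t: "0 \<le> t j" for j by (simp add: t_def)
  define J where "J \<omega> = (\<Sum>j=1..N. 1 / real N * I (t j) \<omega>)" for \<omega>
  have "stoch_integral (\<lambda>s \<omega>. kern K (t j) s * \<sigma> (v s \<omega>)) (I (t j))" for j
    using has_ito_integral_imp_stoch_integral[OF I(1)[OF t] t, of j] by (simp add: kern_def mult.assoc)
  then have "stoch_integral (\<lambda>s \<omega>. \<Sum>j=1..N. 1 / real N * (kern K (t j) s * \<sigma> (v s \<omega>))) J"
    unfolding J_def[abs_def] by (intro stoch_integral_sum stoch_integral_scale) auto
  also have "(\<lambda>s \<omega>. \<Sum>j=1..N. 1 / real N * (kern K (t j) s * \<sigma> (v s \<omega>))) = (\<lambda>s \<omega>. averaged_kern n N s * \<sigma> (v s \<omega>))"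
    by (simp add: averaged_kern_def t_def sum_distrib_right fun_eq_iff)
  finally have J: "stoch_integral (\<lambda>s \<omega>. averaged_kern n N s * \<sigma> (v s \<omega>)) J" .
  have "AE \<omega> in M. \<forall>j\<in>{1..N}. v (t j) \<omega> = v0 + (LBINT s:{0..t j}. K (t j - s) * b (v s \<omega>)) + I (t j) \<omega>"
    by (rule AE_finite_allI) (auto intro: I(2)[OF t])
  then have "AE \<omega> in M. grid_mean n N \<omega> = v0 + (\<Sum>j=1..N. 1 / real N * (LBINT s:{0..t j}. K (t j - s) * b (v s \<omega>))) + J \<omega>"
  proof eventually_elim
    case (elim \<omega>)
    have "grid_mean n N \<omega> = (\<Sum>j=1..N. v (t j) \<omega>) / real N" by (simp add: grid_mean_def t_def)
    also have "(\<Sum>j=1..N. v (t j) \<omega>) = (\<Sum>j=1..N. v0 + (LBINT s:{0..t j}. K (t j - s) * b (v s \<omega>)) + I (t j) \<omega>)"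
      using elim by (intro sum.cong) auto
    finally show ?case
      using assms(2) by (simp add: J_def sum.distrib add_divide_distrib sum_divide_distrib)
  qed
  with J that show ?thesis by (simp add: t_def)
qed

text \<open>By Cauchy-Schwarz the drift is at most \<open>c\<close> times \<open>sqrt t\<close> times the
  \<open>L\<^sup>2\<close> norm of the kernel, and the normalised norm is at most \<open>1\<close>.\<close>

lemma scaled_drift_le:
  assumes n: "1 \<le> n" and t: "t \<in> {0..1 / real n}" and c: "0 \<le> c" "\<And>s. s \<in> {0..1 / real n} \<Longrightarrow> \<bar>b (v s \<omega>)\<bar> \<le> c"
  shows "sqrt (lam K n) * \<bar>LBINT s:{0..t}. K (t - s) * b (v s \<omega>)\<bar> \<le> c * sqrt (1 / real n)"
proof -
  let ?i = "indicat_real {0..t}"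
  let ?e = "\<integral>u. (kern K t u)\<^sup>2 \<partial>lborel"
  have L: "0 < lam K n" by (rule lam_pos[OF n])
  have ksq: "sq_integrable lborel (\<lambda>s. \<bar>kern K t s\<bar>)"
    using kern_sq_integrable[OF K, of t] by (auto simp: sq_integrable_def)
  have i2: "(\<lambda>s. (?i s)\<^sup>2) = ?i" by (auto simp: indicator_def fun_eq_iff)
  have isq: "sq_integrable lborel ?i"
    unfolding sq_integrable_def i2 using t by (auto intro!: integrable_real_indicator)
  have "\<bar>LBINT s:{0..t}. K (t - s) * b (v s \<omega>)\<bar> \<le> (\<integral>s. \<bar>?i s *\<^sub>R (K (t - s) * b (v s \<omega>))\<bar> \<partial>lborel)"
    unfolding set_lebesgue_integral_def by (rule integral_abs_bound)
  also have "\<dots> \<le> (\<integral>s. c * (?i s * \<bar>kern K t s\<bar>) \<partial>lborel)"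
  proof (rule integral_mono')
    show "integrable lborel (\<lambda>s. c * (?i s * \<bar>kern K t s\<bar>))"
      using sq_integrable_mult[OF isq ksq] by simp
    fix s :: real
    show "0 \<le> c * (?i s * \<bar>kern K t s\<bar>)" using c(1) by simp
    show "\<bar>?i s *\<^sub>R (K (t - s) * b (v s \<omega>))\<bar> \<le> c * (?i s * \<bar>kern K t s\<bar>)"
    proof (cases "s \<in> {0..t}")
      case True
      then have "\<bar>b (v s \<omega>)\<bar> \<le> c" using t by (intro c(2)) auto
      then have "\<bar>K (t - s)\<bar> * \<bar>b (v s \<omega>)\<bar> \<le> \<bar>K (t - s)\<bar> * c" by (intro mult_left_mono) auto
      then show ?thesis using True by (simp add: kern_def abs_mult mult.commute)
    qed simp
  qed
  also have "\<dots> = c * (\<integral>s. ?i s * \<bar>kern K t s\<bar> \<partial>lborel)" by simp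
  also have "\<dots> \<le> c * (sqrt (\<integral>s. (?i s)\<^sup>2 \<partial>lborel) * sqrt ?e)"
  proof (rule mult_left_mono[OF _ c(1)])
    show "(\<integral>s. ?i s * \<bar>kern K t s\<bar> \<partial>lborel) \<le> sqrt (\<integral>s. (?i s)\<^sup>2 \<partial>lborel) * sqrt ?e"
      using integral_mult_le_L2[OF isq ksq] by simp
  qed
  also have "(\<integral>s. (?i s)\<^sup>2 \<partial>lborel) = t" unfolding i2 using t by simp
  finally have "sqrt (lam K n) * \<bar>LBINT s:{0..t}. K (t - s) * b (v s \<omega>)\<bar> \<le> sqrt (lam K n) * (c * (sqrt t * sqrt ?e))"
    using L by (intro mult_left_mono) auto
  also have "\<dots> = c * (sqrt t * sqrt (lam K n * ?e))" by (simp add: real_sqrt_mult)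
  also have "\<dots> \<le> c * (sqrt (1 / real n) * 1)"
  proof (intro mult_left_mono[OF _ c(1)] mult_mono)
    have "real n * t \<in> {0..1}" using t n by (auto simp: field_simps)
    from scaled_kern_energy_le[OF n this] show "sqrt (lam K n * ?e) \<le> 1" using n by simp
    show "0 \<le> sqrt (lam K n * ?e)" using L by (simp add: integral_nonneg_AE)
  qed (use t in auto)
  finally show ?thesis by simp
qed

end

section \<open>Gaussian coupling and digital prices\<close>

context small_time_volterra begin

lemma averaged_kern_outside:
  assumes "s \<notin> {0..1 / real n}"
  shows "averaged_kern n N s = 0"
  unfolding averaged_kern_def
proof (rule sum.neutral, rule ballI)
  fix j assume "j \<in> {1..N}"
  then have "real j / real N \<le> 1" by simp
  then have "real j / real N / real n \<le> 1 / real n" by (rule divide_right_mono) simp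
  then have "s \<notin> {0..real j / real N / real n}" using assms by auto
  then show "1 / real N * kern K (real j / real N / real n) s = 0" by (simp add: kern_def)
qed

text \<open>Let \<open>U\<close> be the step function obtained from an approximation of the integrand
  \<open>H\<close> along one path \<open>\<omega>0\<close> that stays near \<open>v0\<close>, and
  \<open>X\<close> its integral. The function \<open>U\<close> is close to \<open>H\<close> along
  \<open>\<omega>0\<close>, which is close to \<open>\<sigma> v0 * k\<close>: this determines the variance of
  \<open>X\<close>. Along every other path near \<open>v0\<close> the integrand is close to the one along
  \<open>\<omega>0\<close>, so that the tail bound applies to \<open>J - X\<close>.\<close>

lemma gaussian_coupling:
  assumes n: "1 \<le> n" and \<eta>: "0 < \<eta>" and \<rho>: "\<And>x. \<bar>x - v0\<bar> \<le> \<rho> \<Longrightarrow> \<bar>\<sigma> x - \<sigma> v0\<bar> \<le> \<eta>"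
    and pos: "0 < prob (near_start \<rho> n)"
    and J: "stoch_integral (\<lambda>s \<omega>. averaged_kern n N s * \<sigma> (v s \<omega>)) J"
  obtains X V where "X \<in> borel_measurable M"
    "0 < V \<Longrightarrow> distributed M lborel X (normal_density 0 (sqrt V))" "0 \<le> V"
    "\<bar>sqrt (lam K n * V) - \<sigma> v0 * sqrt (lam K n * (\<integral>u. (averaged_kern n N u)\<^sup>2 \<partial>lborel))\<bar> \<le> 2 * \<eta>"
    "\<And>\<delta>. 0 < \<delta> \<Longrightarrow> \<P>(\<omega> in M. \<bar>J \<omega> - X \<omega>\<bar> > \<delta> / sqrt (lam K n))
        \<le> 1 - prob (near_start \<rho> n) + 160 * \<eta>\<^sup>2 / \<delta>\<^sup>2"
proof -
  define k where "k = averaged_kern n N"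
  define e where "e = (\<integral>u. (k u)\<^sup>2 \<partial>lborel)"
  define L where "L = lam K n"
  have L: "0 < L" "L * e \<le> 1" using lam_pos[OF n] scaled_averaged_kern_energy_le[OF n] by (auto simp: L_def e_def k_def)
  then have eL: "e \<le> 1 / L" by (simp add: field_simps)
  have ksq: "sq_integrable lborel k" unfolding k_def by (rule averaged_kern_sq_integrable)
  define H where "H s \<omega> = k s * \<sigma> (v s \<omega>)" for s \<omega>
  have siH: "stoch_integral H J" using J unfolding H_def[abs_def] k_def .
  have Hm: "jointly_measurable H" using siH by (simp add: stoch_integral_def)
  have near: "\<bar>H s \<omega> - \<sigma> v0 * k s\<bar> \<le> \<eta> * \<bar>k s\<bar>" if w: "\<omega> \<in> near_start \<rho> n" for s \<omega>
  proof (cases "s \<in> {0..1 / real n}")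
    case True
    then have "\<bar>\<sigma> (v s \<omega>) - \<sigma> v0\<bar> \<le> \<eta>" using w by (intro \<rho>) (auto simp: near_start_def)
    then have "\<bar>k s\<bar> * \<bar>\<sigma> (v s \<omega>) - \<sigma> v0\<bar> \<le> \<bar>k s\<bar> * \<eta>" by (intro mult_left_mono) auto
    moreover have "H s \<omega> - \<sigma> v0 * k s = k s * (\<sigma> (v s \<omega>) - \<sigma> v0)" by (simp add: H_def algebra_simps)
    ultimately show ?thesis by (simp add: abs_mult mult.commute)
  next
    case False
    then show ?thesis by (simp add: H_def k_def averaged_kern_outside)
  qed
  obtain \<omega>0 m \<tau> x where w0: "\<omega>0 \<in> near_start \<rho> n" and grid: "0 \<le> \<tau> 0" "\<forall>i<m. \<tau> i \<le> \<tau> (Suc i)"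
    and frozen: "energy (\<lambda>s. simple_process m \<tau> (\<lambda>i _. x i) s \<omega>0 - H s \<omega>0) \<le> ennreal (\<eta>\<^sup>2 / L)"
    using stoch_integral_frozen_path[OF siH near_start_measurable[OF n] pos, of "\<eta>\<^sup>2 / L"] \<eta> L by auto
  have w0s: "\<omega>0 \<in> space M" using w0 by (simp add: near_start_def)
  define U where "U s = simple_process m \<tau> (\<lambda>i _. x i) s \<omega>0" for s
  have U: "simple_process m \<tau> (\<lambda>i _. x i) s \<omega> = U s" for s and \<omega> :: 'a by (simp add: U_def simple_process_def)
  define X where "X \<omega> = step_sum m \<tau> x (\<lambda>t. B t \<omega>)" for \<omega>
  define V where "V = (\<Sum>i<m. (x i)\<^sup>2 * (\<tau> (Suc i) - \<tau> i))"
  have dat: "simple_process_data M F m \<tau> (\<lambda>i _. x i)" using grid by (auto simp: simple_process_data_def)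
  have Xm: "X \<in> borel_measurable M" unfolding X_def[abs_def] by (rule step_sum_measurable[OF dat])
  have siU: "stoch_integral (\<lambda>s \<omega>. U s) X"
    using stoch_integral_simple[OF dat] unfolding X_def[abs_def] by (simp add: U[abs_def, symmetric])
  have V0: "0 \<le> V" unfolding V_def using grid by (intro sum_nonneg) auto
  have dist: "distributed M lborel X (normal_density 0 (sqrt V))" if "0 < V"
    using step_sum_normal[of \<tau> m x] grid that unfolding V_def X_def[abs_def] by auto
  have nnU: "energy U = ennreal V"
    using nn_integral_simple_process_square[OF dat, of \<omega>0] by (simp add: U V_def)
  have Um: "U \<in> borel_measurable borel"
    using section_measurable[OF simple_process_measurable[OF dat] w0s] by (simp add: U)
  have Usq: "sq_integrable lborel U"
    unfolding sq_integrable_def using Um nnU by (auto intro!: integrableI_nn_integral_finite[where x=V] V0)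
  have intU: "(\<integral>s. (U s)\<^sup>2 \<partial>lborel) = V"
    using nnU Um V0 by (intro integral_eq_nn_integral[THEN trans]) auto
  have km: "k \<in> borel_measurable borel" using ksq by (simp add: sq_integrable_def)
  have Hs: "(\<lambda>s. H s \<omega>) \<in> borel_measurable borel" if "\<omega> \<in> space M" for \<omega>
    by (rule section_measurable[OF Hm that])
  note [measurable] = Um km Hs[OF w0s]

  have close: "energy (\<lambda>s. U s - \<sigma> v0 * k s) \<le> ennreal (4 * \<eta>\<^sup>2 / L)"
  proof -
    have "energy (\<lambda>s. H s \<omega>0 - \<sigma> v0 * k s) \<le> ennreal (\<eta>\<^sup>2 * e)"
      unfolding e_def using near[OF w0] \<eta> by (intro nn_integral_square_le[OF ksq]) auto
    also have "\<dots> \<le> ennreal (\<eta>\<^sup>2 / L)" using mult_left_mono[OF eL, of "\<eta>\<^sup>2"] by (intro ennreal_leI) auto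
    finally have "energy (\<lambda>s. (U s - H s \<omega>0) + (H s \<omega>0 - \<sigma> v0 * k s)) \<le> ennreal (2 * (\<eta>\<^sup>2 / L) + 2 * (\<eta>\<^sup>2 / L))"
      using frozen[unfolded U] L by (intro energy_add_le) auto
    then show ?thesis by simp
  qed
  have sk: "sq_integrable lborel (\<lambda>s. \<sigma> v0 * k s)" by (rule sq_integrable_cmult[OF ksq])
  have "sqrt L * \<bar>sqrt V - sqrt (\<integral>s. (\<sigma> v0 * k s)\<^sup>2 \<partial>lborel)\<bar> \<le> sqrt L * sqrt (\<integral>s. (U s - \<sigma> v0 * k s)\<^sup>2 \<partial>lborel)"
    using L2_norm_diff_le[OF Usq sk] L intU by (intro mult_left_mono) auto
  also have "\<dots> \<le> sqrt L * sqrt (4 * \<eta>\<^sup>2 / L)"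
  proof (intro mult_left_mono real_sqrt_le_mono)
    have "ennreal (\<integral>s. (U s - \<sigma> v0 * k s)\<^sup>2 \<partial>lborel) = energy (\<lambda>s. U s - \<sigma> v0 * k s)"
      using sq_integrable_diff[OF Usq sk] by (intro nn_integral_eq_integral[symmetric]) (auto simp: sq_integrable_def)
    with close have "ennreal (\<integral>s. (U s - \<sigma> v0 * k s)\<^sup>2 \<partial>lborel) \<le> ennreal (4 * \<eta>\<^sup>2 / L)" by simp
    then show "(\<integral>s. (U s - \<sigma> v0 * k s)\<^sup>2 \<partial>lborel) \<le> 4 * \<eta>\<^sup>2 / L" using L by (subst (asm) ennreal_le_iff) auto
  qed (use L in auto)
  also have "\<dots> = 2 * \<eta>" using L \<eta> by (simp add: real_sqrt_mult[symmetric] real_sqrt_mult)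
  finally have "\<bar>sqrt L * sqrt V - sqrt L * sqrt (\<integral>s. (\<sigma> v0 * k s)\<^sup>2 \<partial>lborel)\<bar> \<le> 2 * \<eta>"
    using L by (simp add: right_diff_distrib[symmetric] abs_mult)
  moreover have "sqrt (\<integral>s. (\<sigma> v0 * k s)\<^sup>2 \<partial>lborel) = \<sigma> v0 * sqrt e"
    using \<sigma>_pos by (simp add: power_mult_distrib e_def real_sqrt_mult)
  ultimately have var: "\<bar>sqrt (L * V) - \<sigma> v0 * sqrt (L * e)\<bar> \<le> 2 * \<eta>"
    by (simp add: real_sqrt_mult ac_simps)

  have tail: "\<P>(\<omega> in M. \<bar>J \<omega> - X \<omega>\<bar> > \<delta> / sqrt L) \<le> 1 - prob (near_start \<rho> n) + 160 * \<eta>\<^sup>2 / \<delta>\<^sup>2"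
    if d: "0 < \<delta>" for \<delta>
  proof -
    let ?D = "{\<omega>\<in>space M. energy (\<lambda>s. H s \<omega> + (-1) * U s) > ennreal (10 * \<eta>\<^sup>2 / L)}"
    have si: "stoch_integral (\<lambda>s \<omega>. H s \<omega> + (-1) * U s) (\<lambda>\<omega>. J \<omega> + (-1) * X \<omega>)"
      by (rule stoch_integral_add[OF siH stoch_integral_scale[OF siU]])
    have sub: "?D \<subseteq> space M - near_start \<rho> n"
    proof (rule subsetI, rule ccontr)
      fix \<omega> assume D: "\<omega> \<in> ?D" and "\<omega> \<notin> space M - near_start \<rho> n"
      then have w: "\<omega> \<in> near_start \<rho> n" "\<omega> \<in> space M" by auto
      note [measurable] = Hs[OF w(2)]
      have "\<bar>H s \<omega> - H s \<omega>0\<bar> \<le> 2 * \<eta> * \<bar>k s\<bar>" for s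
        using near[OF w(1), of s] near[OF w0, of s] by linarith
      then have "energy (\<lambda>s. H s \<omega> - H s \<omega>0) \<le> ennreal ((2 * \<eta>)\<^sup>2 * e)"
        unfolding e_def using \<eta> by (intro nn_integral_square_le[OF ksq]) auto
      also have "\<dots> \<le> ennreal (4 * \<eta>\<^sup>2 / L)"
        using mult_left_mono[OF eL, of "(2 * \<eta>)\<^sup>2"] by (intro ennreal_leI) (auto simp: power_mult_distrib)
      finally have "energy (\<lambda>s. (H s \<omega> - H s \<omega>0) + (H s \<omega>0 - U s)) \<le> ennreal (2 * (4 * \<eta>\<^sup>2 / L) + 2 * (\<eta>\<^sup>2 / L))"
        using frozen[unfolded U] L by (intro energy_add_le) (auto simp: power2_commute)
      also have "2 * (4 * \<eta>\<^sup>2 / L) + 2 * (\<eta>\<^sup>2 / L) = 10 * \<eta>\<^sup>2 / L" by (simp add: field_simps)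
      finally have "energy (\<lambda>s. H s \<omega> + (-1) * U s) \<le> ennreal (10 * \<eta>\<^sup>2 / L)" by simp
      then show False using D leD by blast
    qed
    have "prob ?D \<le> prob (space M - near_start \<rho> n)"
      using sub near_start_measurable[OF n] by (intro finite_measure_mono) auto
    also have "\<dots> = 1 - prob (near_start \<rho> n)" using near_start_measurable[OF n] by (rule prob_compl)
    finally have D: "prob ?D \<le> 1 - prob (near_start \<rho> n)" .
    have "0 < \<delta> / sqrt L" "0 < 10 * \<eta>\<^sup>2 / L" using d \<eta> L by auto
    from stoch_integral_tail_bound[OF si this]
    have "\<P>(\<omega> in M. \<bar>J \<omega> - X \<omega>\<bar> > \<delta> / sqrt L) \<le> prob ?D + 16 * (10 * \<eta>\<^sup>2 / L) / (\<delta> / sqrt L)\<^sup>2"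
      by simp
    moreover have "16 * (10 * \<eta>\<^sup>2 / L) / (\<delta> / sqrt L)\<^sup>2 = 160 * \<eta>\<^sup>2 / \<delta>\<^sup>2"
      using L d by (simp add: power_divide)
    ultimately show ?thesis using D by linarith
  qed
  show thesis
    by (rule that[of X V]) (use Xm dist V0 var tail in \<open>simp_all add: L_def e_def k_def\<close>)
qed

definition limit_deviation :: real where
  "limit_deviation = \<sigma> v0 * sqrt limit_variance"

lemma limit_deviation_pos: "0 < limit_deviation"
  using \<sigma>_pos limit_variance_pos by (simp add: limit_deviation_def)

definition scaled_deviation :: "nat \<Rightarrow> 'a \<Rightarrow> real" where
  "scaled_deviation n \<omega> = sqrt (lam K n) * (time_average v (1 / real n) \<omega> - v0)"

lemma scaled_deviation_measurable: "1 \<le> n \<Longrightarrow> scaled_deviation n \<in> borel_measurable M"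
  unfolding scaled_deviation_def[abs_def] using time_average_measurable[of n] by simp

lemma grid_mean_close:
  assumes \<epsilon>: "0 < \<epsilon>" and \<delta>: "0 < \<delta>"
  shows "\<exists>N\<ge>1. n \<le> N \<and> (1 \<le> n \<longrightarrow>
    \<P>(\<omega> in M. \<bar>sqrt (lam K n) * (grid_mean n N \<omega> - time_average v (1 / real n) \<omega>)\<bar> > \<epsilon>) \<le> \<delta>)"
proof (cases "1 \<le> n")
  case True
  note [measurable] = grid_mean_measurable time_average_measurable[OF True]
  have "(\<lambda>k. \<P>(\<omega> in M. \<bar>sqrt (lam K n) * (grid_mean n (Suc k) \<omega> - time_average v (1 / real n) \<omega>)\<bar> > \<epsilon>)) \<longlonglongrightarrow> 0"
  proof (rule prob_tendsto_0_of_pointwise[OF _ _ \<epsilon>])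
    fix \<omega> assume "\<omega> \<in> space M"
    from LIM_zero[OF grid_mean_tendsto[OF True this]]
    show "(\<lambda>k. sqrt (lam K n) * (grid_mean n (Suc k) \<omega> - time_average v (1 / real n) \<omega>)) \<longlonglongrightarrow> 0"
      by (rule tendsto_mult_right_zero)
  qed measurable
  from order_tendstoD(2)[OF this \<delta>] obtain k0 where k0: "\<And>k. k0 \<le> k \<Longrightarrow>
      \<P>(\<omega> in M. \<bar>sqrt (lam K n) * (grid_mean n (Suc k) \<omega> - time_average v (1 / real n) \<omega>)\<bar> > \<epsilon>) < \<delta>"
    by (auto simp: eventually_sequentially)
  show ?thesis
    \<comment> \<open>the number of grid points is also required to be at least \<open>n\<close>, so that it tends to infinity\<close>
    using k0[of "max k0 n"] by (intro exI[of _ "Suc (max k0 n)"]) (auto intro: less_imp_le)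
qed (auto intro!: exI[of _ 1])

text \<open>The normalised deviation of the average differs from the normal variable of the coupling by the
  error of the Riemann sum, the drift and the coupling error; each of them is at most \<open>\<epsilon> /
  3\<close> outside an event of small probability.\<close>

lemma normal_approximation:
  assumes \<epsilon>: "0 < \<epsilon>" "\<epsilon> < limit_deviation"
  shows "eventually (\<lambda>n. \<exists>X s. 0 < s \<and> \<bar>s - limit_deviation\<bar> < \<epsilon> \<and>
       distributed M lborel X (normal_density 0 s) \<and>
       \<P>(\<omega> in M. \<bar>scaled_deviation n \<omega> - X \<omega>\<bar> > \<epsilon>) \<le> \<epsilon>) sequentially"
proof -
  \<comment> \<open>the second bound makes the term \<open>160 * \<eta>\<^sup>2 / (\<epsilon> / 3)\<^sup>2\<close> of the coupling at most \<open>\<epsilon> / 8\<close>, as \<open>11520 = 160 * 9 * 8\<close>\<close>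
  define \<eta> where "\<eta> = min (\<epsilon> / 8) (sqrt (\<epsilon> ^ 3 / 11520))"
  have \<eta>: "0 < \<eta>" "\<eta> \<le> \<epsilon> / 8" using \<epsilon> by (auto simp: \<eta>_def)
  have \<eta>2: "160 * \<eta>\<^sup>2 / (\<epsilon> / 3)\<^sup>2 \<le> \<epsilon> / 8"
  proof -
    have "\<eta>\<^sup>2 \<le> (sqrt (\<epsilon> ^ 3 / 11520))\<^sup>2" using \<eta> by (intro power_mono) (auto simp: \<eta>_def)
    then have "\<eta>\<^sup>2 \<le> \<epsilon> ^ 3 / 11520" using \<epsilon> by simp
    then have "160 * \<eta>\<^sup>2 * 72 \<le> \<epsilon> * \<epsilon>\<^sup>2" by (simp add: power3_eq_cube power2_eq_square)
    then show ?thesis using \<epsilon> by (simp add: power_divide field_simps)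
  qed
  obtain \<rho>1 where \<rho>1: "0 < \<rho>1" "\<And>x. \<bar>x - v0\<bar> < \<rho>1 \<Longrightarrow> \<bar>\<sigma> x - \<sigma> v0\<bar> < \<eta>"
    using \<sigma>_cont \<eta>(1) unfolding continuous_at_eps_delta dist_real_def by metis
  obtain \<rho>2 where \<rho>2: "0 < \<rho>2" "\<And>x. \<bar>x - v0\<bar> < \<rho>2 \<Longrightarrow> \<bar>b x - b v0\<bar> < 1"
    using b_cont zero_less_one unfolding continuous_at_eps_delta dist_real_def by metis
  define \<rho> where "\<rho> = min \<rho>1 \<rho>2 / 2"
  have \<rho>: "0 < \<rho>" "\<And>x. \<bar>x - v0\<bar> \<le> \<rho> \<Longrightarrow> \<bar>\<sigma> x - \<sigma> v0\<bar> \<le> \<eta>" "\<And>x. \<bar>x - v0\<bar> \<le> \<rho> \<Longrightarrow> \<bar>b x\<bar> \<le> \<bar>b v0\<bar> + 1"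
  proof -
    show "0 < \<rho>" using \<rho>1(1) \<rho>2(1) by (simp add: \<rho>_def)
    fix x assume "\<bar>x - v0\<bar> \<le> \<rho>"
    then have "\<bar>x - v0\<bar> < \<rho>1" "\<bar>x - v0\<bar> < \<rho>2" using \<rho>1(1) \<rho>2(1) by (auto simp: \<rho>_def min_def split: if_splits)
    from \<rho>1(2)[OF this(1)] \<rho>2(2)[OF this(2)] show "\<bar>\<sigma> x - \<sigma> v0\<bar> \<le> \<eta>" "\<bar>b x\<bar> \<le> \<bar>b v0\<bar> + 1" by linarith+
  qed
  have e3: "0 < \<epsilon> / 3" "0 < \<epsilon> / 8" using \<epsilon> by auto
  have "\<forall>n. \<exists>N\<ge>1. n \<le> N \<and> (1 \<le> n \<longrightarrow>
    \<P>(\<omega> in M. \<bar>sqrt (lam K n) * (grid_mean n N \<omega> - time_average v (1 / real n) \<omega>)\<bar> > \<epsilon> / 3) \<le> \<epsilon> / 8)"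
    using grid_mean_close[OF e3] by blast
  from choice[OF this] obtain N where N: "\<And>n. 1 \<le> N n" "\<And>n. n \<le> N n" "\<And>n. 1 \<le> n \<Longrightarrow>
    \<P>(\<omega> in M. \<bar>sqrt (lam K n) * (grid_mean n (N n) \<omega> - time_average v (1 / real n) \<omega>)\<bar> > \<epsilon> / 3) \<le> \<epsilon> / 8"
    by blast
  have Nlim: "filterlim N at_top sequentially"
    by (rule filterlim_at_top_mono[OF filterlim_ident]) (simp add: N(2))
  let ?w = "\<lambda>n. \<sigma> v0 * sqrt (lam K n * (\<integral>u. (averaged_kern n (N n) u)\<^sup>2 \<partial>lborel))"
  have "?w \<longlonglongrightarrow> limit_deviation"
    unfolding limit_deviation_def
    by (intro tendsto_mult tendsto_const tendsto_real_sqrt averaged_kern_energy_limit N(1) Nlim)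
  then have ev1: "eventually (\<lambda>n. \<bar>?w n - limit_deviation\<bar> < \<epsilon> / 2) sequentially"
    using \<epsilon> by (auto dest!: tendstoD[of _ _ _ "\<epsilon> / 2"] simp: dist_real_def)
  have ev2: "eventually (\<lambda>n. 1 - \<epsilon> / 8 < prob (near_start \<rho> n)) sequentially"
    using order_tendstoD(1)[OF prob_near_start_tendsto[OF \<rho>(1)], of "1 - \<epsilon> / 8"] \<epsilon> by simp
  have ev3: "eventually (\<lambda>n. 0 < prob (near_start \<rho> n)) sequentially"
    by (rule order_tendstoD(1)[OF prob_near_start_tendsto[OF \<rho>(1)]]) simp
  have "(\<lambda>n. (\<bar>b v0\<bar> + 1) * sqrt (1 / real n)) \<longlonglongrightarrow> (\<bar>b v0\<bar> + 1) * sqrt 0"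
    by (intro tendsto_mult tendsto_const tendsto_real_sqrt lim_1_over_n)
  then have ev4: "eventually (\<lambda>n. (\<bar>b v0\<bar> + 1) * sqrt (1 / real n) < \<epsilon> / 3) sequentially"
    by (rule order_tendstoD(2)) (use e3 in simp)
  from ev1 ev2 ev3 ev4 eventually_ge_at_top[of 1] show ?thesis
  proof eventually_elim
    case (elim n)
    have n: "1 \<le> n" by fact
    let ?L = "lam K n"
    have L: "0 < ?L" by (rule lam_pos[OF n])
    obtain J where J: "stoch_integral (\<lambda>s \<omega>. averaged_kern n (N n) s * \<sigma> (v s \<omega>)) J"
      "AE \<omega> in M. grid_mean n (N n) \<omega> = v0 + (\<Sum>j=1..N n. 1 / real (N n) *
        (LBINT s:{0..real j / real (N n) / real n}. K (real j / real (N n) / real n - s) * b (v s \<omega>))) + J \<omega>"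
      using grid_mean_equation[OF n N(1)] by blast
    obtain X0 V where X0: "X0 \<in> borel_measurable M"
      "0 < V \<Longrightarrow> distributed M lborel X0 (normal_density 0 (sqrt V))" "0 \<le> V"
      "\<bar>sqrt (?L * V) - ?w n\<bar> \<le> 2 * \<eta>"
      "\<And>\<delta>. 0 < \<delta> \<Longrightarrow> \<P>(\<omega> in M. \<bar>J \<omega> - X0 \<omega>\<bar> > \<delta> / sqrt ?L)
        \<le> 1 - prob (near_start \<rho> n) + 160 * \<eta>\<^sup>2 / \<delta>\<^sup>2"
      using gaussian_coupling[OF n \<eta>(1) \<rho>(2) _ J(1)] elim(3) by blast
    define X where "X \<omega> = 0 + sqrt ?L * X0 \<omega>" for \<omega>
    let ?s = "sqrt (?L * V)"
    have s: "\<bar>?s - limit_deviation\<bar> < \<epsilon>" using X0(4) elim(1) \<eta>(2) by linarith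
    then have spos: "0 < ?s" using \<epsilon> by linarith
    then have Vpos: "0 < V" using L by (simp add: zero_less_mult_iff)
    have "distributed M lborel X (normal_density (0 + sqrt ?L * 0) (\<bar>sqrt ?L\<bar> * sqrt V))"
      unfolding X_def[abs_def] using Vpos L by (intro normal_density_affine X0(2)) auto
    then have dX: "distributed M lborel X (normal_density 0 ?s)" using L by (simp add: real_sqrt_mult)
    let ?E1 = "{\<omega>\<in>space M. \<bar>sqrt ?L * (grid_mean n (N n) \<omega> - time_average v (1 / real n) \<omega>)\<bar> > \<epsilon> / 3}"
    let ?E2 = "space M - near_start \<rho> n"
    let ?E3 = "{\<omega>\<in>space M. \<bar>J \<omega> - X0 \<omega>\<bar> > (\<epsilon> / 3) / sqrt ?L}"
    have [measurable]: "J \<in> borel_measurable M" using J(1) by (simp add: stoch_integral_def)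
    note [measurable] = X0(1) grid_mean_measurable time_average_measurable[OF n] near_start_measurable[OF n]
    have "AE \<omega> in M. \<omega> \<in> {\<omega>\<in>space M. \<bar>scaled_deviation n \<omega> - X \<omega>\<bar> > \<epsilon>} \<longrightarrow> \<omega> \<in> ?E1 \<union> ?E2 \<union> ?E3"
      using J(2)
    proof eventually_elim
      case eq: (elim \<omega>)
      show ?case
      proof (intro impI, rule ccontr)
        assume w: "\<omega> \<in> {\<omega>\<in>space M. \<bar>scaled_deviation n \<omega> - X \<omega>\<bar> > \<epsilon>}" and out: "\<omega> \<notin> ?E1 \<union> ?E2 \<union> ?E3"
        then have 1: "\<bar>sqrt ?L * (grid_mean n (N n) \<omega> - time_average v (1 / real n) \<omega>)\<bar> \<le> \<epsilon> / 3"
          and 2: "\<omega> \<in> near_start \<rho> n" and 3: "\<bar>J \<omega> - X0 \<omega>\<bar> \<le> (\<epsilon> / 3) / sqrt ?L" by auto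
        from 3 L have 3: "\<bar>sqrt ?L * (J \<omega> - X0 \<omega>)\<bar> \<le> \<epsilon> / 3" by (simp add: abs_mult pos_le_divide_eq ac_simps)
        define D where "D j = (LBINT s:{0..real j / real (N n) / real n}. K (real j / real (N n) / real n - s) * b (v s \<omega>))" for j
        have drift: "\<bar>sqrt ?L * (\<Sum>j=1..N n. 1 / real (N n) * D j)\<bar> \<le> (\<bar>b v0\<bar> + 1) * sqrt (1 / real n)"
        proof -
          have "\<bar>sqrt ?L * (\<Sum>j=1..N n. 1 / real (N n) * D j)\<bar> = \<bar>\<Sum>j=1..N n. 1 / real (N n) * (sqrt ?L * D j)\<bar>"
            by (simp add: sum_distrib_left mult.left_commute)
          also have "\<dots> \<le> (\<Sum>j=1..N n. \<bar>1 / real (N n) * (sqrt ?L * D j)\<bar>)" by (rule sum_abs)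
          also have "\<dots> \<le> (\<Sum>j=1..N n. 1 / real (N n) * ((\<bar>b v0\<bar> + 1) * sqrt (1 / real n)))"
          proof (rule sum_mono)
            fix j assume "j \<in> {1..N n}"
            then have "real j / real (N n) \<le> 1" by simp
            then have "real j / real (N n) / real n \<le> 1 / real n" by (rule divide_right_mono) simp
            then have t: "real j / real (N n) / real n \<in> {0..1 / real n}" by simp
            have bnd: "\<bar>b (v s \<omega>)\<bar> \<le> \<bar>b v0\<bar> + 1" if "s \<in> {0..1 / real n}" for s
              using 2 that by (intro \<rho>(3)) (simp add: near_start_def)
            have "\<bar>sqrt ?L * D j\<bar> \<le> (\<bar>b v0\<bar> + 1) * sqrt (1 / real n)"
              using scaled_drift_le[OF n t _ bnd] L by (simp add: D_def abs_mult)
            then have "1 / real (N n) * \<bar>sqrt ?L * D j\<bar> \<le> 1 / real (N n) * ((\<bar>b v0\<bar> + 1) * sqrt (1 / real n))"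
              by (rule mult_left_mono) simp
            then show "\<bar>1 / real (N n) * (sqrt ?L * D j)\<bar> \<le> 1 / real (N n) * ((\<bar>b v0\<bar> + 1) * sqrt (1 / real n))"
              by (simp add: abs_mult)
          qed
          also have "\<dots> = (\<bar>b v0\<bar> + 1) * sqrt (1 / real n)" using N(1)[of n] by simp
          finally show ?thesis .
        qed
        have "scaled_deviation n \<omega> - X \<omega> = - (sqrt ?L * (grid_mean n (N n) \<omega> - time_average v (1 / real n) \<omega>))
            + sqrt ?L * (\<Sum>j=1..N n. 1 / real (N n) * D j) + sqrt ?L * (J \<omega> - X0 \<omega>)"
          unfolding scaled_deviation_def X_def eq D_def by (simp only: algebra_simps)
        then have "\<bar>scaled_deviation n \<omega> - X \<omega>\<bar> \<le> \<epsilon>" using 1 3 drift elim(4) by linarith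
        then show False using w by simp
      qed
    qed
    then have "\<P>(\<omega> in M. \<bar>scaled_deviation n \<omega> - X \<omega>\<bar> > \<epsilon>) \<le> prob (?E1 \<union> ?E2 \<union> ?E3)"
      by (rule finite_measure_mono_AE) measurable
    also have "\<dots> \<le> prob (?E1 \<union> ?E2) + prob ?E3" by (rule measure_Un_le) measurable
    also have "prob (?E1 \<union> ?E2) \<le> prob ?E1 + prob ?E2" by (rule measure_Un_le) measurable
    also have "prob ?E2 = 1 - prob (near_start \<rho> n)" by (rule prob_compl[OF near_start_measurable[OF n]])
    finally have "\<P>(\<omega> in M. \<bar>scaled_deviation n \<omega> - X \<omega>\<bar> > \<epsilon>) \<le> \<epsilon>"
      using N(3)[OF n] X0(5)[OF e3(1)] \<eta>2 elim(2) \<epsilon>(1) by linarith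
    with spos s dX show ?case by blast
  qed
qed

lemma digital_call_limit:
  assumes x: "(\<lambda>n. sqrt (lam K n) * (k n - v0)) \<longlonglongrightarrow> x"
  shows "(\<lambda>n. digital_call_price M v (1 / real n) (k n)) \<longlonglongrightarrow> 1 - cdf std_normal_distribution (x / limit_deviation)"
proof (rule LIMSEQ_imp_Suc)
  have price: "digital_call_price M v (1 / real (Suc n)) (k (Suc n)) =
      \<P>(\<omega> in M. scaled_deviation (Suc n) \<omega> \<ge> sqrt (lam K (Suc n)) * (k (Suc n) - v0))" for n
  proof -
    have L: "0 < sqrt (lam K (Suc n))" using lam_pos[of "Suc n"] by simp
    have "digital_call_price M v (1 / real (Suc n)) (k (Suc n)) = \<P>(\<omega> in M. time_average v (1 / real (Suc n)) \<omega> \<ge> k (Suc n))"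
      using time_average_measurable[of "Suc n"] by (simp add: digital_call_price_def)
    also have "{\<omega> \<in> space M. time_average v (1 / real (Suc n)) \<omega> \<ge> k (Suc n)} =
        {\<omega>\<in>space M. scaled_deviation (Suc n) \<omega> \<ge> sqrt (lam K (Suc n)) * (k (Suc n) - v0)}"
      unfolding scaled_deviation_def using mult_le_cancel_left_pos[OF L] by auto
    finally show ?thesis .
  qed
  show "(\<lambda>n. digital_call_price M v (1 / real (Suc n)) (k (Suc n))) \<longlonglongrightarrow> 1 - cdf std_normal_distribution (x / limit_deviation)"
    unfolding price
  proof (rule prob_ge_tendsto_normal_tail[OF _ limit_deviation_pos])
    show "(\<lambda>n. sqrt (lam K (Suc n)) * (k (Suc n) - v0)) \<longlonglongrightarrow> x" by (rule LIMSEQ_Suc[OF x])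
    show "scaled_deviation (Suc n) \<in> borel_measurable M" for n by (rule scaled_deviation_measurable) simp
    fix \<epsilon> assume "0 < \<epsilon>" "\<epsilon> < limit_deviation"
    from normal_approximation[OF this]
    show "eventually (\<lambda>n. \<exists>X s. 0 < s \<and> \<bar>s - limit_deviation\<bar> < \<epsilon> \<and> distributed M lborel X (normal_density 0 s) \<and>
       \<P>(\<omega> in M. \<bar>scaled_deviation (Suc n) \<omega> - X \<omega>\<bar> > \<epsilon>) \<le> \<epsilon>) sequentially"
      by (subst eventually_sequentially_Suc)
  qed
qed

end

lemma isCont_of_hoelder:
  fixes f :: "real \<Rightarrow> real"
  assumes h: "\<And>x y. \<bar>f y - f x\<bar> \<le> C * \<bar>y - x\<bar> powr p" and "0 < p"
  shows "isCont f x"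
proof -
  have "((\<lambda>y. \<bar>y - x\<bar> powr p) \<longlongrightarrow> 0) (at x)"
  proof (rule tendsto_zero_powrI[OF _ tendsto_const])
    show "((\<lambda>y. \<bar>y - x\<bar>) \<longlongrightarrow> 0) (at x)"
      by (intro tendsto_rabs_zero LIM_zero tendsto_ident_at)
  qed (use \<open>0 < p\<close> in auto)
  from tendsto_mult_right_zero[OF this, of C]
  have "((\<lambda>y. f y - f x) \<longlongrightarrow> 0) (at x)"
    by (rule Lim_null_comparison[rotated]) (simp add: h)
  then show ?thesis unfolding isCont_def by (rule LIM_zero_cancel)
qed

theorem proposition2p9:
  fixes b \<sigma> K Kbar :: "real \<Rightarrow> real"
    and C Cs \<chi>b \<chi>\<sigma> \<gamma> \<gamma>s \<gamma>bar v0 a \<beta> :: real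
    and M :: "'w measure" and F :: "real \<Rightarrow> 'w measure"
    and B v :: "real \<Rightarrow> 'w \<Rightarrow> real"
  assumes K: "L2_loc K"
    and parameters: "C > 0" "Cs > 0" "\<chi>b \<in> {0<..1}" "\<chi>\<sigma> \<in> {0<..1}" "\<gamma> > 0" "\<gamma>s > 0"
    and b_hoelder: "\<And>x y. \<bar>b y - b x\<bar> \<le> C * \<bar>y - x\<bar> powr \<chi>b"
    and \<sigma>_hoelder: "\<And>x y. \<bar>\<sigma> y - \<sigma> x\<bar> \<le> C * \<bar>y - x\<bar> powr \<chi>\<sigma>"
    and K_bounds: "\<And>t. t \<in> {0<..1} \<Longrightarrow>
          Cs * t powr (2 * \<gamma>s) \<le> (LBINT s:{0..t}. (K s)\<^sup>2) \<and>
          (LBINT s:{0..t}. (K s)\<^sup>2) \<le> C * t powr (2 * \<gamma>)"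
    and cond1: "\<gamma>s < min (\<gamma> + 1 / 2) (\<gamma> * (1 + \<chi>\<sigma>))"
    and Kbar: "L2_loc Kbar"
    and cond2: "\<And>s t. 0 \<le> s \<Longrightarrow> s \<le> t \<Longrightarrow> t \<le> 1 \<Longrightarrow>
          (\<lambda>n. lam K n * (LBINT r:{0..s / real n}. K ((t - s) / real n + r) * K r))
            \<longlonglongrightarrow> (LBINT r:{0..s}. Kbar (t - s + r) * Kbar r)"
    and \<gamma>bar: "\<gamma>bar > 0"
    and cond3: "\<And>T. T > 0 \<Longrightarrow> \<exists>CT>0. \<forall>h\<in>{0<..1}.
          (LBINT s:{0..T}. \<bar>K (s + h) - K s\<bar>\<^sup>2) \<le> CT * h powr (2 * \<gamma>bar)"
    and \<gamma>'_eq: "min \<gamma> \<gamma>bar = \<gamma>s"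
    and sol: "continuous_weak_solution K b \<sigma> v0 M F B v"
    and v_nonneg: "AE \<omega> in M. \<forall>t\<ge>0. v t \<omega> \<ge> 0"
    and \<sigma>_pos: "\<sigma> v0 > 0"
    and \<beta>: "\<beta> > 0"
  shows
    "(a = 0 \<longrightarrow> (\<lambda>n. digital_call_price M v (1 / real n) v0) \<longlonglongrightarrow> 1 / 2) \<and>
     (a \<noteq> 0 \<and> \<beta> > \<gamma>s \<longrightarrow>
        (\<lambda>n. digital_call_price M v (1 / real n) (v0 + real n powr (- \<beta>) * a)) \<longlonglongrightarrow> 1 / 2) \<and>
     (\<forall>Clam>0. a \<noteq> 0 \<and> \<beta> = \<gamma>s \<and> (\<lambda>n. sqrt (lam K n)) \<sim>[sequentially] (\<lambda>n. Clam * real n powr \<gamma>s) \<longrightarrow>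
        (\<lambda>n. digital_call_price M v (1 / real n) (v0 + real n powr (- \<gamma>s) * a)) \<longlonglongrightarrow>
          1 - cdf std_normal_distribution
                (inverse (\<sigma> v0) * Clam * a / sqrt (LBINT s:{0..1}. (LBINT t:{0..s}. Kbar t)\<^sup>2)))"
proof -
  have kernel: "small_time_kernel K Kbar C Cs \<gamma> \<gamma>s \<gamma>bar"
    unfolding small_time_kernel_def using K parameters K_bounds Kbar cond2 cond3[of 1] \<gamma>'_eq by auto
  have brown: "brownian_space M F B"
    using sol by (intro brownian_space.intro brownian_space_axioms.intro) (simp_all add: continuous_weak_solution_def)
  have "isCont b v0" by (rule isCont_of_hoelder[OF b_hoelder]) (use parameters in simp)
  moreover have "isCont \<sigma> v0" by (rule isCont_of_hoelder[OF \<sigma>_hoelder]) (use parameters in simp)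
  ultimately interpret small_time_volterra K Kbar C Cs \<gamma> \<gamma>s \<gamma>bar M F B b \<sigma> v v0
    by (intro small_time_volterra.intro small_time_volterra_axioms.intro kernel brown sol \<sigma>_pos)
  have half: "1 - cdf std_normal_distribution (0 / limit_deviation) = 1 / 2"
    by (simp add: std_normal_cdf_0)
  show ?thesis
  proof (intro conjI impI allI)
    show "(\<lambda>n. digital_call_price M v (1 / real n) v0) \<longlonglongrightarrow> 1 / 2"
      using digital_call_limit[of "\<lambda>_. v0" 0] unfolding half by simp
  next
    assume "a \<noteq> 0 \<and> \<beta> > \<gamma>s"
    then have \<beta>': "\<gamma>s - \<beta> < 0" by simp
    have "(\<lambda>n. sqrt (lam K n) * (real n powr (- \<beta>) * a)) \<longlonglongrightarrow> 0"
    proof (rule Lim_null_comparison)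
      show "eventually (\<lambda>n. norm (sqrt (lam K n) * (real n powr (- \<beta>) * a)) \<le> \<bar>a\<bar> / sqrt Cs * real n powr (\<gamma>s - \<beta>)) sequentially"
        using eventually_ge_at_top[of 1]
      proof eventually_elim
        case (elim n)
        have "sqrt (lam K n) \<le> sqrt (real n powr (2 * \<gamma>s) / Cs)" by (rule real_sqrt_le_mono[OF lam_upper[OF elim]])
        also have "\<dots> = real n powr \<gamma>s / sqrt Cs"
          using elim by (simp add: real_sqrt_divide powr_half_sqrt[symmetric] powr_powr)
        finally have "sqrt (lam K n) * (real n powr (- \<beta>) * \<bar>a\<bar>) \<le> real n powr \<gamma>s / sqrt Cs * (real n powr (- \<beta>) * \<bar>a\<bar>)"
          by (intro mult_right_mono) auto
        also have "\<dots> = \<bar>a\<bar> / sqrt Cs * real n powr (\<gamma>s - \<beta>)"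
          by (simp add: powr_diff powr_minus divide_inverse)
        finally show ?case using lam_pos[OF elim] by (simp add: abs_mult)
      qed
      show "(\<lambda>n. \<bar>a\<bar> / sqrt Cs * real n powr (\<gamma>s - \<beta>)) \<longlonglongrightarrow> 0"
        by (intro tendsto_mult_right_zero tendsto_neg_powr[OF \<beta>'] filterlim_real_sequentially)
    qed
    then show "(\<lambda>n. digital_call_price M v (1 / real n) (v0 + real n powr (- \<beta>) * a)) \<longlonglongrightarrow> 1 / 2"
      using digital_call_limit[of "\<lambda>n. v0 + real n powr (- \<beta>) * a" 0] unfolding half by simp
  next
    fix Clam :: real
    assume Clam: "0 < Clam"
      and as: "a \<noteq> 0 \<and> \<beta> = \<gamma>s \<and> (\<lambda>n. sqrt (lam K n)) \<sim>[sequentially] (\<lambda>n. Clam * real n powr \<gamma>s)"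
    have "(\<lambda>n. sqrt (lam K n) / (Clam * real n powr \<gamma>s)) \<longlonglongrightarrow> 1"
    proof (rule asymp_equivD_strong)
      show "(\<lambda>n. sqrt (lam K n)) \<sim>[sequentially] (\<lambda>n. Clam * real n powr \<gamma>s)" using as by blast
      show "eventually (\<lambda>n. sqrt (lam K n) \<noteq> 0 \<or> Clam * real n powr \<gamma>s \<noteq> 0) sequentially"
        using eventually_ge_at_top[of 1] by eventually_elim (use lam_pos in force)
    qed
    from tendsto_mult[OF this tendsto_const[of "Clam * a"]]
    have "(\<lambda>n. sqrt (lam K n) * (real n powr (- \<gamma>s) * a)) \<longlonglongrightarrow> Clam * a"
      using Clam by (simp add: powr_minus field_simps)
    from digital_call_limit[of "\<lambda>n. v0 + real n powr (- \<gamma>s) * a", simplified, OF this]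
    show "(\<lambda>n. digital_call_price M v (1 / real n) (v0 + real n powr (- \<gamma>s) * a)) \<longlonglongrightarrow>
          1 - cdf std_normal_distribution
                (inverse (\<sigma> v0) * Clam * a / sqrt (LBINT s:{0..1}. (LBINT t:{0..s}. Kbar t)\<^sup>2))"
      by (simp add: limit_deviation_def limit_variance_def field_simps)
  qed
qed

end
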